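(* For any $\epsilon>0$, there is a polynomial time two-sided distribution-free adaptive algorithm for $\epsilon$-testing $k$-Term that makes $\tilde O(k/\epsilon)$ queries.
   Context: Boolean functions $f:\{0,1\}^n\to\{0,1\}$ are accessed through a membership-query oracle that returns $f(x)$ for a queried $x$. For a distribution $\mathcal D$ on $\{0,1\}^n$, $f$ is $\epsilon$-far from a class $C$ with respect to $\mathcal D$ if $\Pr_{x\sim\mathcal D}[f(x)\neq g(x)]\ge\epsilon$ for every $g\in C$. A two-sided distribution-free adaptive algorithm for $\epsilon$-testing $C$ is a randomized algorithm that, given $\epsilon$, membership-query access to an arbitrary $f$, and an oracle returning independent samples from an arbitrary unknown distribution $\mathcal D$ on $\{0,1\}^n$, chooses queries possibly adaptively and, for every $\mathcal D$, accepts with probability at least $2/3$ if $f\in C$ and rejects with probability at least $2/3$ if $f$ is $\epsilon$-far from every function in $C$ with respect to $\mathcal D$. Queries count membership queries and samples. $\tilde O(T)$ means $O(T\cdot\mathrm{poly}(\log T))$. A term is a conjunction of literals (variables or negated variables); $k$-Term is the class of all terms with at most $k$ literals. *)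

theory Defs
  imports "HOL-Probability.Probability"
begin

section \<open>Terms and distance\<close>

text \<open>Points of the cube are Boolean lists of length \<open>n\<close>. A Boolean function is a function on lists of
  which only the values on the cube matter.\<close>

definition cube :: "nat \<Rightarrow> bool list set" where
  "cube n = {x. length x = n}"

text \<open>The literal \<open>(i, True)\<close> is the variable \<open>i\<close>, and \<open>(i, False)\<close> is its negation.\<close>

type_synonym literal = "nat \<times> bool"

definition eval_literal :: "literal \<Rightarrow> bool list \<Rightarrow> bool" where
  "eval_literal l x \<longleftrightarrow> x ! fst l = snd l"

text \<open>The empty conjunction is the constant true function. A conjunction may contain a
  variable together with its negation, and is then the constant false function.\<close>

definition k_Term :: "nat \<Rightarrow> nat \<Rightarrow> (bool list \<Rightarrow> bool) set" where
  "k_Term n k = {g. \<exists>L \<subseteq> {..<n} \<times> (UNIV :: bool set). card L \<le> k \<and>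
     (\<forall>x \<in> cube n. g x \<longleftrightarrow> (\<forall>l \<in> L. eval_literal l x))}"

definition eps_far ::
  "bool list pmf \<Rightarrow> real \<Rightarrow> (bool list \<Rightarrow> bool) set \<Rightarrow> (bool list \<Rightarrow> bool) \<Rightarrow> bool" where
  "eps_far D \<epsilon> C f \<longleftrightarrow> (\<forall>g \<in> C. measure_pmf.prob D {x. f x \<noteq> g x} \<ge> \<epsilon>)"


section \<open>Randomized oracle algorithms\<close>

text \<open>
  Algorithms are programs of a random access machine with fair coins, a membership oracle and a
  sampling oracle. The memory consists of arrays of natural numbers; \<open>Read a e\<close> is the
  entry of array \<open>a\<close> at index \<open>e\<close>. Each command is charged one unit of time, except
  that an oracle call transfers \<open>n\<close> bits and is charged \<open>n + 1\<close>. There is deliberately no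
  multiplication: the bit length of a value grows only by a constant per time unit, so that this
  uniform cost measure is polynomially related to Turing machine time. Expressions are not
  charged by size, because their size is bounded by a constant depending on the program only.
\<close>

datatype expr =
    Const nat
  | Read nat expr
  | Add expr expr
  | Sub expr expr
  | Div expr expr
  | Mod expr expr
  | Less expr expr
  | Equal expr expr

type_synonym memory = "nat \<Rightarrow> nat \<Rightarrow> nat"

primrec eval_expr :: "expr \<Rightarrow> memory \<Rightarrow> nat" where
  "eval_expr (Const c) m = c"
| "eval_expr (Read a e) m = m a (eval_expr e m)"
| "eval_expr (Add e e') m = eval_expr e m + eval_expr e' m"
| "eval_expr (Sub e e') m = eval_expr e m - eval_expr e' m"
| "eval_expr (Div e e') m = eval_expr e m div eval_expr e' m"
| "eval_expr (Mod e e') m = eval_expr e m mod eval_expr e' m"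
| "eval_expr (Less e e') m = of_bool (eval_expr e m < eval_expr e' m)"
| "eval_expr (Equal e e') m = of_bool (eval_expr e m = eval_expr e' m)"

text \<open>\<open>Store a i e\<close> assigns \<open>e\<close> to entry \<open>i\<close> of array \<open>a\<close>; \<open>Flip a i\<close> assigns a fair random bit
  to it. \<open>Query a i b\<close> assigns to it the value of the tested function at the point stored in
  array \<open>b\<close>, and \<open>Sample b\<close> draws a random point into array \<open>b\<close>. Conditions hold if
  they evaluate to a nonzero number.\<close>

datatype com =
    Skip
  | Store nat expr expr
  | Flip nat expr
  | Query nat expr nat
  | Sample nat
  | Seq com com
  | Cond expr com com
  | While expr com

record config =
  mem :: memory
  time :: nat
  queries :: nat

definition write_entry :: "nat \<Rightarrow> nat \<Rightarrow> nat \<Rightarrow> memory \<Rightarrow> memory" where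
  "write_entry a i v m = m(a := (m a)(i := v))"

definition read_point :: "nat \<Rightarrow> nat \<Rightarrow> memory \<Rightarrow> bool list" where
  "read_point n b m = map (\<lambda>i. m b i \<noteq> 0) [0..<n]"

definition write_point :: "nat \<Rightarrow> nat \<Rightarrow> bool list \<Rightarrow> memory \<Rightarrow> memory" where
  "write_point n b x m = m(b := (\<lambda>i. if i < n then of_bool (x ! i) else m b i))"

definition tick :: "nat \<Rightarrow> config \<Rightarrow> config" where
  "tick t s = s\<lparr>time := time s + t\<rparr>"

definition count_query :: "config \<Rightarrow> config" where
  "count_query s = s\<lparr>queries := queries s + 1\<rparr>"

definition update_mem :: "(memory \<Rightarrow> memory) \<Rightarrow> config \<Rightarrow> config" where
  "update_mem h s = s\<lparr>mem := h (mem s)\<rparr>"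

text \<open>Mass missing from a subprobability distribution is the probability of nontermination.\<close>

partial_function (spmf) iterate :: "('s \<Rightarrow> bool) \<Rightarrow> ('s \<Rightarrow> 's spmf) \<Rightarrow> 's \<Rightarrow> 's spmf" where
  "iterate P c s = (if P s then bind_spmf (c s) (iterate P c) else return_spmf s)"

primrec exec ::
  "nat \<Rightarrow> (bool list \<Rightarrow> bool) \<Rightarrow> bool list pmf \<Rightarrow> com \<Rightarrow> config \<Rightarrow> config spmf" where
  "exec n f D Skip s = return_spmf (tick 1 s)"
| "exec n f D (Store a i e) s =
     return_spmf (tick 1 (update_mem (write_entry a (eval_expr i (mem s)) (eval_expr e (mem s))) s))"
| "exec n f D (Flip a i) s =
     map_spmf (\<lambda>b. tick 1 (update_mem (write_entry a (eval_expr i (mem s)) (of_bool b)) s))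
       (spmf_of_pmf (bernoulli_pmf (1 / 2)))"
| "exec n f D (Query a i b) s =
     return_spmf (tick (n + 1) (count_query
       (update_mem (write_entry a (eval_expr i (mem s)) (of_bool (f (read_point n b (mem s))))) s)))"
| "exec n f D (Sample b) s =
     map_spmf (\<lambda>x. tick (n + 1) (count_query (update_mem (write_point n b x) s)))
       (spmf_of_pmf D)"
| "exec n f D (Seq c c') s = bind_spmf (exec n f D c s) (exec n f D c')"
| "exec n f D (Cond e c c') s =
     (if eval_expr e (mem s) \<noteq> 0 then exec n f D c (tick 1 s) else exec n f D c' (tick 1 s))"
| "exec n f D (While e c) s =
     map_spmf (tick 1)
       (iterate (\<lambda>s. eval_expr e (mem s) \<noteq> 0) (\<lambda>s. exec n f D c (tick 1 s)) s)"


section \<open>Testers\<close>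

text \<open>The inputs \<open>n\<close>, \<open>k\<close>, \<open>p\<close>, \<open>q\<close> are in entry 0 of arrays 0 to 3, and the algorithm
  accepts if it halts with a nonzero number in entry 0 of array 4.\<close>

definition init :: "nat \<Rightarrow> nat \<Rightarrow> nat \<Rightarrow> nat \<Rightarrow> config" where
  "init n k p q =
     \<lparr>mem = (\<lambda>a i. if i = 0 \<and> a < 4 then [n, k, p, q] ! a else 0), time = 0, queries = 0\<rparr>"

definition run ::
  "com \<Rightarrow> nat \<Rightarrow> nat \<Rightarrow> nat \<Rightarrow> nat \<Rightarrow> (bool list \<Rightarrow> bool) \<Rightarrow> bool list pmf \<Rightarrow> config spmf" where
  "run A n k p q f D = exec n f D A (init n k p q)"

definition accepting :: "config \<Rightarrow> bool" where
  "accepting s \<longleftrightarrow> mem s 4 0 \<noteq> 0"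

text \<open>A real \<open>\<epsilon>\<close> is given to an algorithm as a fraction \<open>p / q\<close>. For rational \<open>\<epsilon>\<close> this
  can be \<open>\<epsilon>\<close> itself; in general the algorithm has to cope with every approximation from below
  that is correct up to a factor of two.\<close>

definition represents :: "nat \<Rightarrow> nat \<Rightarrow> real \<Rightarrow> bool" where
  "represents p q \<epsilon> \<longleftrightarrow> 0 < p \<and> 0 < q \<and> real p / real q \<le> \<epsilon> \<and> \<epsilon> \<le> 2 * (real p / real q)"

text \<open>In the next three definitions the program \<open>A\<close> is one and the same for all
  \<open>n\<close>, \<open>k\<close>, \<open>\<epsilon>\<close>, \<open>f\<close> and \<open>D\<close>.\<close>

definition two_sided_distribution_free_tester ::
  "com \<Rightarrow> (nat \<Rightarrow> nat \<Rightarrow> (bool list \<Rightarrow> bool) set) \<Rightarrow> bool" where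
  "two_sided_distribution_free_tester A C \<longleftrightarrow>
     (\<forall>n k \<epsilon> p q f D. k \<ge> 1 \<longrightarrow> \<epsilon> > 0 \<longrightarrow> represents p q \<epsilon> \<longrightarrow> set_pmf D \<subseteq> cube n \<longrightarrow>
        (f \<in> C n k \<longrightarrow>
           measure (measure_spmf (run A n k p q f D)) {s. accepting s} \<ge> 2 / 3) \<and>
        (eps_far D \<epsilon> (C n k) f \<longrightarrow>
           measure (measure_spmf (run A n k p q f D)) {s. \<not> accepting s} \<ge> 2 / 3))"

text \<open>Worst-case bounds over all runs. The queries counted are membership queries and samples.\<close>

definition query_bound :: "com \<Rightarrow> (nat \<Rightarrow> real \<Rightarrow> real) \<Rightarrow> bool" where
  "query_bound A B \<longleftrightarrow>
     (\<forall>n k \<epsilon> p q f D. k \<ge> 1 \<longrightarrow> \<epsilon> > 0 \<longrightarrow> represents p q \<epsilon> \<longrightarrow> set_pmf D \<subseteq> cube n \<longrightarrow>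
        (\<forall>s \<in> set_spmf (run A n k p q f D). real (queries s) \<le> B k \<epsilon>))"

text \<open>The bound does not involve \<open>k\<close>: literals in excess of \<open>2 * n\<close> are irrelevant.\<close>

definition polynomial_time :: "com \<Rightarrow> bool" where
  "polynomial_time A \<longleftrightarrow>
     (\<exists>c d :: nat. \<forall>n k \<epsilon> p q f D.
        k \<ge> 1 \<longrightarrow> \<epsilon> > 0 \<longrightarrow> represents p q \<epsilon> \<longrightarrow> set_pmf D \<subseteq> cube n \<longrightarrow>
        lossless_spmf (run A n k p q f D) \<and>
        (\<forall>s \<in> set_spmf (run A n k p q f D).
           real (time s) \<le> real c * (real n + 1 / \<epsilon> + 1) ^ d))"

text \<open>\<open>B\<close> is bounded by \<open>T\<close> times a polynomial in \<open>log T\<close>, with constants that do not depend on \<open>k\<close>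
  and \<open>\<epsilon>\<close>. The logarithm is shifted so that it is at least 1 also for small \<open>T\<close>.\<close>

definition soft_O :: "(nat \<Rightarrow> real \<Rightarrow> real) \<Rightarrow> (nat \<Rightarrow> real \<Rightarrow> real) set" where
  "soft_O T = {B. \<exists>c d :: nat. \<forall>k \<epsilon>. k \<ge> 1 \<longrightarrow> \<epsilon> > 0 \<longrightarrow>
     B k \<epsilon> \<le> real c * T k \<epsilon> * log 2 (2 + T k \<epsilon>) ^ d}"

end

(* A satisfying point a of a term f turns X |-> not f(a xor X) into a disjunction over the set S of
   variables of f, with |S| <= k. The tester samples until it finds such a point, hashes the variables
   into about k^2 random blocks, which separates S, and then finds by binary search the blocks that
   meet S: whenever a sample is negative already on the unmarked blocks, one of them is marked. As only
   k blocks can ever be marked, O(k / epsilon) samples leave a miss probability of order epsilon.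

   Let F(X) be the set of marked blocks c for which the disjunction holds on X restricted to c. For a
   term, every marked block contains exactly one variable, so F is a homomorphism for symmetric
   difference and intersection. The BLR argument applied to the vector-valued F (rather than
   to each block separately, which would cost a factor log k) shows conversely that if F passes random
   tests of this kind and agrees with its self-correction on most samples, then f is close to a term with
   at most one variable per block. A trial costs O(k) queries and O(1 / epsilon) trials suffice. *)

theory Submission
  imports Defs
begin

section \<open>Programs and their abstract counterparts\<close>

text \<open>The analysis is carried out for distributions and transferred to the machine by a
  coupling, \<open>sim\<close>, that also carries worst-case bounds on time and queries. Two
  obstacles shape the tests. First, neither an intersection of two random sets nor the difference
  between a sample and \<open>a\<close> is uniformly distributed, so closeness of \<open>F\<close>
  to a homomorphism at uniform points says nothing about \<open>F\<close> there; such arguments are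
  shifted by a fresh uniform set, which makes both shifted points uniform. Second, on a function
  that is not a term the discovery of blocks may produce anything, so soundness has to hold for
  every colouring and may use only that there are at most \<open>k\<close> colours. For a term there
  are just two sources of error once a satisfying point is known: a collision of relevant variables
  in one block, and samples that differ from \<open>a\<close> in a relevant variable whose block is
  still unmarked. The integer \<open>E = q div p + 1\<close> stands for 1/\<epsilon>. The logarithm
  in the query bound is the length of a bisection, which is charged to every sample of the
  discovery.\<close>

primrec for_pmf :: "(nat \<Rightarrow> 'a \<Rightarrow> 'a pmf) \<Rightarrow> nat \<Rightarrow> nat \<Rightarrow> 'a \<Rightarrow> 'a pmf" where
  "for_pmf B 0 j a = return_pmf a"
| "for_pmf B (Suc d) j a = bind_pmf (B j a) (for_pmf B d (Suc j))"

text \<open>The recursion peels off the first iteration, as a running loop does. Random bit strings,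
  block maps and random sets are analysed by adding the last coordinate, hence this second
  unfolding.\<close>

lemma for_pmf_snoc:
  "for_pmf B (Suc d) j a = bind_pmf (for_pmf B d j a) (B (j + d))"
proof (induction d arbitrary: j a)
  case 0
  have "for_pmf B 0 k = return_pmf" for k
    by (rule ext) simp
  then show ?case by (simp add: bind_return_pmf bind_return_pmf')
next
  case (Suc d)
  have IH: "for_pmf B (Suc d) (Suc j) = (\<lambda>b. bind_pmf (for_pmf B d (Suc j) b) (B (Suc j + d)))"
    by (rule ext) (rule Suc.IH)
  have "for_pmf B (Suc (Suc d)) j a = bind_pmf (B j a) (for_pmf B (Suc d) (Suc j))"
    by (rule for_pmf.simps(2))
  also have "\<dots> = bind_pmf (for_pmf B (Suc d) j a) (B (j + Suc d))"
    unfolding IH for_pmf.simps(2)[of B d j a] by (simp add: bind_assoc_pmf)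
  finally show ?case .
qed

lemma for_pmf_return [simp]: "for_pmf (\<lambda>_. return_pmf) d j a = return_pmf a"
  by (induction d arbitrary: j a) (simp_all add: bind_return_pmf)

text \<open>Frames are kept at the granularity of whole arrays, which is why each scalar variable of
  the programs lives in an array of its own.\<close>

primrec mods :: "com \<Rightarrow> nat set" where
  "mods Skip = {}"
| "mods (Store a i e) = {a}"
| "mods (Flip a i) = {a}"
| "mods (Query a i b) = {a}"
| "mods (Sample b) = {b}"
| "mods (Seq c c') = mods c \<union> mods c'"
| "mods (Cond e c c') = mods c \<union> mods c'"
| "mods (While e c) = mods c"

abbreviation (input) eq_off :: "nat set \<Rightarrow> memory \<Rightarrow> memory \<Rightarrow> bool" where
  "eq_off X m' m \<equiv> \<forall>x. x \<notin> X \<longrightarrow> m' x = m x"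

abbreviation (input) outcome ::
  "(memory \<Rightarrow> 'a \<Rightarrow> bool) \<Rightarrow> nat set \<Rightarrow> memory \<Rightarrow> config \<Rightarrow> nat \<Rightarrow> nat \<Rightarrow> config \<Rightarrow> 'a \<Rightarrow> bool" where
  "outcome Q X m s T N s' a \<equiv> Q (mem s') a \<and> eq_off X (mem s') m \<and>
     time s' \<le> time s + T \<and> queries s' \<le> queries s + N"

section \<open>Couplings between programs and distributions\<close>

locale testing =
  fixes n :: nat and f :: "bool list \<Rightarrow> bool" and D :: "bool list pmf"
begin

text \<open>A coupling of the run of \<open>c\<close> with an idealised distribution
  \<open>M\<close> of abstract results. The second component has total mass 1, so the relation
  forces termination with probability 1. Since every configuration in the support is related to some
  result, the bounds on time and queries hold for each single run and not only on average.\<close>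

definition sim ::
  "com \<Rightarrow> memory \<Rightarrow> 'a pmf \<Rightarrow> (memory \<Rightarrow> 'a \<Rightarrow> bool) \<Rightarrow> nat \<Rightarrow> nat \<Rightarrow> bool" where
  "sim c m M Q T N \<longleftrightarrow> (\<forall>s. mem s = m \<longrightarrow>
     rel_spmf (outcome Q (mods c) m s T N) (exec n f D c s) (spmf_of_pmf M))"

text \<open>The new postcondition may be derived with the help of the frame and of the support of
  \<open>M\<close>, so postconditions need not list the arrays that a program leaves alone.\<close>

lemma sim_conseq:
  assumes "sim c m M Q T N"
    and "\<And>m' a. Q m' a \<Longrightarrow> a \<in> set_pmf M \<Longrightarrow> eq_off (mods c) m' m \<Longrightarrow> Q' m' a"
    and "T \<le> T'" "N \<le> N'"
  shows "sim c m M Q' T' N'"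
  unfolding sim_def
proof (intro allI impI)
  fix s :: config assume "mem s = m"
  then have "rel_spmf (outcome Q (mods c) m s T N) (exec n f D c s) (spmf_of_pmf M)"
    using assms(1) unfolding sim_def by blast
  then show "rel_spmf (outcome Q' (mods c) m s T' N') (exec n f D c s) (spmf_of_pmf M)"
    by (rule rel_spmf_mono_strong) (use assms(2-) in \<open>force intro: order_trans\<close>)
qed

lemma sim_map:
  assumes "sim c m M (\<lambda>m' a. Q m' (h a)) T N"
  shows "sim c m (map_pmf h M) Q T N"
  using assms unfolding sim_def by (simp add: spmf_rel_map flip: map_spmf_of_pmf)

lemma sim_Skip: "Q m x \<Longrightarrow> sim Skip m (return_pmf x) Q 1 0"
  by (simp add: sim_def tick_def rel_pmf_return_pmf1)

lemma sim_Store: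
  "Q (write_entry a (eval_expr i m) (eval_expr e m) m) x \<Longrightarrow>
   sim (Store a i e) m (return_pmf x) Q 1 0"
  by (simp add: sim_def tick_def update_mem_def write_entry_def rel_pmf_return_pmf1)

lemma sim_Query:
  "Q (write_entry a (eval_expr i m) (of_bool (f (read_point n b m))) m) x \<Longrightarrow>
   sim (Query a i b) m (return_pmf x) Q (n + 1) 1"
  by (simp add: sim_def tick_def update_mem_def count_query_def write_entry_def rel_pmf_return_pmf1)

lemma sim_Sample:
  assumes "\<And>x. x \<in> set_pmf D \<Longrightarrow> Q (write_point n b x m) x"
  shows "sim (Sample b) m D Q (n + 1) 1"
  using assms
  by (auto simp: sim_def tick_def update_mem_def count_query_def write_point_def pmf.rel_map
    intro!: rel_pmf_reflI)

lemma sim_Flip: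
  assumes "\<And>b. Q (write_entry a (eval_expr i m) (of_bool b) m) b"
  shows "sim (Flip a i) m (bernoulli_pmf (1 / 2)) Q 1 0"
  using assms
  by (auto simp: sim_def tick_def update_mem_def write_entry_def pmf.rel_map
    intro!: rel_pmf_reflI)

lemma sim_Seq:
  assumes "sim c m M Q1 T1 N1"
    and "\<And>m' a. Q1 m' a \<Longrightarrow> a \<in> set_pmf M \<Longrightarrow> eq_off (mods c) m' m \<Longrightarrow>
      sim c' m' (M2 a) Q T2 N2"
  shows "sim (Seq c c') m (bind_pmf M M2) Q (T1 + T2) (N1 + N2)"
  unfolding sim_def
proof (intro allI impI)
  fix s :: config assume s: "mem s = m"
  \<comment> \<open>The support of \<open>M\<close> is recorded inside the relation, because the
    hypothesis on the second program refers to it.\<close>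
  have 1: "rel_spmf (\<lambda>s' a. (Q1 (mem s') a \<and> eq_off (mods c) (mem s') m \<and>
         time s' \<le> time s + T1 \<and> queries s' \<le> queries s + N1) \<and> a \<in> set_pmf M)
       (exec n f D c s) (spmf_of_pmf M)"
    using assms(1) s unfolding sim_def
    by (auto elim!: rel_spmf_mono_strong)
  have eq: "spmf_of_pmf (bind_pmf M M2) = bind_spmf (spmf_of_pmf M) (\<lambda>a. spmf_of_pmf (M2 a))"
    by (simp add: spmf_of_pmf_bind)
  show "rel_spmf (outcome Q (mods (Seq c c')) m s (T1 + T2) (N1 + N2)) (exec n f D (Seq c c') s) (spmf_of_pmf (bind_pmf M M2))"
    unfolding eq exec.simps
  proof (rule rel_spmf_bindI[OF 1])
    fix s1 :: config and a
    assume a: "(Q1 (mem s1) a \<and> (\<forall>x. x \<notin> mods c \<longrightarrow> mem s1 x = m x) \<and>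
         time s1 \<le> time s + T1 \<and> queries s1 \<le> queries s + N1) \<and> a \<in> set_pmf M"
    then have "sim c' (mem s1) (M2 a) Q T2 N2"
      using assms(2) by blast
    then have "rel_spmf (\<lambda>s' a. Q (mem s') a \<and> (\<forall>x. x \<notin> mods c' \<longrightarrow> mem s' x = mem s1 x) \<and>
         time s' \<le> time s1 + T2 \<and> queries s' \<le> queries s1 + N2)
       (exec n f D c' s1) (spmf_of_pmf (M2 a))"
      unfolding sim_def by blast
    then show "rel_spmf (outcome Q (mods (Seq c c')) m s (T1 + T2) (N1 + N2)) (exec n f D c' s1) (spmf_of_pmf (M2 a))"
      by (rule rel_spmf_mono) (use a in auto)
  qed
qed

lemma sim_Seq_det:
  assumes "sim c m (return_pmf x) Q1 T1 N1"
    and "\<And>m'. Q1 m' x \<Longrightarrow> eq_off (mods c) m' m \<Longrightarrow> sim c' m' M Q T2 N2"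
  shows "sim (Seq c c') m M Q (T1 + T2) (N1 + N2)"
  using sim_Seq[of c m "return_pmf x" Q1 T1 N1 c' "\<lambda>_. M" Q T2 N2] assms
  by (simp add: bind_return_pmf)

lemma sim_Seq_Store:
  assumes "sim c (write_entry a (eval_expr i m) (eval_expr e m) m) M Q T N"
  shows "sim (Seq (Store a i e) c) m M Q (1 + T) (0 + N)"
proof (rule sim_Seq_det[OF sim_Store[where x = "()" and
      Q = "\<lambda>m' _. m' = write_entry a (eval_expr i m) (eval_expr e m) m"]])
  fix m' assume "m' = write_entry a (eval_expr i m) (eval_expr e m) m"
  with assms show "sim c m' M Q T N" by simp
qed simp

lemma sim_Seq_post:
  assumes "sim c m M Q1 T1 N1"
    and "\<And>m' a. Q1 m' a \<Longrightarrow> a \<in> set_pmf M \<Longrightarrow> eq_off (mods c) m' m \<Longrightarrow>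
      sim c' m' (return_pmf (h a)) Q T2 N2"
  shows "sim (Seq c c') m (map_pmf h M) Q (T1 + T2) (N1 + N2)"
  using sim_Seq[of c m M Q1 T1 N1 c' "\<lambda>a. return_pmf (h a)" Q T2 N2] assms
  by (simp add: map_pmf_def)

lemma sim_Cond:
  assumes "eval_expr e m \<noteq> 0 \<Longrightarrow> sim c m M Q T N"
    and "eval_expr e m = 0 \<Longrightarrow> sim c' m M Q T N"
  shows "sim (Cond e c c') m M Q (T + 1) N"
  unfolding sim_def
proof (intro allI impI)
  fix s :: config assume s: "mem s = m"
  let ?c = "if eval_expr e m \<noteq> 0 then c else c'"
  have "sim ?c m M Q T N"
    using assms by simp
  moreover have "mem (tick 1 s) = m"
    using s by (simp add: tick_def)
  ultimately have "rel_spmf (outcome Q (mods ?c) m (tick 1 s) T N) (exec n f D ?c (tick 1 s)) (spmf_of_pmf M)"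
    unfolding sim_def by blast
  moreover have "exec n f D (Cond e c c') s = exec n f D ?c (tick 1 s)"
    using s by simp
  ultimately show "rel_spmf (outcome Q (mods (Cond e c c')) m s (T + 1) N) (exec n f D (Cond e c c') s) (spmf_of_pmf M)"
    by (auto elim!: rel_spmf_mono simp: tick_def split: if_splits)
qed

end

section \<open>Counting loops\<close>

definition For :: "nat \<Rightarrow> expr \<Rightarrow> com \<Rightarrow> com" where
  "For v e c = Seq (Store v (Const 0) (Const 0))
     (While (Less (Read v (Const 0)) e)
       (Seq c (Store v (Const 0) (Add (Read v (Const 0)) (Const 1)))))"

lemma mods_For [simp]: "mods (For v e c) = insert v (mods c)"
  by (auto simp: For_def)

context testing
begin

text \<open>\<open>I j\<close> describes the state after \<open>j\<close> iterations. The body has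
  to establish \<open>I (Suc j)\<close> for the memory with the counter already incremented, as this
  is the state at the next test. The bound is evaluated anew at each test and hence has to be
  constant along the invariant. The cost \<open>T + 2\<close> is that of the body, the test and the
  increment; the other 2 units are the initialisation and the last test.\<close>

lemma sim_For:
  assumes bound: "\<And>m' j a. I j m' a \<Longrightarrow> eq_off (insert v (mods c)) m' m \<Longrightarrow>
      eval_expr e m' = L"
    and init: "I 0 (write_entry v 0 0 m) a"
    and body: "\<And>m' j a. I j m' a \<Longrightarrow> j < L \<Longrightarrow> m' v 0 = j \<Longrightarrow>
      eq_off (insert v (mods c)) m' m \<Longrightarrow>
      sim c m' (B j a) (\<lambda>m'' a'. I (Suc j) (write_entry v 0 (Suc j) m'') a' \<and> m'' v 0 = j) T N"
  shows "sim (For v e c) m (for_pmf B L 0 a) (I L) (2 + L * (T + 2)) (L * N)"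
proof -
  let ?b = "Seq c (Store v (Const 0) (Add (Read v (Const 0)) (Const 1)))"
  let ?P = "\<lambda>s. eval_expr (Less (Read v (Const 0)) e) (mem s) \<noteq> 0"
  let ?C = "\<lambda>s. exec n f D ?b (tick 1 s)"
  let ?fr = "\<lambda>m'. eq_off (insert v (mods c)) m' m"
  \<comment> \<open>For the induction, the loop is considered with \<open>d\<close> iterations left
    and an arbitrary counter value \<open>j\<close>.\<close>
  have loop: "rel_spmf (\<lambda>s' a'. I L (mem s') a' \<and> ?fr (mem s') \<and>
         time s' \<le> time s + d * (T + 2) \<and> queries s' \<le> queries s + d * N)
      (iterate ?P ?C s) (spmf_of_pmf (for_pmf B d j a))"
    if "j + d = L" "I j (mem s) a" "mem s v 0 = j" "?fr (mem s)" for d j a and s :: config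
    using that
  proof (induction d arbitrary: j s a)
    case 0
    have "eval_expr e (mem s) = L" using bound 0 by auto
    then have "iterate ?P ?C s = return_spmf s"
      using 0 by (subst iterate.simps) simp
    then show ?case using 0 by (simp add: rel_pmf_return_pmf1)
  next
    case (Suc d)
    have "eval_expr e (mem s) = L" using bound Suc by auto
    then have it: "iterate ?P ?C s = bind_spmf (?C s) (iterate ?P ?C)"
      using Suc by (subst iterate.simps) simp
    have c: "sim c (mem s) (B j a)
        (\<lambda>m'' a'. I (Suc j) (write_entry v 0 (Suc j) m'') a' \<and> m'' v 0 = j) T N"
      using Suc.prems body by auto
    have sb: "sim ?b (mem s) (bind_pmf (B j a) return_pmf)
        (\<lambda>m'' a'. I (Suc j) m'' a' \<and> m'' v 0 = Suc j) (T + 1) (N + 0)"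
      by (rule sim_Seq[OF c], rule sim_Store) (auto simp: write_entry_def)
    have b: "rel_spmf (\<lambda>s' a. (I (Suc j) (mem s') a \<and> mem s' v 0 = Suc j) \<and>
        eq_off (mods ?b) (mem s') (mem s) \<and>
         time s' \<le> time (tick 1 s) + (T + 1) \<and> queries s' \<le> queries (tick 1 s) + (N + 0))
       (?C s) (spmf_of_pmf (B j a))"
      by (rule sb[unfolded sim_def bind_return_pmf', rule_format]) (simp add: tick_def)
    have eq: "spmf_of_pmf (for_pmf B (Suc d) j a) =
        bind_spmf (spmf_of_pmf (B j a)) (\<lambda>a. spmf_of_pmf (for_pmf B d (Suc j) a))"
      by (simp add: spmf_of_pmf_bind)
    show ?case
      unfolding it eq
    proof (rule rel_spmf_bindI[OF b])
      fix s1 :: config and a1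
      assume *: "(I (Suc j) (mem s1) a1 \<and> mem s1 v 0 = Suc j) \<and>
        (\<forall>x. x \<notin> mods ?b \<longrightarrow> mem s1 x = mem s x) \<and>
         time s1 \<le> time (tick 1 s) + (T + 1) \<and> queries s1 \<le> queries (tick 1 s) + (N + 0)"
      have "rel_spmf (\<lambda>s' a'. I L (mem s') a' \<and> ?fr (mem s') \<and>
         time s' \<le> time s1 + d * (T + 2) \<and> queries s' \<le> queries s1 + d * N)
        (iterate ?P ?C s1) (spmf_of_pmf (for_pmf B d (Suc j) a1))"
        by (rule Suc.IH) (use Suc.prems * in auto)
      then show "rel_spmf (\<lambda>s' a'. I L (mem s') a' \<and> ?fr (mem s') \<and>
         time s' \<le> time s + Suc d * (T + 2) \<and> queries s' \<le> queries s + Suc d * N)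
        (iterate ?P ?C s1) (spmf_of_pmf (for_pmf B d (Suc j) a1))"
        by (rule rel_spmf_mono) (use * in \<open>auto simp: tick_def\<close>)
    qed
  qed
  show ?thesis
    unfolding sim_def
  proof (intro allI impI)
    fix s :: config assume s: "mem s = m"
    let ?s = "tick 1 (update_mem (write_entry v 0 0) s)"
    have "rel_spmf (\<lambda>s' a'. I L (mem s') a' \<and> ?fr (mem s') \<and>
         time s' \<le> time ?s + L * (T + 2) \<and> queries s' \<le> queries ?s + L * N)
      (iterate ?P ?C ?s) (spmf_of_pmf (for_pmf B L 0 a))"
      by (rule loop) (use init s in \<open>auto simp: tick_def update_mem_def write_entry_def\<close>)
    then show "rel_spmf (\<lambda>s' a. I L (mem s') a \<and> eq_off (mods (For v e c)) (mem s') m \<and>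
         time s' \<le> time s + (2 + L * (T + 2)) \<and> queries s' \<le> queries s + L * N)
       (exec n f D (For v e c) s) (spmf_of_pmf (for_pmf B L 0 a))"
      by (simp add: For_def spmf_rel_map)
        (erule rel_spmf_mono, auto simp: tick_def update_mem_def)
  qed
qed

lemma sim_For_det:
  assumes bound: "\<And>m' j. I j m' \<Longrightarrow> eq_off (insert v (mods c)) m' m \<Longrightarrow>
      eval_expr e m' = L"
    and init: "I 0 (write_entry v 0 0 m)"
    and body: "\<And>m' j. I j m' \<Longrightarrow> j < L \<Longrightarrow> m' v 0 = j \<Longrightarrow>
      eq_off (insert v (mods c)) m' m \<Longrightarrow>
      sim c m' (return_pmf ()) (\<lambda>m'' _. I (Suc j) (write_entry v 0 (Suc j) m'') \<and> m'' v 0 = j) T N"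
  shows "sim (For v e c) m (return_pmf ()) (\<lambda>m' _. I L m') (2 + L * (T + 2)) (L * N)"
  using sim_For[of "\<lambda>j m' (_::unit). I j m'" v c m e L "()" "\<lambda>_. return_pmf" T N] assms
  by simp

end

section \<open>Probability bounds\<close>

abbreviation (input) prob :: "'a pmf \<Rightarrow> 'a set \<Rightarrow> real" where
  "prob M \<equiv> measure_pmf.prob M"

text \<open>The union bound for a two-stage experiment: either the first stage hits the bad set
  \<open>S\<close>, or the second stage fails with conditional probability at most
  \<open>c\<close>.\<close>

lemma prob_bind_le:
  assumes "\<And>x. x \<in> set_pmf M \<Longrightarrow> x \<notin> S \<Longrightarrow> prob (N x) A \<le> c" "0 \<le> c"
  shows "prob (bind_pmf M N) A \<le> prob M S + c"
proof -
  have "emeasure (bind_pmf M N) A = (\<integral>\<^sup>+x. emeasure (N x) A \<partial>M)"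
    by simp
  also have "\<dots> \<le> (\<integral>\<^sup>+x. indicator S x + ennreal c \<partial>M)"
  proof (rule nn_integral_mono_AE, rule AE_pmfI)
    fix x assume x: "x \<in> set_pmf M"
    show "emeasure (N x) A \<le> indicator S x + ennreal c"
    proof (cases "x \<in> S")
      case True
      have "emeasure (N x) A \<le> 1"
        by (rule measure_pmf.emeasure_le_1)
      with True show ?thesis
        by (simp add: add_increasing2)
    next
      case False
      with x assms show ?thesis
        by (simp add: measure_pmf.emeasure_eq_measure ennreal_leI)
    qed
  qed
  also have "\<dots> = emeasure M S + ennreal c"
    by (subst nn_integral_add) auto
  also have "\<dots> = ennreal (prob M S + c)"
    using assms(2) by (simp add: measure_pmf.emeasure_eq_measure ennreal_plus)
  finally show ?thesis
    using assms(2) by (simp add: measure_pmf.emeasure_eq_measure flip: ennreal_plus)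
qed

lemma prob_bind_le_mult:
  assumes "\<And>x. x \<in> set_pmf M \<Longrightarrow> x \<in> S \<Longrightarrow> prob (N x) A \<le> c"
    and "\<And>x. x \<in> set_pmf M \<Longrightarrow> x \<notin> S \<Longrightarrow> prob (N x) A = 0" and "0 \<le> c"
  shows "prob (bind_pmf M N) A \<le> c * prob M S"
proof -
  have "emeasure (bind_pmf M N) A = (\<integral>\<^sup>+x. emeasure (N x) A \<partial>M)"
    by simp
  also have "\<dots> \<le> (\<integral>\<^sup>+x. ennreal c * indicator S x \<partial>M)"
  proof (rule nn_integral_mono_AE, rule AE_pmfI)
    fix x assume x: "x \<in> set_pmf M"
    then show "emeasure (N x) A \<le> ennreal c * indicator S x"
      using assms by (cases "x \<in> S") (auto simp: measure_pmf.emeasure_eq_measure ennreal_leI)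
  qed
  also have "\<dots> = ennreal (c * prob M S)"
    using assms(3) by (simp add: nn_integral_cmult measure_pmf.emeasure_eq_measure ennreal_mult)
  finally show ?thesis
    using assms(3) by (simp add: measure_pmf.emeasure_eq_measure)
qed

lemma prob_bind_eq_mult:
  assumes "\<And>x. x \<in> set_pmf M \<Longrightarrow> x \<in> S \<Longrightarrow> prob (N x) A = c"
    and "\<And>x. x \<in> set_pmf M \<Longrightarrow> x \<notin> S \<Longrightarrow> prob (N x) A = 0" and "0 \<le> c"
  shows "prob (bind_pmf M N) A = c * prob M S"
proof -
  have "emeasure (bind_pmf M N) A = (\<integral>\<^sup>+x. emeasure (N x) A \<partial>M)"
    by simp
  also have "\<dots> = (\<integral>\<^sup>+x. ennreal c * indicator S x \<partial>M)"
  proof (rule nn_integral_cong_AE, rule AE_pmfI)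
    fix x assume x: "x \<in> set_pmf M"
    then show "emeasure (N x) A = ennreal c * indicator S x"
      using assms by (cases "x \<in> S") (auto simp: measure_pmf.emeasure_eq_measure)
  qed
  also have "\<dots> = ennreal (c * prob M S)"
    using assms(3) by (simp add: nn_integral_cmult measure_pmf.emeasure_eq_measure ennreal_mult)
  finally show ?thesis
    using assms(3) by (simp add: measure_pmf.emeasure_eq_measure)
qed

lemma prob_pair_le:
  assumes "\<And>x. x \<in> set_pmf A \<Longrightarrow> x \<in> S \<Longrightarrow> prob B {y. P x y} \<le> c" and "0 \<le> c"
  shows "prob (pair_pmf A B) {(x, y). x \<in> S \<and> P x y} \<le> c * prob A S"
  unfolding pair_pmf_def
proof (rule prob_bind_le_mult)
  fix x assume "x \<in> set_pmf A" "x \<in> S"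
  then show "prob (bind_pmf B (\<lambda>y. return_pmf (x, y))) {(x, y). x \<in> S \<and> P x y} \<le> c"
    using assms(1)[of x] by (simp add: map_pmf_def[symmetric] vimage_def)
next
  fix x assume "x \<notin> S"
  then show "prob (bind_pmf B (\<lambda>y. return_pmf (x, y))) {(x, y). x \<in> S \<and> P x y} = 0"
    by (simp add: map_pmf_def[symmetric] vimage_def)
qed fact

text \<open>Averaging: if all conditional probabilities exceeded \<open>c\<close>, so would their
  mean. This allows one of two random choices to be fixed.\<close>

lemma prob_pair_ex:
  assumes "prob (pair_pmf A B) {(x, y). P x y} \<le> c"
  shows "\<exists>x \<in> set_pmf A. prob B {y. P x y} \<le> c"
proof (rule ccontr)
  assume "\<not> ?thesis"
  then have gt: "c < prob B {y. P x y}" if "x \<in> set_pmf A" for x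
    using that by force
  have c: "0 \<le> c"
    using assms measure_nonneg order_trans by blast
  have "emeasure (pair_pmf A B) {(x, y). P x y} = (\<integral>\<^sup>+x. emeasure B {y. P x y} \<partial>A)"
    by (simp add: pair_pmf_def map_pmf_def[symmetric] vimage_def)
  \<comment> \<open>The inequality of the integrals is strict because that of the integrands is
    strict on the whole support, which is nonempty.\<close>
  also have "\<dots> > (\<integral>\<^sup>+x. ennreal c \<partial>A)"
  proof (rule nn_integral_less)
    show "AE x in A. ennreal c \<le> emeasure B {y. P x y}"
      by (rule AE_pmfI) (auto simp: measure_pmf.emeasure_eq_measure intro!: ennreal_leI less_imp_le[OF gt])
    show "\<not> (AE x in A. emeasure B {y. P x y} \<le> ennreal c)"
      using gt c set_pmf_not_empty[of A]
      by (auto simp: AE_measure_pmf_iff measure_pmf.emeasure_eq_measure not_le)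
  qed auto
  finally show False
    using assms c by (simp add: measure_pmf.emeasure_eq_measure ennreal_less_iff)
qed

lemma prob_mono: "A \<inter> set_pmf M \<subseteq> B \<Longrightarrow> prob M A \<le> prob M B"
  by (rule measure_pmf.finite_measure_mono_AE) (auto simp: AE_measure_pmf_iff)

lemma prob_Un_le:
  "A \<inter> set_pmf M \<subseteq> B \<union> C \<Longrightarrow> prob M A \<le> prob M B + prob M C"
  using prob_mono[of A M "B \<union> C"] measure_Un_le[of B "measure_pmf M" C] by simp

section \<open>Self-correction of approximate homomorphisms\<close>

text \<open>Addition in the Boolean ring of sets, that is, of characteristic vectors over the field
  with two elements; intersection is the multiplication. It is used both for sets of variables and
  for sets of colours.\<close>

definition symdiff :: "'a set \<Rightarrow> 'a set \<Rightarrow> 'a set" (infixl "\<oplus>" 65) where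
  "A \<oplus> B = {x. (x \<in> A) \<noteq> (x \<in> B)}"

lemma mem_symdiff [simp]: "x \<in> A \<oplus> B \<longleftrightarrow> (x \<in> A) \<noteq> (x \<in> B)"
  by (simp add: symdiff_def)

lemma symdiff_cancel [simp]: "A \<oplus> (A \<oplus> B) = B"
  by auto

lemma empty_symdiff [simp]: "{} \<oplus> A = A"
  by auto

lemma symdiff_cancel_right [simp]: "A \<oplus> B \<oplus> B = A"
  by auto

lemma symdiff_self [simp]: "A \<oplus> A = {}"
  by auto

lemma Int_symdiff: "A \<inter> (B \<oplus> C) = (A \<inter> B) \<oplus> (A \<inter> C)"
  by auto

lemma symdiff_Int: "(A \<oplus> B) \<inter> C = (A \<inter> C) \<oplus> (B \<inter> C)"
  by auto

lemma symdiff_subset: "A \<subseteq> C \<Longrightarrow> B \<subseteq> C \<Longrightarrow> A \<oplus> B \<subseteq> C"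
  by auto

definition usets :: "nat \<Rightarrow> nat set pmf" where
  "usets n = pmf_of_set (Pow {..<n})"

lemma set_usets [simp]: "set_pmf (usets n) = Pow {..<n}"
  unfolding usets_def by (subst set_pmf_of_set) auto

text \<open>Translation is an involution of the power set. Hence a fixed set shifted by a uniform
  one is uniform, which is the source of all randomisation in the tests.\<close>

lemma usets_translate:
  assumes "X \<subseteq> {..<n}"
  shows "map_pmf ((\<oplus>) X) (usets n) = usets n"
  unfolding usets_def
proof (rule map_pmf_of_set_bij_betw)
  show "bij_betw ((\<oplus>) X) (Pow {..<n}) (Pow {..<n})"
    using assms
    by (intro bij_betw_byWitness[where f' = "(\<oplus>) X"]) (auto simp: symdiff_subset)
qed auto

lemma prob_usets_translate:
  assumes "X \<subseteq> {..<n}"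
  shows "prob (usets n) {Y. P (X \<oplus> Y)} = prob (usets n) {Y. P Y}"
proof -
  have "prob (usets n) {Y. P Y} = prob (map_pmf ((\<oplus>) X) (usets n)) {Y. P Y}"
    by (simp add: usets_translate[OF assms])
  then show ?thesis
    by (simp add: vimage_def)
qed

lemma usets_translate2:
  assumes "X \<subseteq> {..<n}" "Y \<subseteq> {..<n}"
  shows "map_pmf (\<lambda>(Z, W). (X \<oplus> Z, Y \<oplus> W)) (pair_pmf (usets n) (usets n)) =
    pair_pmf (usets n) (usets n)"
  by (simp add: map_pair usets_translate assms)

lemma prob_usets_translate2:
  assumes "X \<subseteq> {..<n}" "Y \<subseteq> {..<n}"
  shows "prob (pair_pmf (usets n) (usets n)) {(Z, W). P (X \<oplus> Z) (Y \<oplus> W)} =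
    prob (pair_pmf (usets n) (usets n)) {(Z, W). P Z W}"
proof -
  have "prob (pair_pmf (usets n) (usets n)) {(Z, W). P Z W} =
    prob (map_pmf (\<lambda>(Z, W). (X \<oplus> Z, Y \<oplus> W)) (pair_pmf (usets n) (usets n))) {(Z, W). P Z W}"
    by (simp add: usets_translate2[OF assms])
  then show ?thesis
    by (simp add: vimage_def case_prod_unfold)
qed

lemma prob_pair_swap:
  "prob (pair_pmf A B) {(x, y). P x y} = prob (pair_pmf B A) {(y, x). P x y}"
  by (subst pair_commute_pmf) (simp add: vimage_def case_prod_unfold)

lemma prob_lt_1_ex:
  assumes "prob M A < 1"
  shows "\<exists>x \<in> set_pmf M. x \<notin> A"
proof (rule ccontr)
  assume "\<not> ?thesis"
  then have "prob M A = 1"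
    by (auto simp: measure_pmf.prob_eq_1 AE_measure_pmf_iff)
  with assms show False by simp
qed

context
  fixes n :: nat and F :: "nat set \<Rightarrow> 'c set" and \<delta> :: real
  assumes lin: "prob (pair_pmf (usets n) (usets n)) {(Z, W). F (Z \<oplus> W) \<noteq> F Z \<oplus> F W} \<le> \<delta>"
begin

text \<open>Two independent votes on the value at \<open>X\<close> mostly agree. Both
  \<open>F (X \<oplus> Y) \<oplus> F Z\<close> and \<open>F (X \<oplus> Z) \<oplus> F Y\<close>
  equal \<open>F (X \<oplus> Y \<oplus> Z)\<close> unless one of two linearity tests at uniform
  pairs fails, and their equality is a rearrangement of the equality of the votes.\<close>

lemma self_correction_collision:
  assumes X: "X \<subseteq> {..<n}"
  shows "prob (pair_pmf (usets n) (usets n))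
    {(Z, Y). F (X \<oplus> Y) \<oplus> F Y \<noteq> F (X \<oplus> Z) \<oplus> F Z} \<le> 2 * \<delta>"
proof -
  let ?M = "pair_pmf (usets n) (usets n)"
  have 1: "prob ?M {(Z, Y). F ((X \<oplus> Z) \<oplus> Y) \<noteq> F (X \<oplus> Z) \<oplus> F Y} \<le> \<delta>"
    using prob_usets_translate2[OF X, of "{}" "\<lambda>Z Y. F (Z \<oplus> Y) \<noteq> F Z \<oplus> F Y"] lin
    by simp
  then have 2: "prob ?M {(Z, Y). F ((X \<oplus> Y) \<oplus> Z) \<noteq> F (X \<oplus> Y) \<oplus> F Z} \<le> \<delta>"
    by (simp only: prob_pair_swap[where P = "\<lambda>Z Y. F ((X \<oplus> Y) \<oplus> Z) \<noteq> F (X \<oplus> Y) \<oplus> F Z"])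
  have "prob ?M {(Z, Y). F (X \<oplus> Y) \<oplus> F Y \<noteq> F (X \<oplus> Z) \<oplus> F Z} \<le>
    prob ?M {(Z, Y). F ((X \<oplus> Z) \<oplus> Y) \<noteq> F (X \<oplus> Z) \<oplus> F Y} +
    prob ?M {(Z, Y). F ((X \<oplus> Y) \<oplus> Z) \<noteq> F (X \<oplus> Y) \<oplus> F Z}"
  proof (rule prob_Un_le, rule subsetI, rule ccontr)
    fix P assume P: "P \<in> {(Z, Y). F (X \<oplus> Y) \<oplus> F Y \<noteq> F (X \<oplus> Z) \<oplus> F Z} \<inter> set_pmf ?M"
      "P \<notin> {(Z, Y). F ((X \<oplus> Z) \<oplus> Y) \<noteq> F (X \<oplus> Z) \<oplus> F Y} \<union>
        {(Z, Y). F ((X \<oplus> Y) \<oplus> Z) \<noteq> F (X \<oplus> Y) \<oplus> F Z}"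
    obtain Z Y where "P = (Z, Y)"
      by (rule prod.exhaust)
    with P have *: "F (X \<oplus> Y) \<oplus> F Y \<noteq> F (X \<oplus> Z) \<oplus> F Z"
      and 1: "F (X \<oplus> Y \<oplus> Z) = F (X \<oplus> Y) \<oplus> F Z"
      and 2: "F (X \<oplus> Z \<oplus> Y) = F (X \<oplus> Z) \<oplus> F Y"
      by simp_all
    show False
    proof -
      have "X \<oplus> Z \<oplus> Y = X \<oplus> Y \<oplus> Z" by auto
      with 1 2 have "F (X \<oplus> Y) \<oplus> F Z = F (X \<oplus> Z) \<oplus> F Y" by simp
      then have "F (X \<oplus> Y) \<oplus> F Y = F (X \<oplus> Z) \<oplus> F Z"
        by (simp add: set_eq_iff) blast
      with * show False ..
    qed
  qed
  with 1 2 show ?thesis by linarith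
qed

text \<open>One voter \<open>Z\<close> is fixed at a choice that is no worse than average, and its
  vote becomes the value \<open>v\<close>.\<close>

lemma self_correction_ex:
  assumes X: "X \<subseteq> {..<n}"
  shows "\<exists>v. prob (usets n) {Y. F (X \<oplus> Y) \<oplus> F Y \<noteq> v} \<le> 2 * \<delta>"
  using prob_pair_ex[OF self_correction_collision[OF X]] by blast

text \<open>For additivity at \<open>X\<close> and \<open>Y\<close>, three votes that are each wrong
  with probability at most 2 \<delta> have to be right for a common \<open>Z\<close>, which is
  possible as 6 \<delta> < 1. The range is inherited because each value of \<open>g\<close> is a sum
  of two values of \<open>F\<close>.\<close>

lemma BLR:
  assumes \<delta>: "6 * \<delta> < 1" and C: "\<And>X. F X \<subseteq> C"
  obtains g where
    "\<And>X Y. X \<subseteq> {..<n} \<Longrightarrow> Y \<subseteq> {..<n} \<Longrightarrow> g (X \<oplus> Y) = g X \<oplus> g Y"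
    "\<And>X. X \<subseteq> {..<n} \<Longrightarrow> prob (usets n) {Y. F (X \<oplus> Y) \<oplus> F Y \<noteq> g X} \<le> 2 * \<delta>"
    "\<And>X. X \<subseteq> {..<n} \<Longrightarrow> g X \<subseteq> C"
proof -
  let ?p = "prob (usets n)"
  obtain g where g: "?p {Y. F (X \<oplus> Y) \<oplus> F Y \<noteq> g X} \<le> 2 * \<delta>" if "X \<subseteq> {..<n}" for X
    using self_correction_ex by metis
  have "0 \<le> \<delta>"
    using lin measure_nonneg order_trans by blast
  have hom: "g (X \<oplus> Y) = g X \<oplus> g Y" if X: "X \<subseteq> {..<n}" and Y: "Y \<subseteq> {..<n}" for X Y
  proof -
    \<comment> \<open>The vote on \<open>X\<close> is taken at the shifted point
      \<open>Y \<oplus> Z\<close>, so that \<open>F (Y \<oplus> Z)\<close> cancels against the vote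
      on \<open>Y\<close> and the vote on \<open>X \<oplus> Y\<close> remains.\<close>
    let ?B1 = "{Z. F (X \<oplus> (Y \<oplus> Z)) \<oplus> F (Y \<oplus> Z) \<noteq> g X}"
    let ?B2 = "{Z. F (Y \<oplus> Z) \<oplus> F Z \<noteq> g Y}"
    let ?B3 = "{Z. F (X \<oplus> Y \<oplus> Z) \<oplus> F Z \<noteq> g (X \<oplus> Y)}"
    have 1: "?p ?B1 \<le> 2 * \<delta>"
      using g[OF X] prob_usets_translate[OF Y, of "\<lambda>Z. F (X \<oplus> Z) \<oplus> F Z \<noteq> g X"] by simp
    have "?p (?B1 \<union> (?B2 \<union> ?B3)) \<le> ?p ?B1 + (?p ?B2 + ?p ?B3)"
      using prob_Un_le[of "?B1 \<union> (?B2 \<union> ?B3)" "usets n" ?B1 "?B2 \<union> ?B3"]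
        prob_Un_le[of "?B2 \<union> ?B3" "usets n" ?B2 ?B3] by simp
    then have "?p (?B1 \<union> (?B2 \<union> ?B3)) < 1"
      using 1 g[OF Y] g[OF symdiff_subset[OF X Y]] \<delta> by linarith
    then obtain Z where Z: "Z \<notin> ?B1 \<union> (?B2 \<union> ?B3)"
      using prob_lt_1_ex by blast
    have e: "X \<oplus> (Y \<oplus> Z) = X \<oplus> Y \<oplus> Z" by auto
    from Z have "g X = F (X \<oplus> Y \<oplus> Z) \<oplus> F (Y \<oplus> Z)" "g Y = F (Y \<oplus> Z) \<oplus> F Z"
      "g (X \<oplus> Y) = F (X \<oplus> Y \<oplus> Z) \<oplus> F Z"
      by (simp_all add: e)
    then show ?thesis
      by (simp add: set_eq_iff) blast
  qed
  have "g X \<subseteq> C" if X: "X \<subseteq> {..<n}" for X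
  proof -
    have "?p {Y. F (X \<oplus> Y) \<oplus> F Y \<noteq> g X} < 1"
      using g[OF X] \<delta> \<open>0 \<le> \<delta>\<close> by linarith
    then obtain Y where "Y \<notin> {Y. F (X \<oplus> Y) \<oplus> F Y \<noteq> g X}"
      using prob_lt_1_ex by blast
    then have "g X = F (X \<oplus> Y) \<oplus> F Y"
      by simp
    then show ?thesis
      using C symdiff_subset by metis
  qed
  from that[OF hom g this] show ?thesis .
qed

end

text \<open>The defect \<open>g (Z \<inter> W) \<oplus> (g Z \<inter> g W)\<close> is bilinear. If it does not vanish at \<open>(X, Y)\<close>, then for
  each \<open>(Z, W)\<close> it does not vanish on all four corners \<open>(Z, W) + {0, X} \<times> {0, Y}\<close>.\<close>

lemma ring_hom_if_mostly:
  fixes g :: "nat set \<Rightarrow> 'c set"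
  assumes hom: "\<And>X Y. X \<subseteq> {..<n} \<Longrightarrow> Y \<subseteq> {..<n} \<Longrightarrow> g (X \<oplus> Y) = g X \<oplus> g Y"
    and p: "prob (pair_pmf (usets n) (usets n)) {(Z, W). g (Z \<inter> W) \<noteq> g Z \<inter> g W} < 1 / 4"
    and X: "X \<subseteq> {..<n}" and Y: "Y \<subseteq> {..<n}"
  shows "g (X \<inter> Y) = g X \<inter> g Y"
proof (rule ccontr)
  assume ne: "g (X \<inter> Y) \<noteq> g X \<inter> g Y"
  let ?M = "pair_pmf (usets n) (usets n)"
  let ?B = "\<lambda>X Y. {(Z, W). g ((X \<oplus> Z) \<inter> (Y \<oplus> W)) \<noteq> g (X \<oplus> Z) \<inter> g (Y \<oplus> W)}"
  have lt: "prob ?M (?B X' Y') < 1 / 4" if "X' \<subseteq> {..<n}" "Y' \<subseteq> {..<n}" for X' Y'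
    using prob_usets_translate2[OF that, of "\<lambda>Z W. g (Z \<inter> W) \<noteq> g Z \<inter> g W"] p by simp
  let ?A = "(?B {} {} \<union> ?B X {}) \<union> (?B {} Y \<union> ?B X Y)"
  have "prob ?M ?A \<le>
      (prob ?M (?B {} {}) + prob ?M (?B X {})) +
      (prob ?M (?B {} Y) + prob ?M (?B X Y))"
    by (intro order_trans[OF measure_Un_le] add_mono) auto
  also have "\<dots> < 1"
    using lt[OF empty_subsetI empty_subsetI] lt[OF X empty_subsetI] lt[OF empty_subsetI Y] lt[OF X Y]
    by linarith
  finally have "\<exists>P \<in> set_pmf ?M. P \<notin> ?A"
    by (rule prob_lt_1_ex)
  then obtain P where P: "P \<in> set_pmf ?M" "P \<notin> ?A" ..
  obtain Z W where ZW: "P = (Z, W)"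
    by (rule prod.exhaust)
  have sub: "Z \<subseteq> {..<n}" "W \<subseteq> {..<n}"
    using P(1) unfolding ZW by simp_all
  have 1: "g (Z \<inter> W) = g Z \<inter> g W" "g ((X \<oplus> Z) \<inter> W) = g (X \<oplus> Z) \<inter> g W"
    "g (Z \<inter> (Y \<oplus> W)) = g Z \<inter> g (Y \<oplus> W)" "g ((X \<oplus> Z) \<inter> (Y \<oplus> W)) = g (X \<oplus> Z) \<inter> g (Y \<oplus> W)"
    using P(2) unfolding ZW by simp_all
  have 2: "g ((X \<oplus> Z) \<inter> W) = g (X \<inter> W) \<oplus> g (Z \<inter> W)"
    "g (Z \<inter> (Y \<oplus> W)) = g (Z \<inter> Y) \<oplus> g (Z \<inter> W)"
    "g ((X \<oplus> Z) \<inter> (Y \<oplus> W)) = (g (X \<inter> Y) \<oplus> g (Z \<inter> Y)) \<oplus> (g (X \<inter> W) \<oplus> g (Z \<inter> W))"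
    using X Y sub by (simp_all only: Int_symdiff symdiff_Int hom symdiff_subset le_infI1)
  have 3: "g (X \<oplus> Z) = g X \<oplus> g Z" "g (Y \<oplus> W) = g Y \<oplus> g W"
    using X Y sub by (simp_all only: hom)
  note eqs = 1(1) 1(2-4)[unfolded 2 3]
  have "c \<in> g (X \<inter> Y) \<longleftrightarrow> c \<in> g X \<inter> g Y" for c
    using eqs[THEN eqset_imp_iff, of c] unfolding mem_symdiff Int_iff by argo
  then have "g (X \<inter> Y) = g X \<inter> g Y"
    by (rule set_eqI)
  with ne show False ..
qed

text \<open>Images of distinct singletons are disjoint, as \<open>g\<close> is multiplicative and
  maps the empty set to itself; for disjoint sets the symmetric difference is a union. So each
  colour is a disjunction of variables.\<close>

lemma ring_hom_Union:
  assumes hom: "\<And>X Y. X \<subseteq> {..<n} \<Longrightarrow> Y \<subseteq> {..<n} \<Longrightarrow> g (X \<oplus> Y) = g X \<oplus> g Y"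
    and int: "\<And>X Y. X \<subseteq> {..<n} \<Longrightarrow> Y \<subseteq> {..<n} \<Longrightarrow> g (X \<inter> Y) = g X \<inter> g Y"
    and Y: "Y \<subseteq> {..<n :: nat}"
  shows "g Y = (\<Union>i\<in>Y. g {i})"
proof -
  have e: "g {} = {}"
    using hom[of "{}" "{}"] by simp
  have "finite Y"
    using Y finite_subset by blast
  then show ?thesis
    using Y
  proof (induction Y)
    case empty
    show ?case by (simp add: e)
  next
    case (insert i Y)
    then have iY: "insert i Y = {i} \<oplus> Y" "{i} \<inter> Y = {}" "{i} \<subseteq> {..<n}" "Y \<subseteq> {..<n}"
      by auto
    have "g {i} \<inter> g Y = {}"
      using int[OF iY(3,4)] e iY(2) by simp
    moreover have "g (insert i Y) = g {i} \<oplus> g Y"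
      unfolding iY(1) by (rule hom[OF iY(3,4)])
    ultimately have "g (insert i Y) = g {i} \<union> g Y"
      by auto
    then show ?case using insert by simp
  qed
qed

text \<open>The nonempty images of singletons are pairwise disjoint subsets of \<open>C\<close>, so
  a choice of one element from each is injective. This turns a bound on the number of colours into a
  bound on the number of literals.\<close>

lemma ring_hom_support_card:
  assumes hom: "\<And>X Y. X \<subseteq> {..<n} \<Longrightarrow> Y \<subseteq> {..<n} \<Longrightarrow> g (X \<oplus> Y) = g X \<oplus> g Y"
    and int: "\<And>X Y. X \<subseteq> {..<n} \<Longrightarrow> Y \<subseteq> {..<n} \<Longrightarrow> g (X \<inter> Y) = g X \<inter> g Y"
    and C: "\<And>X. X \<subseteq> {..<n :: nat} \<Longrightarrow> g X \<subseteq> C" and fin: "finite C"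
  shows "card {i. i < n \<and> g {i} \<noteq> {}} \<le> card C"
proof -
  have e: "g {} = {}"
    using hom[of "{}" "{}"] by simp
  let ?T = "{i. i < n \<and> g {i} \<noteq> {}}"
  define t where "t i = (SOME c. c \<in> g {i})" for i
  have t: "t i \<in> g {i}" if "i \<in> ?T" for i
    using that by (simp add: t_def some_in_eq)
  have "inj_on t ?T"
  proof (rule inj_onI, rule ccontr)
    fix i j assume ij: "i \<in> ?T" "j \<in> ?T" "t i = t j" "i \<noteq> j"
    then have "g ({i} \<inter> {j}) = g {i} \<inter> g {j}"
      by (intro int) auto
    then have "g {i} \<inter> g {j} = {}"
      using ij(4) e by simp
    then show False
      using t[OF ij(1)] t[OF ij(2)] ij(3) by auto
  qed
  moreover have "t ` ?T \<subseteq> C"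
  proof (rule image_subsetI)
    fix i assume i: "i \<in> ?T"
    then have "{i} \<subseteq> {..<n}"
      by simp
    from subsetD[OF C[OF this] t[OF i]] show "t i \<in> C" .
  qed
  ultimately show ?thesis
    using fin by (rule card_inj_on_le)
qed

section \<open>The trials\<close>

lemma prob_pair_le':
  assumes "\<And>x. x \<in> set_pmf A \<Longrightarrow> prob B {y. P x y} \<le> c" and "0 \<le> c"
  shows "prob (pair_pmf A B) {(x, y). P x y} \<le> c"
  using prob_pair_le[of A UNIV B P c] assms by simp

text \<open>The four conditions of a trial share one random quadruple; these are the marginals on
  which they depend.\<close>

lemma prob_quad:
  fixes A :: "'a pmf" and B :: "'b pmf" and C :: "'c pmf" and E :: "'d pmf"
  defines "M \<equiv> pair_pmf A (pair_pmf B (pair_pmf C E))"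
  shows "prob M {(x, y, z, w). P x y} = prob (pair_pmf A B) {(x, y). P x y}"
    and "prob M {(x, y, z, w). Q x y z} =
      prob (pair_pmf A (pair_pmf B C)) {(x, y, z). Q x y z}"
    and "prob M {(x, y, z, w). R w y} = prob (pair_pmf E B) {(w, y). R w y}"
    and "prob M {(x, y, z, w). T w} = prob E {w. T w}"
proof -
  have "map_pmf (\<lambda>(x, y). (x, fst y)) M = pair_pmf A B"
    unfolding M_def map_pair[of "\<lambda>x. x" fst] map_fst_pair_pmf by simp
  from this[symmetric] show "prob M {(x, y, z, w). P x y} = prob (pair_pmf A B) {(x, y). P x y}"
    by (simp add: vimage_def case_prod_unfold)
  have "map_pmf (\<lambda>(x, y). (x, (\<lambda>(y, z). (y, fst z)) y)) M = pair_pmf A (pair_pmf B C)"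
    unfolding M_def map_pair[of "\<lambda>x. x"] map_pair[of "\<lambda>x. x" fst] map_fst_pair_pmf by simp
  from this[symmetric] show "prob M {(x, y, z, w). Q x y z} =
      prob (pair_pmf A (pair_pmf B C)) {(x, y, z). Q x y z}"
    by (simp add: vimage_def case_prod_unfold)
  have "map_pmf (\<lambda>(y, z). (y, snd z)) (map_pmf snd M) = pair_pmf B E"
    unfolding M_def map_snd_pair_pmf map_pair[of "\<lambda>x. x" snd] by simp
  from this[symmetric] have "prob M {(x, y, z, w). R w y} = prob (pair_pmf B E) {(y, w). R w y}"
    by (simp add: vimage_def case_prod_unfold)
  also have "\<dots> = prob (pair_pmf E B) {(w, y). R w y}"
    by (rule prob_pair_swap)
  finally show "prob M {(x, y, z, w). R w y} = prob (pair_pmf E B) {(w, y). R w y}" .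
  have "map_pmf snd (map_pmf snd (map_pmf snd M)) = E"
    unfolding M_def map_snd_pair_pmf ..
  then have "prob E {w. T w} = prob (map_pmf snd (map_pmf snd (map_pmf snd M))) {w. T w}"
    by simp
  then show "prob M {(x, y, z, w). T w} = prob E {w. T w}"
    by (simp add: vimage_def case_prod_unfold)
qed

context testing
begin

text \<open>On the cube, \<open>flip a\<close> and \<open>diff a\<close> are mutually inverse
  changes of coordinates that move \<open>a\<close> to the empty set.\<close>

definition flip :: "bool list \<Rightarrow> nat set \<Rightarrow> bool list" where
  "flip a Z = map (\<lambda>i. (a ! i) \<noteq> (i \<in> Z)) [0..<n]"

definition diff :: "bool list \<Rightarrow> bool list \<Rightarrow> nat set" where
  "diff a y = {i. i < n \<and> y ! i \<noteq> a ! i}"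

definition neg :: "bool list \<Rightarrow> nat set \<Rightarrow> bool" where
  "neg a Z \<longleftrightarrow> \<not> f (flip a Z)"

text \<open>The vector-valued function to which the homomorphism tests apply. Colour 0 is left out
  because it stands for the unmarked blocks.\<close>

definition colours :: "bool list \<Rightarrow> (nat \<Rightarrow> nat) \<Rightarrow> nat \<Rightarrow> nat set \<Rightarrow> nat set" where
  "colours a col cnt Z = {c \<in> {1..cnt}. neg a (Z \<inter> {i. col i = c})}"

text \<open>The four conditions serve, in this order, for additivity of the self-correction, for its
  multiplicativity, for its agreement with \<open>F\<close> on samples, and for the passage from
  \<open>F\<close> back to \<open>f\<close>. They may share their random sets, \<open>W\<close>
  being also the shift in the third one, since each condition is analysed on its own.\<close>

definition consistent ::
  "bool list \<Rightarrow> (nat \<Rightarrow> nat) \<Rightarrow> nat \<Rightarrow> nat set \<Rightarrow> nat set \<Rightarrow> nat set \<Rightarrow> bool list \<Rightarrow> bool" where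
  "consistent a col cnt Z W V y \<longleftrightarrow> (let F = colours a col cnt; Y = diff a y in
     F (Z \<oplus> W) = F Z \<oplus> F W \<and>
     F ((Z \<inter> W) \<oplus> V) \<oplus> F V = F Z \<inter> F W \<and>
     F (Y \<oplus> W) \<oplus> F W = F Y \<and>
     (neg a Y \<longleftrightarrow> F Y \<noteq> {}))"

definition quad :: "(nat set \<times> nat set \<times> nat set \<times> bool list) pmf" where
  "quad = pair_pmf (usets n) (pair_pmf (usets n) (pair_pmf (usets n) D))"

definition trial :: "bool list \<Rightarrow> (nat \<Rightarrow> nat) \<Rightarrow> nat \<Rightarrow> bool \<Rightarrow> bool pmf" where
  "trial a col cnt rej = map_pmf (\<lambda>(Z, W, V, y). rej \<or> \<not> consistent a col cnt Z W V y) quad"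

lemma length_flip [simp]: "length (flip a Z) = n"
  by (simp add: flip_def)

lemma flip_nth [simp]: "i < n \<Longrightarrow> flip a Z ! i = ((a ! i) \<noteq> (i \<in> Z))"
  by (simp add: flip_def)

lemma flip_diff: "length y = n \<Longrightarrow> flip a (diff a y) = y"
  by (rule nth_equalityI) (auto simp: diff_def)

lemma diff_subset: "diff a y \<subseteq> {..<n}"
  by (auto simp: diff_def)

text \<open>Each condition fails with probability at most \<rho>, the probability of rejection. For
  small \<rho> the self-correction of \<open>F\<close> is a ring homomorphism, and its support
  yields a term. The distance of \<open>f\<close> from this term is at most \<rho> for the last
  condition plus 20/19 \<rho> for samples at which \<open>F\<close> differs from its
  self-correction.\<close>

lemma trial_soundness:
  assumes D: "set_pmf D \<subseteq> cube n" and a: "length a = n" and cnt: "cnt \<le> k"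
    and far: "eps_far D \<epsilon> (k_Term n k) f"
    and small: "prob (trial a col cnt False) {True} < 1 / 40"
  shows "\<epsilon> \<le> 39 / 19 * prob (trial a col cnt False) {True}"
proof -
  define F where "F = colours a col cnt"
  define \<rho> where "\<rho> = prob (trial a col cnt False) {True}"
  let ?U = "usets n"
  have \<rho>: "\<rho> = prob quad {(Z, W, V, y). \<not> consistent a col cnt Z W V y}"
    unfolding \<rho>_def trial_def by (simp add: vimage_def case_prod_unfold)
  have \<rho>_ge: "prob quad {(Z, W, V, y). P Z W V y} \<le> \<rho>"
    if "\<And>Z W V y. P Z W V y \<Longrightarrow> \<not> consistent a col cnt Z W V y" for P
    unfolding \<rho> by (rule measure_pmf.finite_measure_mono) (use that in auto)
  have t1: "prob (pair_pmf ?U ?U) {(Z, W). F (Z \<oplus> W) \<noteq> F Z \<oplus> F W} \<le> \<rho>"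
    using \<rho>_ge[of "\<lambda>Z W V y. F (Z \<oplus> W) \<noteq> F Z \<oplus> F W"]
    by (simp add: quad_def prob_quad(1) consistent_def F_def Let_def)
  have t2: "prob (pair_pmf ?U (pair_pmf ?U ?U))
      {(Z, W, V). F ((Z \<inter> W) \<oplus> V) \<oplus> F V \<noteq> F Z \<inter> F W} \<le> \<rho>"
    using \<rho>_ge[of "\<lambda>Z W V y. F ((Z \<inter> W) \<oplus> V) \<oplus> F V \<noteq> F Z \<inter> F W"]
    by (simp add: quad_def prob_quad(2) consistent_def F_def Let_def)
  have t3: "prob (pair_pmf D ?U)
      {(y, W). F (diff a y \<oplus> W) \<oplus> F W \<noteq> F (diff a y)} \<le> \<rho>"
    using \<rho>_ge[of "\<lambda>Z W V y. F (diff a y \<oplus> W) \<oplus> F W \<noteq> F (diff a y)"]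
    by (simp add: quad_def prob_quad(3) consistent_def F_def Let_def)
  have t4: "prob D {y. neg a (diff a y) \<noteq> (F (diff a y) \<noteq> {})} \<le> \<rho>"
    using \<rho>_ge[of "\<lambda>Z W V y. neg a (diff a y) \<noteq> (F (diff a y) \<noteq> {})"]
    by (simp add: quad_def prob_quad(4) consistent_def F_def Let_def)
  have \<rho>40: "\<rho> < 1 / 40" and \<rho>0: "0 \<le> \<rho>"
    using small by (simp_all add: \<rho>_def)
  have "6 * \<rho> < 1"
    using \<rho>40 by simp
  then obtain g where
    hom: "\<And>X Y. X \<subseteq> {..<n} \<Longrightarrow> Y \<subseteq> {..<n} \<Longrightarrow> g (X \<oplus> Y) = g X \<oplus> g Y"
    and near: "\<And>X. X \<subseteq> {..<n} \<Longrightarrow> prob ?U {Y. F (X \<oplus> Y) \<oplus> F Y \<noteq> g X} \<le> 2 * \<rho>"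
    and C: "\<And>X. X \<subseteq> {..<n} \<Longrightarrow> g X \<subseteq> {1..cnt}"
    by (rule BLR[OF t1, where C = "{1..cnt}"]) (auto simp: F_def colours_def)
  \<comment> \<open>\<open>F Z\<close> and \<open>g Z\<close> differ only if the linearity test for
    \<open>Z\<close> and \<open>W\<close> fails or the vote of \<open>W\<close> on \<open>Z\<close>
    is wrong: \<rho> + 2 \<rho>.\<close>
  have near_F: "prob ?U {Z. F Z \<noteq> g Z} \<le> 3 * \<rho>"
  proof -
    have 1: "prob (pair_pmf ?U ?U) {(Z, W). F Z \<noteq> g Z} \<le>
      prob (pair_pmf ?U ?U) {(Z, W). F (Z \<oplus> W) \<noteq> F Z \<oplus> F W} +
      prob (pair_pmf ?U ?U) {(Z, W). F (Z \<oplus> W) \<oplus> F W \<noteq> g Z}"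
      by (rule prob_Un_le) (auto simp: symdiff_cancel_right)
    have 2: "prob (pair_pmf ?U ?U) {(Z, W). F (Z \<oplus> W) \<oplus> F W \<noteq> g Z} \<le> 2 * \<rho>"
      using near \<rho>0 by (intro prob_pair_le') auto
    have "prob ?U {Z. F Z \<noteq> g Z} =
        prob (map_pmf fst (pair_pmf ?U ?U)) {Z. F Z \<noteq> g Z}"
      by (simp only: map_fst_pair_pmf)
    also have "\<dots> = prob (pair_pmf ?U ?U) {(Z, W). F Z \<noteq> g Z}"
      by (simp add: vimage_def case_prod_unfold)
    finally show ?thesis
      using 1 2 t1 by linarith
  qed
  have int: "g (X \<inter> Y) = g X \<inter> g Y" if "X \<subseteq> {..<n}" "Y \<subseteq> {..<n}" for X Y
  proof (rule ring_hom_if_mostly[OF hom _ that])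
    let ?M = "pair_pmf ?U (pair_pmf ?U ?U)"
    let ?p = "prob ?M"
    let ?A1 = "{(Z, W, V). F ((Z \<inter> W) \<oplus> V) \<oplus> F V \<noteq> F Z \<inter> F W}"
    let ?A2 = "{(Z, W, V). F ((Z \<inter> W) \<oplus> V) \<oplus> F V \<noteq> g (Z \<inter> W)}"
    let ?A3 = "{(Z, W, V). F Z \<noteq> g Z}" and ?A4 = "{(Z, W, V). F W \<noteq> g W}"
    have 1: "?p {(Z, W, V). g (Z \<inter> W) \<noteq> g Z \<inter> g W} \<le> ?p (?A1 \<union> ?A2) + ?p (?A3 \<union> ?A4)"
      by (rule prob_Un_le) auto
    have 2: "?p (?A1 \<union> ?A2) \<le> ?p ?A1 + ?p ?A2" "?p (?A3 \<union> ?A4) \<le> ?p ?A3 + ?p ?A4"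
      by (rule measure_Un_le; simp)+
    have 3: "?p ?A2 \<le> 2 * \<rho>"
    proof -
      have "prob (pair_pmf ?U ?U) {(W, V). F ((Z \<inter> W) \<oplus> V) \<oplus> F V \<noteq> g (Z \<inter> W)} \<le> 2 * \<rho>"
        if "Z \<in> set_pmf ?U" for Z
        using that near \<rho>0 by (intro prob_pair_le') (auto simp: le_infI1)
      then show ?thesis
        using \<rho>0 prob_pair_le'[of ?U "pair_pmf ?U ?U"
            "\<lambda>Z (W, V). F ((Z \<inter> W) \<oplus> V) \<oplus> F V \<noteq> g (Z \<inter> W)" "2 * \<rho>"]
        by (simp add: case_prod_unfold)
    qed
    have "prob (map_pmf fst ?M) {Z. F Z \<noteq> g Z} \<le> 3 * \<rho>"
      unfolding map_fst_pair_pmf by (rule near_F)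
    then have 4: "?p ?A3 \<le> 3 * \<rho>"
      unfolding measure_map_pmf by (simp add: vimage_def case_prod_unfold)
    have "prob (map_pmf fst (map_pmf snd ?M)) {Z. F Z \<noteq> g Z} \<le> 3 * \<rho>"
      unfolding map_fst_pair_pmf map_snd_pair_pmf by (rule near_F)
    then have 5: "?p ?A4 \<le> 3 * \<rho>"
      unfolding measure_map_pmf by (simp add: vimage_def case_prod_unfold)
    \<comment> \<open>The four events contribute \<rho> + 2 \<rho> + 3 \<rho> + 3 \<rho> = 9 \<rho>,
      which is less than 9/40.\<close>
    have "?p {(Z, W, V). g (Z \<inter> W) \<noteq> g Z \<inter> g W} < 1 / 4"
      using 1 2 3 4 5 t2 \<rho>40 by linarith
    moreover have eq: "map_pmf (\<lambda>(x, y). (x, fst y)) ?M = pair_pmf ?U ?U"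
      unfolding map_pair[of "\<lambda>x. x" fst] map_fst_pair_pmf by simp
    have "prob (map_pmf (\<lambda>(x, y). (x, fst y)) ?M) {(Z, W). g (Z \<inter> W) \<noteq> g Z \<inter> g W} =
        ?p {(Z, W, V). g (Z \<inter> W) \<noteq> g Z \<inter> g W}"
      by (simp add: vimage_def case_prod_unfold)
    then have "?p {(Z, W, V). g (Z \<inter> W) \<noteq> g Z \<inter> g W} =
        prob (pair_pmf ?U ?U) {(Z, W). g (Z \<inter> W) \<noteq> g Z \<inter> g W}"
      unfolding eq ..
    ultimately show "prob (pair_pmf ?U ?U) {(Z, W). g (Z \<inter> W) \<noteq> g Z \<inter> g W} < 1 / 4"
      by simp
  qed
  define T where "T = {i. i < n \<and> g {i} \<noteq> {}}"
  have T: "card T \<le> k"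
  proof -
    have "card T \<le> card {1..cnt}"
      unfolding T_def by (rule ring_hom_support_card[OF hom int C]) auto
    then show ?thesis using cnt by simp
  qed
  have g_T: "g Y \<noteq> {} \<longleftrightarrow> Y \<inter> T \<noteq> {}" if "Y \<subseteq> {..<n}" for Y
  proof -
    have "g Y = (\<Union>i\<in>Y. g {i})"
      by (rule ring_hom_Union[OF hom int that])
    moreover have "(\<Union>i\<in>Y. g {i}) \<noteq> {} \<longleftrightarrow> Y \<inter> T \<noteq> {}"
      using that unfolding T_def by blast
    ultimately show ?thesis
      by simp
  qed
  \<comment> \<open>Every literal is the one that \<open>a\<close> satisfies, so this term holds at
    \<open>y\<close> exactly if \<open>y\<close> agrees with \<open>a\<close> on
    \<open>T\<close>.\<close>
  let ?t = "\<lambda>x. \<forall>l \<in> (\<lambda>i. (i, a ! i)) ` T. eval_literal l x"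
  have "?t \<in> k_Term n k"
    unfolding k_Term_def
  proof (intro CollectI exI[of _ "(\<lambda>i. (i, a ! i)) ` T"] conjI)
    show "card ((\<lambda>i. (i, a ! i)) ` T) \<le> k"
      by (rule order_trans[OF card_image_le T]) (simp add: T_def)
  qed (auto simp: T_def)
  then have "\<epsilon> \<le> prob D {y. f y \<noteq> ?t y}"
    by (rule far[unfolded eps_far_def, THEN bspec])
  moreover have "prob D {y. f y \<noteq> ?t y} \<le> prob D {y. neg a (diff a y) \<noteq> (F (diff a y) \<noteq> {})} +
      prob D {y. F (diff a y) \<noteq> g (diff a y)}"
  proof (rule prob_Un_le, rule subsetI)
    fix y assume y: "y \<in> {y. f y \<noteq> ?t y} \<inter> set_pmf D"
    then have len: "length y = n"
      using D by (auto simp: cube_def)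
    have "?t y \<longleftrightarrow> diff a y \<inter> T = {}"
      by (auto simp: eval_literal_def diff_def T_def)
    then have "?t y \<longleftrightarrow> g (diff a y) = {}"
      using g_T[OF diff_subset] by blast
    moreover have "neg a (diff a y) \<longleftrightarrow> \<not> f y"
      using len by (simp add: neg_def flip_diff)
    ultimately show "y \<in> {y. neg a (diff a y) \<noteq> (F (diff a y) \<noteq> {})} \<union> {y. F (diff a y) \<noteq> g (diff a y)}"
      using y by auto
  qed
  \<comment> \<open>As \<open>y\<close> is drawn from \<open>D\<close>, \<open>near_F\<close> is of
    no help. If \<open>F\<close> and \<open>g\<close> differ at \<open>diff a y\<close>, the third
    condition holds only if the vote of \<open>W\<close> is wrong, and for each \<open>y\<close>
    this has probability at most 2 \<rho>. Solving \<open>?p \<le> \<rho> + 2 * \<rho> * ?p\<close>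
    with 2 \<rho> \<le> 1/20 gives the factor 20/19.\<close>
  moreover have "prob D {y. F (diff a y) \<noteq> g (diff a y)} \<le> 20 / 19 * \<rho>"
  proof -
    let ?p = "prob D {y. F (diff a y) \<noteq> g (diff a y)}"
    have 1: "prob (pair_pmf D ?U) {(y, W). F (diff a y) \<noteq> g (diff a y)} \<le>
      prob (pair_pmf D ?U) {(y, W). F (diff a y \<oplus> W) \<oplus> F W \<noteq> F (diff a y)} +
      prob (pair_pmf D ?U) {(y, W). y \<in> {y. F (diff a y) \<noteq> g (diff a y)} \<and>
        F (diff a y \<oplus> W) \<oplus> F W \<noteq> g (diff a y)}"
      by (rule prob_Un_le) auto
    have 2: "prob (pair_pmf D ?U) {(y, W). y \<in> {y. F (diff a y) \<noteq> g (diff a y)} \<and>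
        F (diff a y \<oplus> W) \<oplus> F W \<noteq> g (diff a y)} \<le> 2 * \<rho> * ?p"
      using near[OF diff_subset] \<rho>0 by (intro prob_pair_le) auto
    have "?p = prob (map_pmf fst (pair_pmf D ?U)) {y. F (diff a y) \<noteq> g (diff a y)}"
      by (simp only: map_fst_pair_pmf)
    also have "\<dots> = prob (pair_pmf D ?U) {(y, W). F (diff a y) \<noteq> g (diff a y)}"
      by (simp add: vimage_def case_prod_unfold)
    finally have "?p \<le> \<rho> + 2 * \<rho> * ?p"
      using 1 2 t3 by linarith
    moreover have "2 * \<rho> * ?p \<le> 1 / 20 * ?p"
      using \<rho>40 by (intro mult_right_mono) auto
    ultimately show ?thesis by simp
  qed
  ultimately show ?thesis
    using t4 unfolding \<rho>_def[symmetric] by linarith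
qed

end

section \<open>Random blocks and discovery of relevant blocks\<close>

text \<open>A replacement for the exponential estimate: the product of (1 - x)^t and (1 + x)^t is at
  most 1, and the second factor is at least 1 + t x by Bernoulli. With c = 5 it gives the error
  1/6.\<close>

lemma power_one_minus_le:
  fixes x :: real
  assumes "0 \<le> x" "x \<le> 1" "c \<le> real t * x" "0 \<le> c"
  shows "(1 - x) ^ t \<le> 1 / (1 + c)"
proof -
  have "(1 - x) ^ t * (1 + c) \<le> (1 - x) ^ t * (1 + x) ^ t"
    using assms Bernoulli_inequality[of x t] by (intro mult_left_mono) auto
  also have "\<dots> = (1 - x\<^sup>2) ^ t"
    by (simp add: power_mult_distrib[symmetric] power2_eq_square algebra_simps)
  also have "\<dots> \<le> 1"
    using assms by (intro power_le_one) (auto simp: power_le_one)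
  finally show ?thesis
    using assms by (simp add: field_simps)
qed

lemma prob_False_conv: "prob (M :: bool pmf) {False} = 1 - prob M {True}"
proof -
  have "- {True} = {False}" by auto
  then show ?thesis
    using measure_pmf.prob_compl[of "{True}" M] by (simp add: Compl_eq_Diff_UNIV)
qed

primrec locate :: "(nat \<Rightarrow> bool) \<Rightarrow> nat \<Rightarrow> nat \<Rightarrow> nat" where
  "locate g 0 lo = lo"
| "locate g (Suc d) lo = (if g (lo + 2 ^ d) then locate g d lo else locate g d (lo + 2 ^ d))"

text \<open>The bisection keeps \<open>g\<close> false at the left end and true at the right end of
  its interval. At width one, \<open>g\<close> switches between two neighbours.\<close>

lemma locate:
  assumes "\<not> g lo" "g (lo + 2 ^ d)"
  shows "\<not> g (locate g d lo) \<and> g (Suc (locate g d lo))"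
  using assms
  by (induction d arbitrary: lo) (auto simp: mult_2 add.assoc)

definition random_block :: "nat \<Rightarrow> nat pmf" where
  "random_block l = for_pmf (\<lambda>_ x. map_pmf (\<lambda>b. x + x + of_bool b) (bernoulli_pmf (1 / 2))) l 0 0"

lemma random_block_Suc:
  "random_block (Suc l) =
    bind_pmf (random_block l) (\<lambda>x. map_pmf (\<lambda>b. x + x + of_bool b) (bernoulli_pmf (1 / 2)))"
  unfolding random_block_def by (subst for_pmf_snoc) simp

text \<open>The value \<open>v\<close> forces the last bit to be \<open>odd v\<close> and the prefix
  to be \<open>v div 2\<close>, so each fair bit halves the probability of a point.\<close>

lemma random_block_le: "prob (random_block l) {v} \<le> (1 / 2) ^ l"
proof (induction l arbitrary: v)
  case 0
  show ?case by simp
next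
  case (Suc l)
  have "prob (random_block (Suc l)) {v} \<le> 1 / 2 * prob (random_block l) {v div 2}"
    unfolding random_block_Suc
  proof (rule prob_bind_le_mult)
    fix x assume "x \<in> {v div 2}"
    have "prob (map_pmf (\<lambda>b. x + x + of_bool b) (bernoulli_pmf (1 / 2))) {v} =
        prob (bernoulli_pmf (1 / 2)) ((\<lambda>b. x + x + of_bool b) -` {v})"
      by simp
    also have "\<dots> \<le> prob (bernoulli_pmf (1 / 2)) {odd v}"
      by (rule measure_pmf.finite_measure_mono) auto
    also have "\<dots> = 1 / 2"
      by (cases "odd v") (simp_all add: measure_pmf_single)
    finally show "prob (map_pmf (\<lambda>b. x + x + of_bool b) (bernoulli_pmf (1 / 2))) {v} \<le> 1 / 2" .
  next
    fix x assume "x \<notin> {v div 2}"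
    then have "(\<lambda>b. x + x + of_bool b) -` {v} = {}"
      by (auto simp: of_bool_def mult_2[symmetric] split: if_splits)
    then show "prob (map_pmf (\<lambda>b. x + x + of_bool b) (bernoulli_pmf (1 / 2))) {v} = 0"
      by simp
  qed simp
  also have "\<dots> \<le> 1 / 2 * (1 / 2) ^ l"
    using Suc.IH by (intro mult_left_mono) auto
  finally show ?case by simp
qed

lemma random_block_less: "x \<in> set_pmf (random_block l) \<Longrightarrow> x < 2 ^ l"
proof (induction l arbitrary: x)
  case 0
  then show ?case by (simp add: random_block_def)
next
  case (Suc l)
  then show ?case
    by (fastforce simp: random_block_Suc of_bool_def split: if_splits)
qed

text \<open>Indices that are not variables are sent to block 0, so that the bound by
  \<open>2 ^ l\<close> holds for all arguments.\<close>

definition random_blocks :: "nat \<Rightarrow> nat \<Rightarrow> (nat \<Rightarrow> nat) pmf" where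
  "random_blocks l d = for_pmf (\<lambda>i bl. map_pmf (\<lambda>x. bl(i := x)) (random_block l)) d 0 (\<lambda>_. 0)"

lemma random_blocks_Suc:
  "random_blocks l (Suc d) =
    bind_pmf (random_blocks l d) (\<lambda>bl. map_pmf (\<lambda>x. bl(d := x)) (random_block l))"
  unfolding random_blocks_def by (subst for_pmf_snoc) simp

lemma random_blocks_less: "bl \<in> set_pmf (random_blocks l d) \<Longrightarrow> bl i < 2 ^ l"
proof (induction d arbitrary: bl)
  case 0
  then show ?case by (simp add: random_blocks_def)
next
  case (Suc d)
  then show ?case
    by (auto simp: random_blocks_Suc random_block_less)
qed

text \<open>The birthday bound, one variable at a time: a new variable of \<open>S\<close> hits the
  block of one of at most \<open>K\<close> earlier ones with probability at most
  \<open>K * (1 / 2) ^ l\<close>, and a variable outside \<open>S\<close> adds nothing.\<close>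

lemma random_blocks_collision:
  assumes S: "finite S" "card S \<le> K"
  shows "prob (random_blocks l d) {bl. \<not> inj_on bl (S \<inter> {..<d})} \<le>
    real (card (S \<inter> {..<d})) * (real K * (1 / 2) ^ l)"
proof (induction d)
  case 0
  show ?case by simp
next
  case (Suc d)
  let ?q = "real K * (1 / 2) ^ l"
  show ?case
  proof (cases "d \<in> S")
    case False
    then have e: "S \<inter> {..<Suc d} = S \<inter> {..<d}"
      by (auto simp: less_Suc_eq)
    have "prob (random_blocks l (Suc d)) {bl. \<not> inj_on bl (S \<inter> {..<d})} \<le>
        prob (random_blocks l d) {bl. \<not> inj_on bl (S \<inter> {..<d})} + 0"
      unfolding random_blocks_Suc
    proof (rule prob_bind_le)
      fix bl :: "nat \<Rightarrow> nat" assume "bl \<notin> {bl. \<not> inj_on bl (S \<inter> {..<d})}"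
      then have "inj_on (bl(d := x)) (S \<inter> {..<d})" for x
        by (auto simp: inj_on_def)
      then show "prob (map_pmf (\<lambda>x. bl(d := x)) (random_block l))
          {bl. \<not> inj_on bl (S \<inter> {..<d})} \<le> 0"
        by (simp add: vimage_def)
    qed simp
    with Suc e show ?thesis by simp
  next
    case True
    then have e: "S \<inter> {..<Suc d} = insert d (S \<inter> {..<d})"
      by (auto simp: less_Suc_eq)
    have c: "card (S \<inter> {..<Suc d}) = Suc (card (S \<inter> {..<d}))"
      unfolding e by simp
    have "prob (random_blocks l (Suc d)) {bl. \<not> inj_on bl (S \<inter> {..<Suc d})} \<le>
        prob (random_blocks l d) {bl. \<not> inj_on bl (S \<inter> {..<d})} + ?q"
      unfolding random_blocks_Suc
    proof (rule prob_bind_le)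
      fix bl :: "nat \<Rightarrow> nat" assume "bl \<notin> {bl. \<not> inj_on bl (S \<inter> {..<d})}"
      then have "inj_on bl (S \<inter> {..<d})"
        by simp
      then have "inj_on (bl(d := x)) (S \<inter> {..<Suc d})" if "x \<notin> bl ` (S \<inter> {..<d})" for x
        using that unfolding e by (fastforce simp: inj_on_def)
      then have "prob (map_pmf (\<lambda>x. bl(d := x)) (random_block l))
          {bl. \<not> inj_on bl (S \<inter> {..<Suc d})} \<le>
          prob (random_block l) (\<Union>i \<in> S \<inter> {..<d}. {bl i})"
        unfolding measure_map_pmf by (intro measure_pmf.finite_measure_mono) auto
      also have "\<dots> \<le> (\<Sum>i \<in> S \<inter> {..<d}. prob (random_block l) {bl i})"
        by (rule measure_pmf.finite_measure_subadditive_finite) auto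
      also have "\<dots> \<le> (\<Sum>i \<in> S \<inter> {..<d}. (1 / 2) ^ l)"
        by (intro sum_mono random_block_le)
      also have "\<dots> = real (card (S \<inter> {..<d})) * (1 / 2) ^ l"
        by simp
      also have "\<dots> \<le> ?q"
        using S card_mono[of S "S \<inter> {..<d}"] by (intro mult_right_mono) auto
      finally show "prob (map_pmf (\<lambda>x. bl(d := x)) (random_block l))
          {bl. \<not> inj_on bl (S \<inter> {..<Suc d})} \<le> ?q" .
    qed simp
    with Suc c show ?thesis by (simp add: algebra_simps)
  qed
qed

section \<open>Repeated trials and the discovery process\<close>

context testing
begin

definition trials :: "bool list \<Rightarrow> (nat \<Rightarrow> nat) \<Rightarrow> nat \<Rightarrow> nat \<Rightarrow> bool pmf" where
  "trials a col cnt t = for_pmf (\<lambda>_. trial a col cnt) t 0 False"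

lemma trials_True [simp]: "for_pmf (\<lambda>_. trial a col cnt) t j True = return_pmf True"
  by (induction t arbitrary: j) (simp_all add: trial_def case_prod_unfold bind_return_pmf)

lemma trials_accept:
  "prob (trials a col cnt t) {False} = prob (trial a col cnt False) {False} ^ t"
proof -
  have "prob (for_pmf (\<lambda>_. trial a col cnt) t j False) {False} =
      prob (trial a col cnt False) {False} ^ t" for j
  proof (induction t arbitrary: j)
    case (Suc t)
    have "prob (for_pmf (\<lambda>_. trial a col cnt) (Suc t) j False) {False} =
      prob (trial a col cnt False) {False} ^ t * prob (trial a col cnt False) {False}"
      unfolding for_pmf.simps(2) by (rule prob_bind_eq_mult) (auto simp: Suc.IH)
    then show ?case by simp
  qed simp
  then show ?thesis by (simp add: trials_def)
qed

text \<open>The union bound over the trials, read off from the exact acceptance probability by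
  Bernoulli's inequality.\<close>

lemma trials_reject:
  "prob (trials a col cnt t) {True} \<le> real t * prob (trial a col cnt False) {True}"
proof -
  let ?p = "prob (trial a col cnt False) {True}"
  have "1 + real t * (- ?p) \<le> (1 + (- ?p)) ^ t"
    by (rule Bernoulli_inequality) simp
  then show ?thesis
    using trials_accept[of a col cnt t]
    by (simp add: prob_False_conv)
qed

text \<open>A single trial rejects with probability at least 1/(20 E), so 100 E trials reject 5
  times on average, and 1/(1 + 5) bounds the probability that none of them does.\<close>

lemma trials_soundness:
  assumes D: "set_pmf D \<subseteq> cube n" and a: "length a = n" and cnt: "cnt \<le> k"
    and far: "eps_far D \<epsilon> (k_Term n k) f"
    and E: "1 / real E < \<epsilon>" "2 \<le> E"
  shows "prob (trials a col cnt (100 * E)) {False} \<le> 1 / 6"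
proof -
  let ?p = "prob (trial a col cnt False) {True}"
  \<comment> \<open>If the rejection probability is at least 1/40, the bound follows from
    \<open>2 \<le> E\<close>; otherwise it follows from the distance of \<open>f\<close> to the
    class, with room to spare.\<close>
  have "1 / (20 * real E) \<le> ?p"
  proof (cases "?p < 1 / 40")
    case True
    have "\<epsilon> \<le> 39 / 19 * ?p"
      by (rule trial_soundness[OF D a cnt far True])
    then have "1 / (20 * real E) \<le> 39 / (19 * 20) * ?p"
      using E by simp
    also have "\<dots> \<le> ?p" by simp
    finally show ?thesis .
  next
    case False
    have "2 * ?p \<le> real E * ?p"
      using E by (intro mult_right_mono) auto
    with False have "1 / 20 \<le> real E * ?p"
      by linarith
    then show ?thesis using E by (simp add: field_simps)
  qed
  then have "5 \<le> real (100 * E) * ?p"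
    using E by (simp add: field_simps)
  then have "(1 - ?p) ^ (100 * E) \<le> 1 / (1 + 5)"
    by (intro power_one_minus_le) auto
  then show ?thesis
    unfolding trials_accept prob_False_conv[of "trial a col cnt False"] by simp
qed

text \<open>The guard \<open>cnt < K\<close> protects soundness: for arbitrary \<open>f\<close> it
  limits the number of colours. For a term whose variables lie in different blocks it never prevents
  a marking. New colours start from 1, because 0 stands for unmarked.\<close>

definition explore ::
  "bool list \<Rightarrow> (nat \<Rightarrow> nat) \<Rightarrow> nat \<Rightarrow> nat \<Rightarrow> (nat \<Rightarrow> nat) \<times> nat \<Rightarrow> bool list \<Rightarrow> (nat \<Rightarrow> nat) \<times> nat" where
  "explore a bl l K = (\<lambda>(\<kappa>, cnt) y. let Y = {i \<in> diff a y. \<kappa> (bl i) = 0} in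
     if neg a Y \<and> cnt < K
     then (\<kappa>(locate (\<lambda>c. neg a {i \<in> Y. bl i < c}) l 0 := Suc cnt), Suc cnt) else (\<kappa>, cnt))"

definition discover ::
  "bool list \<Rightarrow> (nat \<Rightarrow> nat) \<Rightarrow> nat \<Rightarrow> nat \<Rightarrow> nat \<Rightarrow> ((nat \<Rightarrow> nat) \<times> nat) pmf" where
  "discover a bl l K M = for_pmf (\<lambda>_ \<sigma>. map_pmf (explore a bl l K \<sigma>) D) M 0 (\<lambda>_. 0, 0)"

lemma discover_le: "\<sigma> \<in> set_pmf (discover a bl l K M) \<Longrightarrow> snd \<sigma> \<le> K"
proof -
  have "snd \<sigma>' \<le> K"
    if "\<sigma>' \<in> set_pmf (for_pmf (\<lambda>_ \<sigma>. map_pmf (explore a bl l K \<sigma>) D) M j \<sigma>)" "snd \<sigma> \<le> K" for j \<sigma> \<sigma>'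
    using that
  proof (induction M arbitrary: j \<sigma>)
    case (Suc M)
    then obtain y where y: "\<sigma>' \<in> set_pmf (for_pmf (\<lambda>_ \<sigma>. map_pmf (explore a bl l K \<sigma>) D) M (Suc j) (explore a bl l K \<sigma> y))"
      by auto
    have "snd (explore a bl l K \<sigma> y) \<le> K"
      using Suc.prems(2) by (auto simp: explore_def Let_def split: prod.splits)
    with Suc.IH[OF y] show ?case .
  qed simp
  then show "\<sigma> \<in> set_pmf (discover a bl l K M) \<Longrightarrow> snd \<sigma> \<le> K"
    unfolding discover_def by fastforce
qed

end

section \<open>Colourings for a term and their miss probability\<close>

context testing
begin

definition coloured :: "nat set \<Rightarrow> (nat \<Rightarrow> nat) \<Rightarrow> nat \<Rightarrow> bool" where
  "coloured S col cnt \<longleftrightarrow> (\<forall>i \<in> S. col i \<le> cnt) \<and> (\<forall>c \<in> {1..cnt}. \<exists>!i. i \<in> S \<and> col i = c)"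

text \<open>These samples have two roles: for separated variables they are exactly those that make
  \<open>explore\<close> add a colour, and they are the only ones on which a trial can reject a
  term. Hence progress of the discovery pays for errors of the trials.\<close>

definition miss :: "bool list \<Rightarrow> nat set \<Rightarrow> (nat \<Rightarrow> nat) \<Rightarrow> bool list set" where
  "miss a S col = {y. diff a y \<inter> S \<inter> {i. col i = 0} \<noteq> {}}"

text \<open>Each colour belongs to one relevant variable \<open>s c\<close>, so \<open>F Z\<close>
  consists of the colours with \<open>s c\<close> in \<open>Z\<close>, and this is an exact ring
  homomorphism. The first three conditions always hold, and the last one fails only at a missed
  sample.\<close>

lemma trial_completeness:
  assumes neg: "\<And>Z. neg a Z \<longleftrightarrow> Z \<inter> S \<noteq> {}" and col: "coloured S col cnt"
  shows "prob (trial a col cnt False) {True} \<le> prob D (miss a S col)"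
proof -
  have "\<forall>c \<in> {1..cnt}. \<exists>!i. i \<in> S \<and> col i = c"
    using col by (simp add: coloured_def)
  then have ex: "\<exists>!i. i \<in> S \<and> col i = c" if "c \<in> {1..cnt}" for c
    using that by (rule bspec)
  define s where "s c = (THE i. i \<in> S \<and> col i = c)" for c
  have s: "i \<in> S \<and> col i = c \<longleftrightarrow> i = s c" if "c \<in> {1..cnt}" for c i
    using theI'[OF ex[OF that]] the1_equality[OF ex[OF that], of i] by (auto simp: s_def)
  have F: "colours a col cnt Z = {c \<in> {1..cnt}. s c \<in> Z}" for Z
  proof -
    have "neg a (Z \<inter> {i. col i = c}) \<longleftrightarrow> s c \<in> Z" if "c \<in> {1..cnt}" for c
    proof -
      have "Z \<inter> {i. col i = c} \<inter> S = {i. i \<in> Z \<and> (i \<in> S \<and> col i = c)}"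
        by auto
      also have "\<dots> = {i. i \<in> Z \<and> i = s c}"
        by (simp only: s[OF that])
      finally show ?thesis
        by (simp add: neg)
    qed
    then show ?thesis by (auto simp: colours_def)
  qed
  have "consistent a col cnt Z W V y" if y: "y \<notin> miss a S col" for Z W V y
  proof -
    have "neg a (diff a y) \<longleftrightarrow> {c \<in> {1..cnt}. s c \<in> diff a y} \<noteq> {}"
    proof
      assume "neg a (diff a y)"
      then obtain i where i: "i \<in> diff a y" "i \<in> S"
        by (auto simp: neg)
      then have "col i \<in> {1..cnt}"
        using y col by (auto simp: miss_def coloured_def Suc_le_eq)
      moreover from s[OF this, of i] i have "i = s (col i)"
        by simp
      ultimately show "{c \<in> {1..cnt}. s c \<in> diff a y} \<noteq> {}"
        using i(1) by auto
    next
      assume "{c \<in> {1..cnt}. s c \<in> diff a y} \<noteq> {}"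
      then obtain c where c: "c \<in> {1..cnt}" "s c \<in> diff a y"
        by blast
      then show "neg a (diff a y)"
        using s[OF c(1), of "s c"] by (auto simp: neg)
    qed
    then show ?thesis
      unfolding consistent_def Let_def F by auto
  qed
  then have "prob quad {(Z, W, V, y). \<not> consistent a col cnt Z W V y} \<le>
      prob quad {(Z, W, V, y). y \<in> miss a S col}"
    by (intro measure_pmf.finite_measure_mono) auto
  then show ?thesis
    using prob_quad(4)[of "usets n" "usets n" "usets n" D "\<lambda>y. y \<in> miss a S col"]
    by (simp add: trial_def quad_def vimage_def case_prod_unfold)
qed

text \<open>Every colour in use is taken by some relevant variable. As long as one of them is
  uncoloured, the count is therefore below \<open>card S\<close>.\<close>

lemma coloured_card:
  assumes "coloured S col cnt" "finite S"
  shows "cnt \<le> card {i \<in> S. col i \<noteq> 0}"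
proof -
  have "{1..cnt} \<subseteq> col ` {i \<in> S. col i \<noteq> 0}"
  proof
    fix c assume c: "c \<in> {1..cnt}"
    then obtain i where "i \<in> S" "col i = c"
      using assms(1) unfolding coloured_def by blast
    with c show "c \<in> col ` {i \<in> S. col i \<noteq> 0}"
      by auto
  qed
  from card_mono[OF _ this] card_image_le[of "{i \<in> S. col i \<noteq> 0}" col] assms(2) show ?thesis
    by simp
qed

context
  fixes a :: "bool list" and S :: "nat set" and bl :: "nat \<Rightarrow> nat" and l K :: nat
  assumes neg: "\<And>Z. neg a Z \<longleftrightarrow> Z \<inter> S \<noteq> {}" and fin: "finite S" and card: "card S \<le> K"
    and inj: "inj_on bl S" and less: "\<And>i. bl i < 2 ^ l"
begin

text \<open>A missed sample raises the number of colours by exactly one and any other sample leaves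
  it unchanged, so that counting colours amounts to counting misses.\<close>

lemma explore_coloured:
  assumes col: "coloured S (\<kappa> \<circ> bl) cnt"
  shows "\<exists>\<kappa>'. explore a bl l K (\<kappa>, cnt) y = (\<kappa>', cnt + of_bool (y \<in> miss a S (\<kappa> \<circ> bl))) \<and>
    coloured S (\<kappa>' \<circ> bl) (cnt + of_bool (y \<in> miss a S (\<kappa> \<circ> bl)))"
proof -
  define Y where "Y = {i \<in> diff a y. \<kappa> (bl i) = 0}"
  have m: "y \<in> miss a S (\<kappa> \<circ> bl) \<longleftrightarrow> neg a Y"
    by (auto simp: miss_def neg Y_def)
  show ?thesis
  proof (cases "neg a Y")
    case False
    then show ?thesis
      using col by (simp add: m explore_def Y_def[symmetric])
  next
    case True
    define b where "b = locate (\<lambda>c. neg a {i \<in> Y. bl i < c}) l 0"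
    \<comment> \<open>No block lies below 0 and all blocks lie below \<open>2 ^ l\<close>, so the
      values at the two ends are false and \<open>neg a Y\<close>. The block at the switch contains
      a relevant uncoloured variable \<open>j\<close>.\<close>
    have "\<not> neg a {i \<in> Y. bl i < b} \<and> neg a {i \<in> Y. bl i < Suc b}"
      unfolding b_def using True less by (intro locate) (auto simp: neg)
    then obtain j where j: "j \<in> Y" "j \<in> S" "bl j = b"
      by (auto simp: neg less_Suc_eq)
    then have j0: "\<kappa> (bl j) = 0"
      by (simp add: Y_def)
    have "card {i \<in> S. (\<kappa> \<circ> bl) i \<noteq> 0} \<le> card (S - {j})"
      using fin j0 by (intro card_mono) auto
    moreover have "card (S - {j}) < card S"
      using j fin by (intro psubset_card_mono) auto
    ultimately have "cnt < K"
      using coloured_card[OF col fin] card by linarith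
    then have e: "explore a bl l K (\<kappa>, cnt) y = (\<kappa>(b := Suc cnt), Suc cnt)"
      using True by (simp add: explore_def Y_def[symmetric] b_def)
    let ?col = "\<kappa>(b := Suc cnt) \<circ> bl"
    \<comment> \<open>Marking \<open>b\<close> recolours no relevant variable other than
      \<open>j\<close>, because \<open>bl\<close> separates them.\<close>
    have new: "?col i = (if i = j then Suc cnt else \<kappa> (bl i))" if "i \<in> S" for i
      using that j inj by (auto simp: inj_on_def)
    have "coloured S ?col (Suc cnt)"
      unfolding coloured_def
    proof (intro conjI ballI)
      show "?col i \<le> Suc cnt" if "i \<in> S" for i
        using col new[OF that] that by (auto simp: coloured_def le_Suc_eq)
      fix c assume c: "c \<in> {1..Suc cnt}"
      show "\<exists>!i. i \<in> S \<and> ?col i = c"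
      proof (cases "c = Suc cnt")
        case True
        show ?thesis
        proof (rule ex1I[of _ j])
          show "j \<in> S \<and> ?col j = c"
            using new[OF j(2)] j(2) True by simp
          fix i assume i: "i \<in> S \<and> ?col i = c"
          show "i = j"
          proof (rule ccontr)
            assume "i \<noteq> j"
            with i new[of i] True have "\<kappa> (bl i) = Suc cnt"
              by simp
            moreover have "\<kappa> (bl i) \<le> cnt"
              using i col by (simp add: coloured_def)
            ultimately show False by simp
          qed
        qed
      next
        case False
        then have "c \<in> {1..cnt}" "c \<noteq> 0"
          using c by auto
        then have "\<exists>!i. i \<in> S \<and> \<kappa> (bl i) = c"
          using col by (simp add: coloured_def)
        moreover have "i \<in> S \<and> ?col i = c \<longleftrightarrow> i \<in> S \<and> \<kappa> (bl i) = c" for i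
        proof (cases "i \<in> S")
          case i: True
          show ?thesis
            unfolding new[OF i] using False j0 \<open>c \<noteq> 0\<close> by auto
        qed simp
        ultimately show ?thesis
          by simp
      qed
    qed
    then show ?thesis
      using True e by (simp add: m)
  qed
qed

lemma miss_antimono:
  "\<sigma>' \<in> set_pmf (for_pmf (\<lambda>_ \<sigma>. map_pmf (explore a bl l K \<sigma>) D) M j \<sigma>) \<Longrightarrow>
   miss a S (fst \<sigma>' \<circ> bl) \<subseteq> miss a S (fst \<sigma> \<circ> bl)"
proof (induction M arbitrary: j \<sigma>)
  case 0
  then show ?case by simp
next
  case (Suc M)
  from Suc.prems have "\<exists>y \<in> set_pmf D. \<sigma>' \<in> set_pmf (for_pmf (\<lambda>_ \<sigma>. map_pmf (explore a bl l K \<sigma>) D) M (Suc j) (explore a bl l K \<sigma> y))"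
    unfolding for_pmf.simps set_bind_pmf set_map_pmf by (rule UN_E) blast
  then obtain y where y: "\<sigma>' \<in> set_pmf (for_pmf (\<lambda>_ \<sigma>. map_pmf (explore a bl l K \<sigma>) D) M (Suc j) (explore a bl l K \<sigma> y))" ..
  have "(fst (explore a bl l K \<sigma> y) \<circ> bl) i \<noteq> 0" if "(fst \<sigma> \<circ> bl) i \<noteq> 0" for i
    using that by (simp add: explore_def Let_def split_beta)
  then have "{i. (fst (explore a bl l K \<sigma> y) \<circ> bl) i = 0} \<subseteq> {i. (fst \<sigma> \<circ> bl) i = 0}"
    by (meson Collect_mono)
  then have "miss a S (fst (explore a bl l K \<sigma> y) \<circ> bl) \<subseteq> miss a S (fst \<sigma> \<circ> bl)"
    unfolding miss_def by blast
  with Suc.IH[OF y] show ?case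
    by (rule order_trans)
qed

text \<open>The expected number of new colours in a step is the current miss probability, and miss
  probabilities only decrease. As at most \<open>K\<close> colours are found in total, the final miss probability
  is at most \<open>K / M\<close> on average.\<close>

lemma expected_miss:
  assumes "coloured S (\<kappa> \<circ> bl) cnt"
  shows "of_nat M * (\<integral>\<^sup>+\<sigma>. emeasure D (miss a S (fst \<sigma> \<circ> bl)) \<partial>for_pmf (\<lambda>_ \<sigma>. map_pmf (explore a bl l K \<sigma>) D) M j (\<kappa>, cnt)) + of_nat cnt
    \<le> (of_nat K :: ennreal)"
  using assms
proof (induction M arbitrary: j \<kappa> cnt)
  case 0
  have "cnt \<le> card {i \<in> S. (\<kappa> \<circ> bl) i \<noteq> 0}"
    by (rule coloured_card[OF 0 fin])
  also have "\<dots> \<le> card S"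
    using fin by (intro card_mono) auto
  finally show ?case using card by simp
next
  case (Suc M)
  let ?B = "\<lambda>_ \<sigma>. map_pmf (explore a bl l K \<sigma>) D"
  let ?e = "\<lambda>\<sigma>. emeasure D (miss a S (fst \<sigma> \<circ> bl))"
  let ?U = "\<lambda>\<sigma>. \<integral>\<^sup>+\<sigma>. ?e \<sigma> \<partial>for_pmf ?B M (Suc j) \<sigma>"
  let ?V = "\<integral>\<^sup>+\<sigma>. ?U \<sigma> \<partial>map_pmf (explore a bl l K (\<kappa>, cnt)) D"
  let ?m = "emeasure D (miss a S (\<kappa> \<circ> bl))"
  have V: "(\<integral>\<^sup>+\<sigma>. ?e \<sigma> \<partial>for_pmf ?B (Suc M) j (\<kappa>, cnt)) = ?V"
    by simp
  have "?V \<le> ?m"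
    unfolding V[symmetric]
  proof -
    have "(\<integral>\<^sup>+\<sigma>. ?e \<sigma> \<partial>for_pmf ?B (Suc M) j (\<kappa>, cnt)) \<le>
        (\<integral>\<^sup>+\<sigma>. ?m \<partial>for_pmf ?B (Suc M) j (\<kappa>, cnt))"
      using miss_antimono[of _ "Suc M" j "(\<kappa>, cnt)"]
      by (intro nn_integral_mono_AE AE_pmfI emeasure_mono) (auto simp del: for_pmf.simps)
    then show "(\<integral>\<^sup>+\<sigma>. ?e \<sigma> \<partial>for_pmf ?B (Suc M) j (\<kappa>, cnt)) \<le> ?m"
      by (simp del: for_pmf.simps)
  qed
  \<comment> \<open>The induction hypothesis after a first sample \<open>y\<close>, averaged over
    \<open>y\<close>; the indicator of a miss is the increase of \<open>cnt\<close> in this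
    step.\<close>
  have "of_nat M * ?V + (?m + of_nat cnt) \<le> of_nat K"
  proof -
    have "of_nat M * ?V + (?m + of_nat cnt) =
        of_nat M * (\<integral>\<^sup>+y. ?U (explore a bl l K (\<kappa>, cnt) y) \<partial>D) +
        ((\<integral>\<^sup>+y. indicator (miss a S (\<kappa> \<circ> bl)) y \<partial>D) + (\<integral>\<^sup>+y. of_nat cnt \<partial>D))"
      by simp
    also have "\<dots> = (\<integral>\<^sup>+y. of_nat M * ?U (explore a bl l K (\<kappa>, cnt) y) +
        (indicator (miss a S (\<kappa> \<circ> bl)) y + of_nat cnt) \<partial>D)"
      by (simp add: nn_integral_add nn_integral_cmult)
    also have "\<dots> \<le> (\<integral>\<^sup>+y. of_nat K \<partial>D)"
    proof (rule nn_integral_mono)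
      fix y
      obtain \<kappa>' where e: "explore a bl l K (\<kappa>, cnt) y = (\<kappa>', cnt + of_bool (y \<in> miss a S (\<kappa> \<circ> bl)))"
        and c: "coloured S (\<kappa>' \<circ> bl) (cnt + of_bool (y \<in> miss a S (\<kappa> \<circ> bl)))"
        using explore_coloured[OF Suc.prems] by blast
      from Suc.IH[OF c, of "Suc j"]
      show "of_nat M * ?U (explore a bl l K (\<kappa>, cnt) y) + (indicator (miss a S (\<kappa> \<circ> bl)) y + of_nat cnt) \<le> of_nat K"
        unfolding e by (auto simp: indicator_def add_ac comp_def)
    qed
    finally show ?thesis by simp
  qed
  \<comment> \<open>The additional summand \<open>?V\<close> is absorbed by the present miss
    probability \<open>?m\<close>.\<close>
  moreover have "of_nat (Suc M) * ?V + of_nat cnt \<le> of_nat M * ?V + (?m + of_nat cnt)"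
    using \<open>?V \<le> ?m\<close> by (simp add: distrib_right add.assoc add_left_mono add_right_mono add.left_commute)
  ultimately show ?case
    unfolding V by (rule order_trans[rotated])
qed

end

end

section \<open>The abstract tester\<close>

context testing
begin

text \<open>For a term with separated variables, \<open>K * (1000 * E)\<close> samples bring the
  expected miss probability down to 1/(1000 E), so that 100 E trials reject with probability at most
  1/10.\<close>

definition verify :: "bool list \<Rightarrow> nat \<Rightarrow> nat \<Rightarrow> nat \<Rightarrow> bool pmf" where
  "verify a l K E = bind_pmf (random_blocks l n) (\<lambda>bl. bind_pmf (discover a bl l K (K * (1000 * E)))
     (\<lambda>\<sigma>. map_pmf Not (trials a (fst \<sigma> \<circ> bl) (snd \<sigma>) (100 * E))))"

text \<open>A positive point is kept once it is found; otherwise the last negative point survives,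
  to be complemented later. The initial point is the one stored in zero memory.\<close>

definition find_positive :: "nat \<Rightarrow> (bool \<times> bool list) pmf" where
  "find_positive t = for_pmf (\<lambda>_ s. if fst s then return_pmf s else map_pmf (\<lambda>y. (f y, y)) D) t 0
     (f (replicate n False), replicate n False)"

text \<open>Without a positive point, \<open>f\<close> is close to the constant false function, which is a term unless
  \<open>k < 2\<close> or \<open>n = 0\<close>. In these two cases a term is true at the complement of a negative point.\<close>

definition tester :: "nat \<Rightarrow> nat \<Rightarrow> nat \<Rightarrow> nat \<Rightarrow> bool pmf" where
  "tester k l K E = bind_pmf (find_positive (5 * E)) (\<lambda>s.
     if fst s then verify (snd s) l K E
     else if k < 2 \<or> n = 0 then
       if f (flip (snd s) UNIV) then verify (flip (snd s) UNIV) l K E else return_pmf False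
     else return_pmf True)"

lemma discover_coloured:
  assumes neg: "\<And>Z. neg a Z \<longleftrightarrow> Z \<inter> S \<noteq> {}" and fin: "finite S" and card: "card S \<le> K"
    and inj: "inj_on bl S" and less: "\<And>i. bl i < 2 ^ l"
    and \<sigma>: "\<sigma> \<in> set_pmf (discover a bl l K M)"
  shows "coloured S (fst \<sigma> \<circ> bl) (snd \<sigma>)"
proof -
  let ?B = "\<lambda>_ \<sigma>. map_pmf (explore a bl l K \<sigma>) D"
  have "coloured S (fst \<sigma>' \<circ> bl) (snd \<sigma>')"
    if "\<sigma>' \<in> set_pmf (for_pmf ?B M j (\<kappa>, cnt))" "coloured S (\<kappa> \<circ> bl) cnt" for j \<kappa> cnt \<sigma>'
    using that
  proof (induction M arbitrary: j \<kappa> cnt)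
    case 0
    then show ?case by simp
  next
    case (Suc M)
    from Suc.prems(1) obtain y where
      y: "\<sigma>' \<in> set_pmf (for_pmf ?B M (Suc j) (explore a bl l K (\<kappa>, cnt) y))"
      by auto
    obtain \<kappa>' where e: "explore a bl l K (\<kappa>, cnt) y = (\<kappa>', cnt + of_bool (y \<in> miss a S (\<kappa> \<circ> bl)))"
      and c: "coloured S (\<kappa>' \<circ> bl) (cnt + of_bool (y \<in> miss a S (\<kappa> \<circ> bl)))"
      using explore_coloured[OF neg fin card inj less Suc.prems(2)] by blast
    from Suc.IH[OF y[unfolded e] c] show ?case .
  qed
  from this[OF \<sigma>[unfolded discover_def]] show ?thesis
    by (simp add: coloured_def)
qed

text \<open>The error consists of 1/32 for a collision of relevant variables and 1/10 for missed
  samples. The miss probability is itself random, so the rejection bound for given colours is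
  integrated over the outcome of the discovery.\<close>

lemma verify_completeness:
  assumes neg: "\<And>Z. neg a Z \<longleftrightarrow> Z \<inter> S \<noteq> {}" and S: "S \<subseteq> {..<n}" and card: "card S \<le> K"
    and l: "32 * K * K \<le> 2 ^ l" and E: "0 < E"
  shows "prob (verify a l K E) {False} \<le> 1 / 3"
proof -
  have fin: "finite S"
    using S finite_subset by blast
  have "prob (verify a l K E) {False} \<le>
      prob (random_blocks l n) {bl. \<not> inj_on bl S} + 1 / 10"
    unfolding verify_def
  proof (rule prob_bind_le)
    fix bl :: "nat \<Rightarrow> nat"
    assume bl: "bl \<in> set_pmf (random_blocks l n)" "bl \<notin> {bl. \<not> inj_on bl S}"
    then have inj: "inj_on bl S" and less: "\<And>i. bl i < 2 ^ l"
      by (simp_all add: random_blocks_less)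
    let ?M = "K * (1000 * E)"
    let ?e = "\<lambda>\<sigma>. emeasure D (miss a S (fst \<sigma> \<circ> bl))"
    let ?D = "discover a bl l K ?M"
    let ?N = "\<lambda>\<sigma>. map_pmf Not (trials a (fst \<sigma> \<circ> bl) (snd \<sigma>) (100 * E))"
    let ?U = "\<integral>\<^sup>+\<sigma>. ?e \<sigma> \<partial>?D"
    have "?U \<le> (\<integral>\<^sup>+\<sigma>. 1 \<partial>?D)"
      by (intro nn_integral_mono measure_pmf.emeasure_le_1)
    then have "?U \<le> 1" by simp
    then have "?U \<noteq> \<top>"
      by (metis ennreal_one_neq_top top.extremum_unique)
    then obtain u where u: "?U = ennreal u" "0 \<le> u"
      by (cases ?U) auto
    have "of_nat ?M * ?U + of_nat 0 \<le> (of_nat K :: ennreal)"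
      unfolding discover_def
      by (rule expected_miss[OF neg fin card inj less]) (simp add: coloured_def)
    then have "ennreal (real ?M * u) \<le> ennreal (real K)"
      unfolding u(1) using u(2) by (simp add: ennreal_mult ennreal_of_nat_eq_real_of_nat del: of_nat_mult)
    then have Mu: "real ?M * u \<le> real K"
      by simp
    \<comment> \<open>Since the number of samples has the factor \<open>K\<close>, it cancels
      against the bound \<open>K\<close> on the number of colours. For \<open>K = 0\<close> there is
      no relevant variable and nothing can be missed.\<close>
    have u10: "real (100 * E) * u \<le> 1 / 10"
    proof (cases "K = 0")
      case True
      then have "S = {}"
        using card fin by simp
      then have "?U = 0"
        by (simp add: miss_def)
      then show ?thesis
        using u by simp
    next
      case False
      then have "real K * (1000 * real E * u) \<le> real K * 1"
        using Mu by (simp add: mult_ac)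
      then have "1000 * real E * u \<le> 1"
        using False by (simp del: mult_1_right)
      then show ?thesis by simp
    qed
    have "emeasure (bind_pmf ?D ?N) {False} =
        (\<integral>\<^sup>+\<sigma>. emeasure (?N \<sigma>) {False} \<partial>?D)"
      by simp
    also have "\<dots> \<le> (\<integral>\<^sup>+\<sigma>. ennreal (real (100 * E)) * ?e \<sigma> \<partial>?D)"
    proof (rule nn_integral_mono_AE, rule AE_pmfI)
      fix \<sigma> assume "\<sigma> \<in> set_pmf ?D"
      then have col: "coloured S (fst \<sigma> \<circ> bl) (snd \<sigma>)"
        by (rule discover_coloured[OF neg fin card inj less])
      have "Not -` {False} = {True}" by auto
      then have "prob (?N \<sigma>) {False} =
          prob (trials a (fst \<sigma> \<circ> bl) (snd \<sigma>) (100 * E)) {True}"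
        by simp
      also have "\<dots> \<le> real (100 * E) * prob (trial a (fst \<sigma> \<circ> bl) (snd \<sigma>) False) {True}"
        by (rule trials_reject)
      also have "\<dots> \<le> real (100 * E) * prob D (miss a S (fst \<sigma> \<circ> bl))"
        by (rule mult_left_mono[OF trial_completeness[OF neg col]]) simp
      finally show "emeasure (?N \<sigma>) {False} \<le> ennreal (real (100 * E)) * ?e \<sigma>"
        by (simp add: measure_pmf.emeasure_eq_measure ennreal_mult[symmetric] ennreal_leI)
    qed
    also have "\<dots> = ennreal (real (100 * E)) * ?U"
      by (rule nn_integral_cmult) simp
    also have "\<dots> = ennreal (real (100 * E) * u)"
      unfolding u(1) by (rule ennreal_mult[symmetric]) (use u in auto)
    also have "\<dots> \<le> ennreal (1 / 10)"
      by (rule ennreal_leI[OF u10])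
    finally show "prob (bind_pmf ?D ?N) {False} \<le> 1 / 10"
      unfolding measure_pmf.emeasure_eq_measure by (subst (asm) ennreal_le_iff) auto
  qed simp
  also have "prob (random_blocks l n) {bl. \<not> inj_on bl S} \<le> 1 / 32"
  proof -
    have e: "S \<inter> {..<n} = S"
      using S by auto
    have "prob (random_blocks l n) {bl. \<not> inj_on bl S} \<le> real (card S) * (real K * (1 / 2) ^ l)"
      using random_blocks_collision[OF fin card, of l n] unfolding e .
    also have "\<dots> \<le> real K * (real K * (1 / 2) ^ l)"
      using card by (intro mult_right_mono) auto
    also have "\<dots> = real (K * K) / 2 ^ l"
      by (simp add: power_divide)
    also have "\<dots> \<le> 1 / 32"
    proof -
      have "real (32 * K * K) \<le> real (2 ^ l)"
        using l by (rule of_nat_mono)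
      then show ?thesis by (simp add: field_simps)
    qed
    finally show ?thesis .
  qed
  finally show ?thesis by simp
qed

text \<open>The bound on the trials holds for each outcome of the hashing and of the discovery,
  since every outcome has at most \<open>K\<close> colours.\<close>

lemma verify_soundness:
  assumes D: "set_pmf D \<subseteq> cube n" and a: "length a = n" and K: "K \<le> k"
    and far: "eps_far D \<epsilon> (k_Term n k) f"
    and E: "1 / real E < \<epsilon>" "2 \<le> E"
  shows "prob (verify a l K E) {True} \<le> 1 / 6"
proof -
  have "prob (verify a l K E) {True} \<le> prob (random_blocks l n) {} + 1 / 6"
    unfolding verify_def
  proof (rule prob_bind_le)
    fix bl :: "nat \<Rightarrow> nat"
    let ?M = "K * (1000 * E)"
    let ?N = "\<lambda>\<sigma>. map_pmf Not (trials a (fst \<sigma> \<circ> bl) (snd \<sigma>) (100 * E))"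
    have "prob (bind_pmf (discover a bl l K ?M) ?N) {True} \<le>
      prob (discover a bl l K ?M) {} + 1 / 6"
    proof (rule prob_bind_le)
      fix \<sigma> assume "\<sigma> \<in> set_pmf (discover a bl l K ?M)"
      then have "snd \<sigma> \<le> k"
        using discover_le K order_trans by blast
      moreover have "Not -` {True} = {False}" by auto
      ultimately show "prob (?N \<sigma>) {True} \<le> 1 / 6"
        using trials_soundness[OF D a _ far E] by simp
    qed simp
    then show "prob (bind_pmf (discover a bl l K ?M) ?N) {True} \<le> 1 / 6"
      by simp
  qed simp
  then show ?thesis by simp
qed

lemma find_positive_set:
  assumes D: "set_pmf D \<subseteq> cube n" and s: "s \<in> set_pmf (find_positive t)"
  shows "length (snd s) = n" "fst s \<longleftrightarrow> f (snd s)"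
proof -
  let ?B = "\<lambda>_ s. if fst s then return_pmf s else map_pmf (\<lambda>y. (f y, y)) D"
  have "length (snd s') = n \<and> (fst s' \<longleftrightarrow> f (snd s'))"
    if "s' \<in> set_pmf (for_pmf ?B t j s)" "length (snd s) = n \<and> (fst s \<longleftrightarrow> f (snd s))" for j s s'
    using that
  proof (induction t arbitrary: j s)
    case 0
    then show ?case by simp
  next
    case (Suc t)
    from Suc.prems(1) obtain s1 where
      s1: "s1 \<in> set_pmf (?B j s)" "s' \<in> set_pmf (for_pmf ?B t (Suc j) s1)"
      by auto
    from s1(1) have "length (snd s1) = n \<and> (fst s1 \<longleftrightarrow> f (snd s1))"
      using Suc.prems(2) D by (cases "fst s") (auto simp: cube_def)
    from Suc.IH[OF s1(2) this] show ?case .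
  qed
  from this[OF s[unfolded find_positive_def]] show "length (snd s) = n" "fst s \<longleftrightarrow> f (snd s)"
    by simp_all
qed

lemma find_positive_fails:
  "prob (find_positive t) {s. \<not> fst s} \<le> (1 - prob D {y. f y}) ^ t"
proof -
  let ?B = "\<lambda>_ s. if fst s then return_pmf s else map_pmf (\<lambda>y. (f y, y)) D"
  let ?q = "1 - prob D {y. f y}"
  have T: "prob (for_pmf ?B t j s) {s. \<not> fst s} = 0" if "fst s" for j t and s :: "bool \<times> bool list"
    using that by (induction t arbitrary: j) (simp_all add: bind_return_pmf)
  have q: "prob D {y. \<not> f y} = ?q"
    using measure_pmf.prob_compl[of "{y. f y}" D] by (simp add: Compl_eq_Diff_UNIV[symmetric] Collect_neg_eq)
  have "prob (for_pmf ?B t j s) {s. \<not> fst s} \<le> ?q ^ t" for j and s :: "bool \<times> bool list"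
  proof (induction t arbitrary: j s)
    case 0
    show ?case by (simp add: measure_pmf.prob_le_1)
  next
    case (Suc t)
    show ?case
    proof (cases "fst s")
      case True
      then show ?thesis
        by (subst T) simp_all
    next
      case False
      have "prob (for_pmf ?B (Suc t) j s) {s. \<not> fst s} \<le>
          ?q ^ t * prob (?B j s) {s. \<not> fst s}"
        unfolding for_pmf.simps(2) by (rule prob_bind_le_mult) (use Suc.IH T in auto)
      also have "prob (?B j s) {s. \<not> fst s} = ?q"
        using False q by (simp add: vimage_def)
      finally show ?thesis by (simp add: mult.commute)
    qed
  qed
  then show ?thesis by (simp add: find_positive_def)
qed

text \<open>Verification accepts with probability at most 1/6. Acceptance without it requires that
  no positive point was found although \<open>k \<ge> 2\<close> and \<open>n > 0\<close>. Then the
  constant false function is a term, so \<open>f\<close> is positive with probability at least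
  \<epsilon>, and 5 E samples overlook this with probability at most 1/6.\<close>

lemma tester_soundness:
  assumes D: "set_pmf D \<subseteq> cube n" and k: "1 \<le> k" and K: "K \<le> k"
    and far: "eps_far D \<epsilon> (k_Term n k) f"
    and E: "1 / real E < \<epsilon>" "2 \<le> E"
  shows "prob (tester k l K E) {True} \<le> 1 / 3"
proof -
  define B where "B = {s :: bool \<times> bool list. \<not> fst s \<and> \<not> (k < 2 \<or> n = 0)}"
  have "prob (tester k l K E) {True} \<le> prob (find_positive (5 * E)) B + 1 / 6"
    unfolding tester_def
  proof (rule prob_bind_le)
    fix s assume s: "s \<in> set_pmf (find_positive (5 * E))" "s \<notin> B"
    have cases: "prob (if fst s then V else if k < 2 \<or> n = 0 then
        if P then V' else return_pmf False else return_pmf True) {True} \<le> 1 / 6"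
      if "prob V {True} \<le> 1 / 6" "prob V' {True} \<le> 1 / 6" for V V' P
      using that s(2) by (auto simp: B_def)
    have "prob (verify (snd s) l K E) {True} \<le> 1 / 6"
      by (rule verify_soundness[OF D find_positive_set(1)[OF D s(1)] K far E])
    moreover have "prob (verify (flip (snd s) UNIV) l K E) {True} \<le> 1 / 6"
      by (rule verify_soundness[OF D length_flip K far E])
    ultimately show "prob (if fst s then verify (snd s) l K E
        else if k < 2 \<or> n = 0 then
          if f (flip (snd s) UNIV) then verify (flip (snd s) UNIV) l K E else return_pmf False
        else return_pmf True) {True} \<le> 1 / 6"
      by (rule cases)
  qed simp
  also have "prob (find_positive (5 * E)) B \<le> 1 / 6"
  proof (cases "k < 2 \<or> n = 0")
    case True
    then show ?thesis by (simp add: B_def)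
  next
    case False
    let ?p = "prob D {y. f y}"
    \<comment> \<open>The conjunction of variable 0 and its negation; it uses one variable and two
      literals.\<close>
    have "(\<lambda>_. False) \<in> k_Term n k"
      unfolding k_Term_def using False
      by (intro CollectI exI[of _ "{(0, True), (0, False)}"]) (auto simp: eval_literal_def)
    from far[unfolded eps_far_def, THEN bspec, OF this] have "\<epsilon> \<le> ?p"
      by simp
    with E have "1 / real E \<le> ?p" by simp
    then have "5 \<le> real (5 * E) * ?p"
      using E by (simp add: field_simps)
    then have "(1 - ?p) ^ (5 * E) \<le> 1 / (1 + 5)"
      by (intro power_one_minus_le) auto
    moreover have "prob (find_positive (5 * E)) B \<le> prob (find_positive (5 * E)) {s. \<not> fst s}"
      by (rule measure_pmf.finite_measure_mono) (auto simp: B_def)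
    ultimately show ?thesis
      using find_positive_fails[of "5 * E"] by simp
  qed
  finally show ?thesis by simp
qed

text \<open>As \<open>a\<close> satisfies the term, no variable occurs with both signs, and flipping
  \<open>Z\<close> falsifies the term exactly if \<open>Z\<close> meets its variables. There are at
  most \<open>min k n\<close> of them even if \<open>k\<close> is much larger.\<close>

lemma verify_k_Term:
  assumes f: "f \<in> k_Term n k" and a: "length a = n" "f a"
    and l: "32 * min k n * min k n \<le> 2 ^ l" and E: "0 < E"
  shows "prob (verify a l (min k n) E) {False} \<le> 1 / 3"
proof -
  obtain L where L: "L \<subseteq> {..<n} \<times> UNIV" "card L \<le> k"
    "\<And>x. x \<in> cube n \<Longrightarrow> f x \<longleftrightarrow> (\<forall>l \<in> L. eval_literal l x)"
    using f by (auto simp: k_Term_def)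
  define S where "S = fst ` L"
  have finL: "finite L"
    using L(1) by (rule finite_subset) simp
  have "\<forall>l \<in> L. eval_literal l a"
    using L(3)[of a] a by (simp add: cube_def)
  then have La: "snd l = a ! fst l" if "l \<in> L" for l
    using that by (simp add: eval_literal_def)
  have S: "S \<subseteq> {..<n}"
    using L(1) by (auto simp: S_def)
  have "card S \<le> k"
    using card_image_le[OF finL, of fst] L(2) by (simp add: S_def)
  moreover have "card S \<le> n"
    using card_mono[OF _ S] by simp
  ultimately have card: "card S \<le> min k n"
    by simp
  have "neg a Z \<longleftrightarrow> Z \<inter> S \<noteq> {}" for Z
  proof -
    have "eval_literal l (flip a Z) \<longleftrightarrow> fst l \<notin> Z" if "l \<in> L" for l
    proof -
      have "fst l < n"
        using L(1) that by auto
      then show ?thesis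
        using La[OF that] by (auto simp: eval_literal_def)
    qed
    then have "f (flip a Z) \<longleftrightarrow> (\<forall>l \<in> L. fst l \<notin> Z)"
      using L(3)[of "flip a Z"] by (simp add: cube_def)
    then show ?thesis
      by (auto simp: neg_def S_def)
  qed
  then show ?thesis
    by (rule verify_completeness[OF _ S card l E])
qed

lemma tester_completeness:
  assumes D: "set_pmf D \<subseteq> cube n" and k: "1 \<le> k" and f: "f \<in> k_Term n k"
    and l: "32 * min k n * min k n \<le> 2 ^ l" and E: "0 < E"
  shows "prob (tester k l (min k n) E) {False} \<le> 1 / 3"
proof -
  have "prob (tester k l (min k n) E) {False} \<le>
      prob (find_positive (5 * E)) {} + 1 / 3"
    unfolding tester_def
  proof (rule prob_bind_le)
    fix s assume "s \<in> set_pmf (find_positive (5 * E))"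
    note s = find_positive_set[OF D this]
    have "f (flip (snd s) UNIV)" if s_neg: "\<not> fst s" and small: "k < 2 \<or> n = 0"
    proof -
      obtain L where L: "L \<subseteq> {..<n} \<times> UNIV" "card L \<le> k"
        "\<And>x. x \<in> cube n \<Longrightarrow> f x \<longleftrightarrow> (\<forall>l \<in> L. eval_literal l x)"
        using f by (auto simp: k_Term_def)
      have finL: "finite L"
        using L(1) by (rule finite_subset) simp
      \<comment> \<open>A falsified literal witnesses \<open>n > 0\<close>, so that
        \<open>k < 2\<close> and the term is this single literal, which holds at the
        complement.\<close>
      obtain l where l: "l \<in> L" "\<not> eval_literal l (snd s)"
        using L(3)[of "snd s"] s s_neg by (auto simp: cube_def)
      then have n: "fst l < n"
        using L(1) by auto
      then have "card L \<le> 1"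
        using small L(2) by auto
      then have "L = {l}"
        using l(1) finL card_le_Suc0_iff_eq[OF finL] by auto
      moreover have "eval_literal l (flip (snd s) UNIV)"
        using l(2) n by (auto simp: eval_literal_def)
      ultimately show ?thesis
        using L(3)[of "flip (snd s) UNIV"] by (simp add: cube_def)
    qed
    then show "prob (if fst s then verify (snd s) l (min k n) E
        else if k < 2 \<or> n = 0 then
          if f (flip (snd s) UNIV) then verify (flip (snd s) UNIV) l (min k n) E else return_pmf False
        else return_pmf True) {False} \<le> 1 / 3"
      using s verify_k_Term[OF f s(1) _ l E] verify_k_Term[OF f length_flip _ l E] by simp
  qed simp
  then show ?thesis by simp
qed

end

section \<open>Sets as programs\<close>

lemma pair_pmf_of_set:
  assumes "finite A" "A \<noteq> {}" "finite B" "B \<noteq> {}"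
  shows "pair_pmf (pmf_of_set A) (pmf_of_set B) = pmf_of_set (A \<times> B)"
proof (rule pmf_eqI)
  fix p
  show "pmf (pair_pmf (pmf_of_set A) (pmf_of_set B)) p = pmf (pmf_of_set (A \<times> B)) p"
    using assms by (cases p) (simp add: pmf_pair card_cartesian_product indicator_def)
qed

text \<open>A subset of \<open>{..<Suc n}\<close> amounts to a subset of \<open>{..<n}\<close> and
  one fair bit for \<open>n\<close>; this matches the program that flips one coin per
  variable.\<close>

lemma usets_Suc:
  "usets (Suc n) =
    bind_pmf (usets n) (\<lambda>Z. map_pmf (\<lambda>b. if b then insert n Z else Z) (bernoulli_pmf (1 / 2)))"
proof -
  let ?h = "\<lambda>(Z, b). if b then insert n Z else Z"
  have "bij_betw ?h (Pow {..<n} \<times> UNIV) (Pow {..<Suc n})"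
    by (rule bij_betw_byWitness[where f' = "\<lambda>X. (X - {n}, n \<in> X)"])
      (auto simp: less_Suc_eq split: if_splits)
  then have "map_pmf ?h (pmf_of_set (Pow {..<n} \<times> UNIV)) = usets (Suc n)"
    unfolding usets_def by (rule map_pmf_of_set_bij_betw) auto
  moreover have "pair_pmf (usets n) (bernoulli_pmf (1 / 2)) = pmf_of_set (Pow {..<n} \<times> UNIV)"
    unfolding usets_def bernoulli_pmf_half_conv_pmf_of_set by (rule pair_pmf_of_set) auto
  ultimately have "usets (Suc n) = map_pmf ?h (pair_pmf (usets n) (bernoulli_pmf (1 / 2)))"
    by simp
  also have "\<dots> = bind_pmf (usets n) (\<lambda>Z. map_pmf (\<lambda>b. if b then insert n Z else Z) (bernoulli_pmf (1 / 2)))"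
    by (simp add: pair_pmf_def map_pmf_def bind_assoc_pmf bind_return_pmf)
  finally show ?thesis .
qed

lemma usets_for:
  "for_pmf (\<lambda>j Z. map_pmf (\<lambda>b. if b then insert j Z else Z) (bernoulli_pmf (1 / 2))) n 0 {} = usets n"
proof (induction n)
  case 0
  show ?case by (simp add: usets_def pmf_of_set_singleton)
next
  case (Suc n)
  then show ?case
    by (simp only: for_pmf_snoc usets_Suc add_0)
qed

abbreviation (input) rd :: "nat \<Rightarrow> expr" where "rd v \<equiv> Read v (Const 0)"
abbreviation (input) setv :: "nat \<Rightarrow> expr \<Rightarrow> com" where "setv v \<equiv> Store v (Const 0)"

text \<open>The arrays besides the inputs 0 to 3 and the output 4. Point \<open>a\<close> is in \<open>vA\<close>, the query point is
  assembled in \<open>vP\<close>, there are \<open>vR = 2 ^ vL\<close> blocks, \<open>vBL\<close> maps variables to blocks and \<open>vMK\<close> maps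
  blocks to colours, where unmarked blocks have colour 0. Arrays 31 to 37 hold the answers to the
  queries of a colour test.\<close>

abbreviation (input) "vE \<equiv> 5 :: nat"
abbreviation (input) "vA \<equiv> 6 :: nat"
abbreviation (input) "vFd \<equiv> 7 :: nat"
abbreviation (input) "ci \<equiv> 8 :: nat"
abbreviation (input) "vP \<equiv> 9 :: nat"
abbreviation (input) "vK \<equiv> 10 :: nat"
abbreviation (input) "vU \<equiv> 11 :: nat"
abbreviation (input) "vL \<equiv> 12 :: nat"
abbreviation (input) "vR \<equiv> 13 :: nat"
abbreviation (input) "vBL \<equiv> 14 :: nat"
abbreviation (input) "cr \<equiv> 15 :: nat"
abbreviation (input) "cl \<equiv> 16 :: nat"
abbreviation (input) "cc \<equiv> 17 :: nat"
abbreviation (input) "vY \<equiv> 18 :: nat"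
abbreviation (input) "vQ \<equiv> 19 :: nat"
abbreviation (input) "vLo \<equiv> 20 :: nat"
abbreviation (input) "vW \<equiv> 21 :: nat"
abbreviation (input) "vMK \<equiv> 22 :: nat"
abbreviation (input) "vC \<equiv> 23 :: nat"
abbreviation (input) "sZ \<equiv> 24 :: nat"
abbreviation (input) "sW \<equiv> 25 :: nat"
abbreviation (input) "sV \<equiv> 26 :: nat"
abbreviation (input) "vRej \<equiv> 27 :: nat"
abbreviation (input) "vAny \<equiv> 28 :: nat"
abbreviation (input) "vM \<equiv> 29 :: nat"
abbreviation (input) "vT \<equiv> 30 :: nat"
abbreviation (input) "vB \<equiv> 38 :: nat"

definition notE :: "expr \<Rightarrow> expr" where "notE x = Equal x (Const 0)"
definition andE :: "expr \<Rightarrow> expr \<Rightarrow> expr" where "andE x y = notE (Add (notE x) (notE y))"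
definition xorE :: "expr \<Rightarrow> expr \<Rightarrow> expr" where "xorE x y = notE (Equal x y)"

text \<open>The machine lacks multiplication, so a constant multiple is unrolled into a sum inside
  one expression, whose size depends on the program only.\<close>

primrec times :: "nat \<Rightarrow> expr \<Rightarrow> expr" where
  "times 0 e = Const 0"
| "times (Suc c) e = Add e (times c e)"

lemma eval_notE [simp]: "eval_expr (notE x) m = of_bool (eval_expr x m = 0)"
  by (simp add: notE_def)

lemma eval_andE [simp]: "eval_expr (andE x y) m = of_bool (eval_expr x m \<noteq> 0 \<and> eval_expr y m \<noteq> 0)"
  by (simp add: andE_def)

lemma eval_xorE [simp]: "eval_expr (xorE x y) m = of_bool (eval_expr x m \<noteq> eval_expr y m)"
  by (simp add: xorE_def)

lemma eval_times [simp]: "eval_expr (times c e) m = c * eval_expr e m"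
  by (induction c) simp_all

section \<open>Oracle calls at sets of flipped variables\<close>

definition query_set :: "nat \<Rightarrow> expr \<Rightarrow> com" where
  "query_set d e = Seq (For ci (rd 0) (Store vP (rd ci) (xorE (Read vA (rd ci)) e))) (Query d (Const 0) vP)"

primrec query_sets :: "(nat \<times> expr) list \<Rightarrow> com" where
  "query_sets [] = Skip"
| "query_sets (q # qs) = Seq (query_set (fst q) (snd q)) (query_sets qs)"

definition random_set :: "nat \<Rightarrow> com" where
  "random_set b = For ci (rd 0) (Flip b (rd ci))"

lemma mods_query_set [simp]: "mods (query_set d e) = {ci, vP, d}"
  by (auto simp: query_set_def)

lemma mods_query_sets [simp]: "mods (query_sets qs) = (if qs = [] then {} else {ci, vP}) \<union> fst ` set qs"
  by (induction qs) auto

lemma mods_random_set [simp]: "mods (random_set b) = {ci, b}"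
  by (auto simp: random_set_def)

context testing
begin

definition env :: "bool list \<Rightarrow> memory \<Rightarrow> bool" where
  "env a m \<longleftrightarrow> m 0 0 = n \<and> length a = n \<and> (\<forall>i<n. m vA i = of_bool (a ! i))"

lemma env_cong: "m' 0 = m 0 \<Longrightarrow> m' vA = m vA \<Longrightarrow> env a m' \<longleftrightarrow> env a m"
  by (simp add: env_def)

text \<open>The expression is evaluated inside the loop that assembles a query point, with the
  current variable in \<open>ci\<close>. Its value therefore has to survive changes of
  \<open>ci\<close>, of \<open>vP\<close> and of the arrays in \<open>X\<close>, which receive the
  answers of other queries.\<close>

definition denotes :: "memory \<Rightarrow> nat set \<Rightarrow> expr \<Rightarrow> nat set \<Rightarrow> bool" where
  "denotes m X e Z \<longleftrightarrow> (\<forall>m' i. i < n \<longrightarrow> m' ci 0 = i \<longrightarrow> (eq_off (insert ci (insert vP X)) m' m) \<longrightarrow>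
     eval_expr e m' = of_bool (i \<in> Z))"

lemma sim_query_set:
  assumes env: "env a m" and e: "denotes m {} e Z"
  shows "sim (query_set d e) m (return_pmf ()) (\<lambda>m' _. m' d 0 = of_bool (f (flip a Z)))
    (4 * n + 3) 1"
  unfolding query_set_def
proof (rule sim_conseq[OF sim_Seq_det])
  let ?I = "\<lambda>j m'. \<forall>i<j. m' vP i = of_bool ((a ! i) \<noteq> (i \<in> Z))"
  show "sim (For ci (rd 0) (Store vP (rd ci) (xorE (Read vA (rd ci)) e))) m (return_pmf ())
      (\<lambda>m' _. ?I n m') (2 + n * (1 + 2)) (n * 0)"
  proof (rule sim_For_det)
    fix m' :: memory and j
    assume "eq_off (insert ci (mods (Store vP (rd ci) (xorE (Read vA (rd ci)) e)))) m' m"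
    then show "eval_expr (rd 0) m' = n"
      using env by (simp add: env_def)
  next
    show "?I 0 (write_entry ci 0 0 m)" by simp
  next
    fix m' :: memory and j
    assume I: "?I j m'" and j: "j < n" "m' ci 0 = j"
      and fr: "eq_off (insert ci (mods (Store vP (rd ci) (xorE (Read vA (rd ci)) e)))) m' m"
    have "eval_expr e m' = of_bool (j \<in> Z)"
      using e j fr unfolding denotes_def by simp
    moreover have "m' vA j = of_bool (a ! j)"
      using env j fr by (simp add: env_def)
    ultimately show "sim (Store vP (rd ci) (xorE (Read vA (rd ci)) e)) m' (return_pmf ())
        (\<lambda>m'' _. ?I (Suc j) (write_entry ci 0 (Suc j) m'') \<and> m'' ci 0 = j) 1 0"
      using I j by (intro sim_Store) (auto simp: write_entry_def less_Suc_eq)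
  qed
next
  fix m' :: memory
  assume I: "\<forall>i<n. m' vP i = of_bool ((a ! i) \<noteq> (i \<in> Z))"
  then have "read_point n vP m' = flip a Z"
    by (auto simp: read_point_def flip_def)
  then show "sim (Query d (Const 0) vP) m' (return_pmf ()) (\<lambda>m' _. m' d 0 = of_bool (f (flip a Z))) (n + 1) 1"
    by (intro sim_Query) (simp add: write_entry_def)
qed auto

text \<open>With all answer arrays in the place of \<open>X\<close>, an expression that is evaluated
  late still denotes its set after the earlier answers have been written.\<close>

lemma sim_query_sets:
  assumes env: "env a m" and X: "distinct (map fst qs)" "fst ` set qs \<inter> {0, vA, ci, vP} = {}"
    and qs: "\<And>d e. (d, e) \<in> set qs \<Longrightarrow> denotes m (fst ` set qs) e (Z d)"
  shows "sim (query_sets qs) m (return_pmf ()) (\<lambda>m' _. \<forall>d \<in> fst ` set qs. m' d 0 = of_bool (f (flip a (Z d))))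
    (1 + length qs * (4 * n + 3)) (length qs)"
  using assms
proof (induction qs arbitrary: m)
  case Nil
  show ?case by (auto intro!: sim_conseq[OF sim_Skip[of "\<lambda>_ _. True"]])
next
  case (Cons q qs)
  obtain d e where q: "q = (d, e)"
    by (cases q)
  have "denotes m {} e (Z d)"
    using Cons.prems(4)[of d e] unfolding q denotes_def by simp
  note 1 = sim_query_set[OF Cons.prems(1) this, of d]
  show ?case
    unfolding query_sets.simps q fst_conv snd_conv
  proof (rule sim_conseq[OF sim_Seq_det[OF 1]])
    fix m' :: memory
    assume d: "m' d 0 = of_bool (f (flip a (Z d)))"
      and fr: "eq_off (mods (query_set d e)) m' m"
    have "env a m'"
      using Cons.prems(1,3) fr by (subst env_cong[of m' m]) (auto simp: q)
    moreover have "denotes m' (fst ` set qs) e' (Z d')" if "(d', e') \<in> set qs" for d' e'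
      using Cons.prems(4)[of d' e'] that fr unfolding denotes_def q by auto
    ultimately have "sim (query_sets qs) m' (return_pmf ())
        (\<lambda>m' _. \<forall>d \<in> fst ` set qs. m' d 0 = of_bool (f (flip a (Z d)))) (1 + length qs * (4 * n + 3)) (length qs)"
      using Cons.prems(2,3) by (intro Cons.IH) auto
    then show "sim (query_sets qs) m' (return_pmf ())
        (\<lambda>m' _. \<forall>d' \<in> insert d (fst ` set qs). m' d' 0 = of_bool (f (flip a (Z d')))) (1 + length qs * (4 * n + 3)) (length qs)"
    proof (rule sim_conseq)
      fix m'' assume *: "\<forall>d \<in> fst ` set qs. m'' d 0 = of_bool (f (flip a (Z d)))"
        and fr': "eq_off (mods (query_sets qs)) m'' m'"
      have "m'' d = m' d"
        using Cons.prems(2,3) by (intro fr'[rule_format]) (auto simp: q)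
      with * d show "\<forall>d' \<in> insert d (fst ` set qs). m'' d' 0 = of_bool (f (flip a (Z d')))"
        by simp
    qed auto
  qed auto
qed

lemma sim_random_set:
  assumes "m 0 0 = n" "b \<noteq> 0" "b \<noteq> ci"
  shows "sim (random_set b) m (usets n) (\<lambda>m' Z. Z \<subseteq> {..<n} \<and> (\<forall>i<n. m' b i = of_bool (i \<in> Z))) (2 + n * 3) 0"
proof -
  let ?I = "\<lambda>j m' Z. Z \<subseteq> {..<j} \<and> (\<forall>i<j. m' b i = of_bool (i \<in> Z))"
  let ?B = "\<lambda>j Z. map_pmf (\<lambda>b. if b then insert j Z else Z) (bernoulli_pmf (1 / 2))"
  have "sim (random_set b) m (for_pmf ?B n 0 {}) (?I n) (2 + n * (1 + 2)) (n * 0)"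
    unfolding random_set_def
  proof (rule sim_For)
    fix m' :: memory and j Z
    assume "eq_off (insert ci (mods (Flip b (rd ci)))) m' m"
    then show "eval_expr (rd 0) m' = n"
      using assms by simp
  next
    fix m' :: memory and j Z
    assume I: "?I j m' Z" and j: "j < n" "m' ci 0 = j"
    have "sim (Flip b (rd ci)) m' (bernoulli_pmf (1 / 2))
        (\<lambda>m'' c. ?I (Suc j) (write_entry ci 0 (Suc j) m'') (if c then insert j Z else Z) \<and> m'' ci 0 = j) 1 0"
      using I j assms by (intro sim_Flip) (auto simp: write_entry_def less_Suc_eq)
    then show "sim (Flip b (rd ci)) m' (?B j Z)
        (\<lambda>m'' a'. ?I (Suc j) (write_entry ci 0 (Suc j) m'') a' \<and> m'' ci 0 = j) 1 0"
      by (rule sim_map)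
  qed auto
  then show ?thesis
    unfolding usets_for by (rule sim_conseq) auto
qed

end

section \<open>The program for the trials\<close>

definition memE :: "nat \<Rightarrow> expr" where "memE s = Read s (rd ci)"
definition diffE :: expr where "diffE = xorE (Read vY (rd ci)) (Read vA (rd ci))"
definition colourE :: expr where "colourE = Read vMK (Read vBL (rd ci))"
definition in_colourE :: "expr \<Rightarrow> expr" where "in_colourE e = andE e (Equal colourE (Add (rd cc) (Const 1)))"

definition colour_queries :: "(nat \<times> expr) list" where
  "colour_queries =
    [(31, in_colourE (memE sZ)), (32, in_colourE (memE sW)), (33, in_colourE (memE sV)),
     (34, in_colourE (xorE (memE sZ) (memE sW))),
     (35, in_colourE (xorE (andE (memE sZ) (memE sW)) (memE sV))),
     (36, in_colourE diffE), (37, in_colourE (xorE diffE (memE sW)))]"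

text \<open>The arrays hold values of \<open>f\<close>, the negations of \<open>neg\<close>. So a
  sum of two answers is 0 exactly if both sets are negative, and additivity becomes an equality of
  three bits in place of an inequality.\<close>

definition agreeE :: expr where
  "agreeE = andE (Equal (rd 34) (Equal (rd 31) (rd 32)))
     (andE (Equal (xorE (rd 35) (rd 33)) (notE (Add (rd 31) (rd 32))))
       (Equal (xorE (rd 37) (rd 32)) (notE (rd 36))))"

definition colour_test :: com where
  "colour_test = Seq (query_sets colour_queries)
     (Seq (Cond agreeE Skip (setv vRej (Const 1))) (Cond (rd 36) Skip (setv vAny (Const 1))))"

text \<open>\<open>vQ\<close> is the value of \<open>f\<close> at the sample whereas
  \<open>vAny\<close> tells whether some colour is negative there, so it is agreement of the two
  bits that leads to rejection.\<close>

definition trial_tests :: com where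
  "trial_tests = Seq (Query vQ (Const 0) vY) (Seq (setv vAny (Const 0))
     (Seq (For cc (rd vC) colour_test) (Cond (Equal (rd vQ) (rd vAny)) (setv vRej (Const 1)) Skip)))"

definition trial_com :: com where
  "trial_com = Seq (random_set sZ) (Seq (random_set sW) (Seq (random_set sV) (Seq (Sample vY) trial_tests)))"

definition trials_com :: com where
  "trials_com = Seq (setv vRej (Const 0)) (For cr (times 100 (rd vE)) trial_com)"

lemma mods_colour_test [simp]:
  "mods colour_test = {ci, vP, 31, 32, 33, 34, 35, 36, 37, vRej, vAny}"
  by (auto simp: colour_test_def colour_queries_def)

lemma mods_trial_tests [simp]:
  "mods trial_tests = {ci, vP, 31, 32, 33, 34, 35, 36, 37, vRej, vAny, vQ, cc}"
  by (auto simp: trial_tests_def)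

lemma mods_trial_com [simp]:
  "mods trial_com = {ci, vP, 31, 32, 33, 34, 35, 36, 37, vRej, vAny, vQ, cc, sZ, sW, sV, vY}"
  by (auto simp: trial_com_def)

context testing
begin

definition agree ::
  "bool list \<Rightarrow> (nat \<Rightarrow> nat) \<Rightarrow> nat set \<Rightarrow> nat set \<Rightarrow> nat set \<Rightarrow> nat set \<Rightarrow> nat \<Rightarrow> bool" where
  "agree a col Z W V Y c \<longleftrightarrow> (let F = \<lambda>X. neg a (X \<inter> {i. col i = c}) in
     (F (Z \<oplus> W) \<longleftrightarrow> F Z \<noteq> F W) \<and>
     ((F ((Z \<inter> W) \<oplus> V) \<noteq> F V) \<longleftrightarrow> F Z \<and> F W) \<and>
     ((F (Y \<oplus> W) \<noteq> F W) \<longleftrightarrow> F Y))"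

text \<open>Equations between sets of colours are split into equations for the single colours; the
  program can then go through the colours with two flags and need not store the sets.\<close>

lemma consistent_iff:
  "consistent a col cnt Z W V y \<longleftrightarrow>
    (\<forall>c \<in> {1..cnt}. agree a col Z W V (diff a y) c) \<and>
    (neg a (diff a y) \<longleftrightarrow> (\<exists>c \<in> {1..cnt}. neg a (diff a y \<inter> {i. col i = c})))"
proof -
  define F where "F = (\<lambda>X c. neg a (X \<inter> {i. col i = c}))"
  define A where "A = {1..cnt}"
  have col: "colours a col cnt X = {c \<in> A. F X c}" for X
    by (simp add: colours_def F_def A_def)
  have sd: "{c \<in> A. P c} \<oplus> {c \<in> A. Q c} = {c \<in> A. P c \<noteq> Q c}" for P Q
    by auto
  have int: "{c \<in> A. P c} \<inter> {c \<in> A. Q c} = {c \<in> A. P c \<and> Q c}" for P Q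
    by auto
  have eq: "{c \<in> A. P c} = {c \<in> A. Q c} \<longleftrightarrow> (\<forall>c \<in> A. P c = Q c)" for P Q
    by blast
  have ne: "{c \<in> A. P c} \<noteq> {} \<longleftrightarrow> (\<exists>c \<in> A. P c)" for P
    by blast
  have ag: "agree a col Z W V (diff a y) c \<longleftrightarrow> (F (Z \<oplus> W) c \<longleftrightarrow> F Z c \<noteq> F W c) \<and>
     ((F ((Z \<inter> W) \<oplus> V) c \<noteq> F V c) \<longleftrightarrow> F Z c \<and> F W c) \<and>
     ((F (diff a y \<oplus> W) c \<noteq> F W c) \<longleftrightarrow> F (diff a y) c)" for c
    by (simp add: agree_def F_def)
  show ?thesis
    unfolding A_def[symmetric] ag consistent_def Let_def col sd int eq ne ball_conj_distrib
    by (simp add: F_def)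
qed

definition colour_env :: "bool list \<Rightarrow> (nat \<Rightarrow> nat) \<Rightarrow> memory \<Rightarrow> bool" where
  "colour_env a col m \<longleftrightarrow> env a m \<and> (\<forall>i<n. m vMK (m vBL i) = col i)"

definition trial_env ::
  "bool list \<Rightarrow> (nat \<Rightarrow> nat) \<Rightarrow> nat set \<Rightarrow> nat set \<Rightarrow> nat set \<Rightarrow> bool list \<Rightarrow> memory \<Rightarrow> bool" where
  "trial_env a col Z W V y m \<longleftrightarrow> colour_env a col m \<and> (\<forall>i<n. m sZ i = of_bool (i \<in> Z)) \<and>
     (\<forall>i<n. m sW i = of_bool (i \<in> W)) \<and> (\<forall>i<n. m sV i = of_bool (i \<in> V)) \<and>
     length y = n \<and> (\<forall>i<n. m vY i = of_bool (y ! i))"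

lemma colour_env_cong:
  "m' 0 = m 0 \<Longrightarrow> m' vA = m vA \<Longrightarrow> m' vMK = m vMK \<Longrightarrow> m' vBL = m vBL \<Longrightarrow>
   colour_env a col m' \<longleftrightarrow> colour_env a col m"
  by (simp add: colour_env_def env_def)

lemma trial_env_cong:
  "m' 0 = m 0 \<Longrightarrow> m' vA = m vA \<Longrightarrow> m' vMK = m vMK \<Longrightarrow> m' vBL = m vBL \<Longrightarrow>
   m' sZ = m sZ \<Longrightarrow> m' sW = m sW \<Longrightarrow> m' sV = m sV \<Longrightarrow> m' vY = m vY \<Longrightarrow>
   trial_env a col Z W V y m' \<longleftrightarrow> trial_env a col Z W V y m"
  by (simp add: trial_env_def colour_env_def env_def)

lemma sim_colour_test:
  assumes m: "trial_env a col Z W V y m" and c: "m cc 0 = j"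
  defines "Y \<equiv> diff a y"
  shows "sim colour_test m (return_pmf ())
    (\<lambda>m' _. m' vRej 0 = (if agree a col Z W V Y (Suc j) then m vRej 0 else 1) \<and>
       m' vAny 0 = (if neg a (Y \<inter> {i. col i = Suc j}) then 1 else m vAny 0))
    (28 * n + 26) 7"
proof -
  define C where "C = {i. col i = Suc j}"
  \<comment> \<open>Assigns to each answer array the set at which it is queried, cut down to the
    current colour class.\<close>
  define S :: "nat \<Rightarrow> nat set" where "S = (\<lambda>_. {})(31 := Z \<inter> C, 32 := W \<inter> C, 33 := V \<inter> C,
    34 := (Z \<oplus> W) \<inter> C, 35 := ((Z \<inter> W) \<oplus> V) \<inter> C, 36 := Y \<inter> C, 37 := (Y \<oplus> W) \<inter> C)"
  have env: "env a m"
    using m by (simp add: trial_env_def colour_env_def)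
  let ?X = "fst ` set colour_queries"
  have X: "?X = {31, 32, 33, 34, 35, 36, 37}"
    by (simp add: colour_queries_def)
  have den: "denotes m ?X e (S d)" if "(d, e) \<in> set colour_queries" for d e
    unfolding denotes_def
  proof (intro allI impI)
    fix m' :: memory and i
    assume i: "i < n" "m' ci 0 = i" and "eq_off (insert ci (insert vP ?X)) m' m"
    then have fr: "m' x = m x" if "x \<notin> {ci, vP, 31, 32, 33, 34, 35, 36, 37}" for x
      using that X by simp
    have mem: "m' sZ i = of_bool (i \<in> Z)" "m' sW i = of_bool (i \<in> W)" "m' sV i = of_bool (i \<in> V)"
      "m' vY i = of_bool (y ! i)" "m' vA i = of_bool (a ! i)" "m' vMK (m' vBL i) = col i" "m' cc 0 = j"
      using m c i(1) by (simp_all add: fr trial_env_def colour_env_def env_def)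
    have vals: "eval_expr (memE sZ) m' = of_bool (i \<in> Z)" "eval_expr (memE sW) m' = of_bool (i \<in> W)"
      "eval_expr (memE sV) m' = of_bool (i \<in> V)" "eval_expr diffE m' = of_bool (i \<in> Y)"
      using i(1) by (simp_all add: memE_def diffE_def i(2) mem Y_def diff_def)
    have inC: "eval_expr (in_colourE e) m' = of_bool (eval_expr e m' \<noteq> 0 \<and> i \<in> C)" for e
      by (simp add: in_colourE_def colourE_def i(2) mem C_def)
    show "eval_expr e m' = of_bool (i \<in> S d)"
      using that unfolding colour_queries_def set_simps insert_iff prod.inject
      by (elim disjE conjE emptyE) (simp_all add: inC vals S_def)
  qed
  have 1: "sim (query_sets colour_queries) m (return_pmf ())
      (\<lambda>m' _. \<forall>d \<in> ?X. m' d 0 = of_bool (f (flip a (S d)))) (1 + length colour_queries * (4 * n + 3))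
      (length colour_queries)"
    by (rule sim_query_sets[OF env _ _ den]) (simp_all add: colour_queries_def)
  have 2: "sim (Seq (Cond agreeE Skip (setv vRej (Const 1))) (Cond (rd 36) Skip (setv vAny (Const 1)))) m'
      (return_pmf ()) (\<lambda>m' _. m' vRej 0 = (if agree a col Z W V Y (Suc j) then m vRej 0 else 1) \<and>
       m' vAny 0 = (if neg a (Y \<inter> C) then 1 else m vAny 0)) (1 + 1 + (1 + 1)) (0 + 0)"
    if q: "\<forall>d \<in> ?X. m' d 0 = of_bool (f (flip a (S d)))"
      and fr: "eq_off (mods (query_sets colour_queries)) m' m" for m'
  proof -
    have q: "m' 31 0 = of_bool (\<not> neg a (Z \<inter> C))" "m' 32 0 = of_bool (\<not> neg a (W \<inter> C))"
      "m' 33 0 = of_bool (\<not> neg a (V \<inter> C))" "m' 34 0 = of_bool (\<not> neg a ((Z \<oplus> W) \<inter> C))"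
      "m' 35 0 = of_bool (\<not> neg a (((Z \<inter> W) \<oplus> V) \<inter> C))" "m' 36 0 = of_bool (\<not> neg a (Y \<inter> C))"
      "m' 37 0 = of_bool (\<not> neg a ((Y \<oplus> W) \<inter> C))"
      using q unfolding X by (simp_all add: S_def neg_def)
    have old: "m' vRej = m vRej" "m' vAny = m vAny"
      by (simp_all add: fr colour_queries_def)
    have ag: "eval_expr agreeE m' \<noteq> 0 \<longleftrightarrow> agree a col Z W V Y (Suc j)"
      unfolding agreeE_def agree_def Let_def C_def[symmetric] by (simp add: q)
    show ?thesis
    proof (rule sim_Seq_det[where ?Q1.0 = "\<lambda>m'' _. m'' vRej 0 = (if agree a col Z W V Y (Suc j) then m vRej 0 else 1)"])
      show "sim (Cond agreeE Skip (setv vRej (Const 1))) m' (return_pmf ())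
          (\<lambda>m'' _. m'' vRej 0 = (if agree a col Z W V Y (Suc j) then m vRej 0 else 1)) (1 + 1) 0"
        using ag by (intro sim_Cond sim_Skip sim_Store) (auto simp: write_entry_def old)
      fix m'' :: memory
      assume r: "m'' vRej 0 = (if agree a col Z W V Y (Suc j) then m vRej 0 else 1)"
        and fr': "eq_off (mods (Cond agreeE Skip (setv vRej (Const 1)))) m'' m'"
      have "m'' 36 = m' 36" "m'' vAny = m vAny"
        using fr' old by simp_all
      then show "sim (Cond (rd 36) Skip (setv vAny (Const 1))) m'' (return_pmf ())
          (\<lambda>m' _. m' vRej 0 = (if agree a col Z W V Y (Suc j) then m vRej 0 else 1) \<and>
            m' vAny 0 = (if neg a (Y \<inter> C) then 1 else m vAny 0)) (1 + 1) 0"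
        using r by (intro sim_Cond sim_Skip sim_Store) (auto simp: write_entry_def q)
    qed
  qed
  show ?thesis
    unfolding colour_test_def C_def[symmetric]
    by (rule sim_conseq[OF sim_Seq_det[OF 1 2]]) (auto simp: colour_queries_def)
qed

lemma sim_trial_tests:
  assumes m: "trial_env a col Z W V y m" and C: "m vC 0 = cnt" and rej: "m vRej 0 = of_bool rej"
  shows "sim trial_tests m (return_pmf (rej \<or> \<not> consistent a col cnt Z W V y))
    (\<lambda>m' r. m' vRej 0 = of_bool r) (n + 6 + cnt * (28 * n + 28)) (1 + cnt * 7)"
proof -
  let ?r = "return_pmf (rej \<or> \<not> consistent a col cnt Z W V y)"
  let ?post = "\<lambda>m' r. m' vRej 0 = of_bool r"
  let ?end = "Cond (Equal (rd vQ) (rd vAny)) (setv vRej (Const 1)) Skip"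
  let ?Y = "diff a y"
  let ?q = "of_bool (\<not> neg a ?Y) :: nat"
  have len: "length y = n"
    using m by (simp add: trial_env_def)
  have pt: "read_point n vY m = y"
    using m by (auto simp: trial_env_def read_point_def intro!: nth_equalityI)
  define I where "I = (\<lambda>j (m' :: memory).
    m' vRej 0 = of_bool (rej \<or> (\<exists>c \<in> {1..j}. \<not> agree a col Z W V ?Y c)) \<and>
    m' vAny 0 = of_bool (\<exists>c \<in> {1..j}. neg a (?Y \<inter> {i. col i = c})))"
  have loop: "sim (For cc (rd vC) colour_test) m' (return_pmf ()) (\<lambda>m' _. I cnt m')
      (2 + cnt * (28 * n + 26 + 2)) (cnt * 7)"
    if m': "trial_env a col Z W V y m'" "m' vC 0 = cnt" "I 0 m'" for m'
  proof (rule sim_For_det)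
    fix m'' :: memory and j
    assume fr: "eq_off (insert cc (mods colour_test)) m'' m'"
    show "eval_expr (rd vC) m'' = cnt"
      using fr m' by simp
  next
    show "I 0 (write_entry cc 0 0 m')"
      using m'(3) by (simp add: I_def write_entry_def)
  next
    fix m'' :: memory and j
    assume I: "I j m''" and j: "j < cnt" "m'' cc 0 = j"
      and fr: "eq_off (insert cc (mods colour_test)) m'' m'"
    have "trial_env a col Z W V y m''"
      using m'(1) by (subst trial_env_cong[of m'' m']) (simp_all add: fr)
    from sim_colour_test[OF this j(2)]
    show "sim colour_test m'' (return_pmf ()) (\<lambda>m3 _. I (Suc j) (write_entry cc 0 (Suc j) m3) \<and> m3 cc 0 = j)
        (28 * n + 26) 7"
    proof (rule sim_conseq)
      fix m3 :: memory
      assume *: "m3 vRej 0 = (if agree a col Z W V ?Y (Suc j) then m'' vRej 0 else 1) \<and>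
          m3 vAny 0 = (if neg a (?Y \<inter> {i. col i = Suc j}) then 1 else m'' vAny 0)"
        and fr': "eq_off (mods colour_test) m3 m''"
      have e: "{1..Suc j} = insert (Suc j) {1..j}"
        by auto
      have "m3 cc = m'' cc"
        by (simp add: fr')
      then show "I (Suc j) (write_entry cc 0 (Suc j) m3) \<and> m3 cc 0 = j"
        using * I j(2) unfolding I_def e by (simp add: write_entry_def)
    qed auto
  qed
  have post: "sim ?end m'
      ?r ?post (1 + 1) 0"
    if "I cnt m'" "m' vQ 0 = ?q" for m'
  proof -
    define ag where "ag \<longleftrightarrow> (\<forall>c \<in> {1..cnt}. agree a col Z W V ?Y c)"
    define N where "N \<longleftrightarrow> neg a ?Y"
    define X where "X \<longleftrightarrow> (\<exists>c \<in> {1..cnt}. neg a (?Y \<inter> {i. col i = c}))"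
    have c: "consistent a col cnt Z W V y \<longleftrightarrow> ag \<and> (N \<longleftrightarrow> X)"
      by (simp add: consistent_iff ag_def N_def X_def)
    have q: "m' vQ 0 = of_bool (\<not> N)" "m' vAny 0 = of_bool X" "m' vRej 0 = of_bool (rej \<or> \<not> ag)"
      using that by (simp_all add: I_def N_def X_def ag_def)
    show ?thesis
      unfolding c
      by (intro sim_Cond sim_Skip sim_Store; cases N; cases X) (simp_all add: q write_entry_def)
  qed
  have 3: "sim (Seq (For cc (rd vC) colour_test) ?end) m'
      ?r ?post
      (2 + cnt * (28 * n + 26 + 2) + (1 + 1)) (cnt * 7 + 0)"
    if m': "trial_env a col Z W V y m'" "m' vC 0 = cnt" "I 0 m'" "m' vQ 0 = ?q" for m'
  proof (rule sim_Seq_det[OF loop[OF m'(1-3)]])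
    fix m'' :: memory
    assume "I cnt m''" and fr: "eq_off (mods (For cc (rd vC) colour_test)) m'' m'"
    then show "sim ?end m''
        ?r ?post (1 + 1) 0"
      using m'(4) fr by (intro post) simp_all
  qed
  show ?thesis
    unfolding trial_tests_def
  proof (rule sim_conseq[OF sim_Seq_det[OF sim_Query[where x = "()" and Q = "\<lambda>m' _. m' vQ 0 = ?q"]
          sim_Seq_det[OF sim_Store[where x = "()" and Q = "\<lambda>m' _. m' vAny 0 = 0"] 3]]])
    show "write_entry vQ (eval_expr (Const 0) m) (of_bool (f (read_point n vY m))) m vQ 0 = ?q"
      using len by (simp add: write_entry_def pt neg_def flip_diff)
  next
    fix m' :: memory
    show "write_entry vAny (eval_expr (Const 0) m') (eval_expr (Const 0) m') m' vAny 0 = 0"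
      by (simp add: write_entry_def)
  next
    fix m' m'' :: memory
    assume q: "m' vQ 0 = ?q" and any: "m'' vAny 0 = 0"
      and fr1: "eq_off (mods (Query vQ (Const 0) vY)) m' m"
      and fr2: "eq_off (mods (setv vAny (Const 0))) m'' m'"
    then have fr: "m'' x = m x" if "x \<notin> {vQ, vAny}" for x
      using that by simp
    show "trial_env a col Z W V y m''"
      using m by (subst trial_env_cong[of m'' m]) (simp_all add: fr)
    show "m'' vC 0 = cnt" "m'' vQ 0 = ?q" "I 0 m''"
      using C q rej any fr2 by (simp_all add: fr I_def)
  qed (simp_all add: algebra_simps)
qed

lemma trial_bind:
  "trial a col cnt rej = bind_pmf (usets n) (\<lambda>Z. bind_pmf (usets n) (\<lambda>W. bind_pmf (usets n) (\<lambda>V.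
     map_pmf (\<lambda>y. rej \<or> \<not> consistent a col cnt Z W V y) D)))"
  unfolding trial_def quad_def pair_pmf_def
  by (simp add: map_bind_pmf map_pmf_def bind_assoc_pmf bind_return_pmf)

lemma sim_trial:
  assumes D: "set_pmf D \<subseteq> cube n"
    and m: "colour_env a col m" and C: "m vC 0 = cnt" and rej: "m vRej 0 = of_bool rej"
  shows "sim trial_com m (trial a col cnt rej) (\<lambda>m' r. m' vRej 0 = of_bool r)
    (11 * n + 13 + cnt * (28 * n + 28)) (2 + cnt * 7)"
proof -
  let ?h = "\<lambda>Z W V y. rej \<or> \<not> consistent a col cnt Z W V y"
  let ?T = "(n + 1) + (n + 6 + cnt * (28 * n + 28))"
  let ?R = "2 + n * 3"
  let ?N = "1 + (1 + cnt * 7)"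
  have n: "m 0 0 = n"
    using m by (simp add: colour_env_def env_def)
  let ?P = "\<lambda>Z m'. Z \<subseteq> {..<n} \<and> (\<forall>i<n. m' sZ i = of_bool (i \<in> Z))"
  let ?post = "\<lambda>m' r. m' vRej 0 = of_bool r"
  have 4: "sim (Seq (Sample vY) trial_tests) m' (map_pmf (?h Z W V) D) ?post
      ?T ?N"
    if fr: "eq_off {ci, sZ, sW, sV} m' m"
      and sets: "\<forall>i<n. m' sZ i = of_bool (i \<in> Z)" "\<forall>i<n. m' sW i = of_bool (i \<in> W)" "\<forall>i<n. m' sV i = of_bool (i \<in> V)"
    for m' Z W V
  proof (rule sim_Seq_post[OF sim_Sample[where Q = "\<lambda>m'' y. length y = n \<and> (\<forall>i<n. m'' vY i = of_bool (y ! i))"]])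
    fix x assume "x \<in> set_pmf D"
    then show "length x = n \<and> (\<forall>i<n. write_point n vY x m' vY i = of_bool (x ! i))"
      using D by (auto simp: cube_def write_point_def)
  next
    fix m'' :: memory and y
    assume y: "length y = n \<and> (\<forall>i<n. m'' vY i = of_bool (y ! i))"
      and fr': "eq_off (mods (Sample vY)) m'' m'"
    have fr2: "m'' x = m x" if "x \<notin> {ci, sZ, sW, sV, vY}" for x
      using that fr fr' by simp
    have "colour_env a col m''"
      using m by (subst colour_env_cong[of m'' m]) (simp_all add: fr2)
    then have "trial_env a col Z W V y m''"
      using y sets by (simp add: trial_env_def fr')
    then show "sim trial_tests m'' (return_pmf (?h Z W V y)) ?post
        (n + 6 + cnt * (28 * n + 28)) (1 + cnt * 7)"
      by (rule sim_trial_tests) (simp_all add: fr2 C rej)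
  qed
  have "sim trial_com m (trial a col cnt rej) ?post
      (?R + (?R + (?R + ?T)))
      (0 + (0 + (0 + ?N)))"
    unfolding trial_com_def trial_bind
  proof (rule sim_Seq[OF sim_random_set[where m = m and b = sZ, OF n]], simp_all only: mods_random_set)
    fix m1 Z
    assume Z: "Z \<subseteq> {..<n} \<and> (\<forall>i<n. m1 sZ i = of_bool (i \<in> Z))" and fr1: "eq_off {ci, sZ} m1 m"
    then have "m1 0 0 = n" using n by simp
    show "sim (Seq (random_set sW) (Seq (random_set sV) (Seq (Sample vY) trial_tests))) m1
        (bind_pmf (usets n) (\<lambda>W. bind_pmf (usets n) (\<lambda>V.
          map_pmf (?h Z W V) D))) ?post
        (?R + (?R + ?T))
        (0 + (0 + ?N))"
    proof (rule sim_Seq[OF sim_random_set[where m = m1 and b = sW, OF \<open>m1 0 0 = n\<close>]], simp_all only: mods_random_set)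
      fix m2 W
      assume W: "W \<subseteq> {..<n} \<and> (\<forall>i<n. m2 sW i = of_bool (i \<in> W))" and fr2: "eq_off {ci, sW} m2 m1"
      then have "m2 0 0 = n" using \<open>m1 0 0 = n\<close> by simp
      show "sim (Seq (random_set sV) (Seq (Sample vY) trial_tests)) m2
          (bind_pmf (usets n) (\<lambda>V. map_pmf (?h Z W V) D)) ?post
          (?R + ?T) (0 + ?N)"
      proof (rule sim_Seq[OF sim_random_set[where m = m2 and b = sV, OF \<open>m2 0 0 = n\<close>]], simp_all only: mods_random_set)
        fix m3 V
        assume V: "V \<subseteq> {..<n} \<and> (\<forall>i<n. m3 sV i = of_bool (i \<in> V))" and fr3: "eq_off {ci, sV} m3 m2"
        show "sim (Seq (Sample vY) trial_tests) m3 (map_pmf (?h Z W V) D) ?post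
            ?T ?N"
          using Z W V by (intro 4) (simp_all add: fr3 fr2 fr1)
      qed
    qed
  qed
  then show ?thesis
    by (rule sim_conseq) auto
qed

lemma sim_trials:
  assumes D: "set_pmf D \<subseteq> cube n"
    and m: "colour_env a col m" and C: "m vC 0 = cnt" and E: "m vE 0 = E"
  shows "sim trials_com m (trials a col cnt (100 * E)) (\<lambda>m' r. m' vRej 0 = of_bool r)
    (3 + 100 * E * (11 * n + 15 + cnt * (28 * n + 28))) (100 * E * (2 + cnt * 7))"
proof -
  have loop: "sim (For cr (times 100 (rd vE)) trial_com) m' (trials a col cnt (100 * E)) (\<lambda>m' r. m' vRej 0 = of_bool r)
      (2 + 100 * E * (11 * n + 13 + cnt * (28 * n + 28) + 2)) (100 * E * (2 + cnt * 7))"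
    if fr: "eq_off {vRej} m' m" and rej: "m' vRej 0 = 0" for m'
    unfolding trials_def
  proof (rule sim_For)
    fix m'' :: memory
    assume fr': "eq_off (insert cr (mods trial_com)) m'' m'"
    show "eval_expr (times 100 (rd vE)) m'' = 100 * E"
      using E by (simp add: fr fr')
  next
    show "write_entry cr 0 0 m' vRej 0 = of_bool False"
      using rej by (simp add: write_entry_def)
  next
    fix m'' :: memory and j r
    assume r: "m'' vRej 0 = of_bool r" and j: "m'' cr 0 = j"
      and fr': "eq_off (insert cr (mods trial_com)) m'' m'"
    have fr2: "m'' x = m x" if "x \<notin> insert cr (insert vRej (mods trial_com))" for x
      using that fr fr' by simp
    have "colour_env a col m''"
      using m by (subst colour_env_cong[of m'' m]) (simp_all add: fr2)
    from sim_trial[OF D this _ r, of cnt]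
    show "sim trial_com m'' (trial a col cnt r)
        (\<lambda>m3 r'. write_entry cr 0 (Suc j) m3 vRej 0 = of_bool r' \<and> m3 cr 0 = j)
        (11 * n + 13 + cnt * (28 * n + 28)) (2 + cnt * 7)"
      using C j by (auto simp: fr2 write_entry_def elim!: sim_conseq)
  qed
  show ?thesis
    unfolding trials_com_def
    by (rule sim_conseq[OF sim_Seq_det[OF sim_Store[where x = "()" and Q = "\<lambda>m' _. m' vRej 0 = 0"] loop]])
      (simp_all add: write_entry_def algebra_simps)
qed

end

section \<open>The program for the discovery of blocks\<close>

definition blocks_com :: com where
  "blocks_com = For cr (rd 0) (Seq (Seq (setv vT (Const 0)) (For cl (rd vL)
     (Seq (Flip vB (Const 0)) (setv vT (Add (Add (rd vT) (rd vT)) (rd vB)))))) (Store vBL (rd cr) (rd vT)))"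

definition freshE :: expr where "freshE = andE diffE (notE colourE)"

definition search_com :: com where
  "search_com = For cl (rd vL) (Seq (setv vW (Div (rd vW) (Const 2)))
     (Seq (query_set vQ (andE freshE (Less (Read vBL (rd ci)) (Add (rd vLo) (rd vW)))))
       (Cond (rd vQ) (setv vLo (Add (rd vLo) (rd vW))) Skip)))"

definition new_colour :: com where
  "new_colour = Seq (setv vLo (Const 0)) (Seq (setv vW (rd vR)) (Seq search_com
     (Seq (setv vC (Add (rd vC) (Const 1))) (Store vMK (rd vLo) (rd vC)))))"

definition explore_com :: com where
  "explore_com = Seq (Sample vY) (Seq (query_set vQ freshE)
     (Cond (andE (notE (rd vQ)) (Less (rd vC) (rd vK))) new_colour Skip))"

definition discover_com :: com where
  "discover_com = For cr (rd vM) explore_com"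

lemma mods_blocks_com [simp]: "mods blocks_com = {cr, cl, vT, vB, vBL}"
  by (auto simp: blocks_com_def)

lemma mods_search_com [simp]: "mods search_com = {cl, vW, vLo, vQ, ci, vP}"
  by (auto simp: search_com_def)

lemma mods_new_colour [simp]: "mods new_colour = {cl, vW, vLo, vQ, ci, vP, vMK, vC}"
  by (auto simp: new_colour_def)

lemma mods_explore_com [simp]: "mods explore_com = {cl, vW, vLo, vQ, ci, vP, vMK, vC, vY}"
  by (auto simp: explore_com_def)

lemma mods_discover_com [simp]: "mods discover_com = {cr, cl, vW, vLo, vQ, ci, vP, vMK, vC, vY}"
  by (auto simp: discover_com_def)

context testing
begin

lemma sim_blocks:
  assumes n: "m 0 0 = n" and l: "m vL 0 = l"
  shows "sim blocks_com m (random_blocks l n) (\<lambda>m' bl. \<forall>i<n. m' vBL i = bl i) (2 + n * (6 + l * 4)) 0"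
proof -
  let ?I = "\<lambda>j m' bl. \<forall>i<j. m' vBL i = bl i"
  let ?c = "Seq (Flip vB (Const 0)) (setv vT (Add (Add (rd vT) (rd vT)) (rd vB)))"
  let ?b = "Seq (setv vT (Const 0)) (For cl (rd vL) ?c)"
  have inner: "sim ?b m' (random_block l) (\<lambda>m'' x. m'' vT 0 = x) (1 + (2 + l * (1 + 1 + 2))) (0 + l * (0 + 0))"
    if "m' vL 0 = l" for m'
  proof (rule sim_Seq_det[OF sim_Store[where x = "()" and Q = "\<lambda>m'' _. m'' vT 0 = 0"]])
    fix m1 :: memory
    assume m1: "m1 vT 0 = 0" and fr: "eq_off (mods (setv vT (Const 0))) m1 m'"
    show "sim (For cl (rd vL) ?c) m1 (random_block l) (\<lambda>m'' x. m'' vT 0 = x) (2 + l * (1 + 1 + 2)) (l * (0 + 0))"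
      unfolding random_block_def
    proof (rule sim_For)
      fix m2 :: memory
      assume "eq_off (insert cl (mods ?c)) m2 m1"
      then show "eval_expr (rd vL) m2 = l"
        using that fr by simp
    next
      show "write_entry cl 0 0 m1 vT 0 = 0"
        using m1 by (simp add: write_entry_def)
    next
      fix m2 :: memory and j x
      assume x: "m2 vT 0 = x" and j: "m2 cl 0 = j"
      show "sim ?c m2 (map_pmf (\<lambda>b. x + x + of_bool b) (bernoulli_pmf (1 / 2)))
          (\<lambda>m'' a'. write_entry cl 0 (Suc j) m'' vT 0 = a' \<and> m'' cl 0 = j) (1 + 1) (0 + 0)"
      proof (rule sim_Seq_post[OF sim_Flip[where Q = "\<lambda>m3 b. m3 vB 0 = of_bool b \<and> m3 vT 0 = x \<and> m3 cl 0 = j"]])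
        show "write_entry vB (eval_expr (Const 0) m2) (of_bool b) m2 vB 0 = of_bool b \<and>
            write_entry vB (eval_expr (Const 0) m2) (of_bool b) m2 vT 0 = x \<and>
            write_entry vB (eval_expr (Const 0) m2) (of_bool b) m2 cl 0 = j" for b
          using x j by (simp add: write_entry_def)
      next
        fix m3 :: memory and b
        assume "m3 vB 0 = of_bool b \<and> m3 vT 0 = x \<and> m3 cl 0 = j"
        then show "sim (setv vT (Add (Add (rd vT) (rd vT)) (rd vB))) m3 (return_pmf (x + x + of_bool b))
          (\<lambda>m'' a'. write_entry cl 0 (Suc j) m'' vT 0 = a' \<and> m'' cl 0 = j) 1 0"
          by (intro sim_Store) (simp add: write_entry_def)
      qed
    qed
  qed (simp add: write_entry_def)
  have "sim blocks_com m (random_blocks l n) (?I n) (2 + n * ((1 + (2 + l * (1 + 1 + 2))) + 1 + 2)) (n * ((0 + l * (0 + 0)) + 0))"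
    unfolding blocks_com_def random_blocks_def
  proof (rule sim_For)
    fix m' :: memory
    assume "eq_off (insert cr (mods (Seq ?b (Store vBL (rd cr) (rd vT))))) m' m"
    then show "eval_expr (rd 0) m' = n"
      using n by simp
  next
    fix m' :: memory and j bl
    assume I: "?I j m' bl" and j: "m' cr 0 = j"
      and fr: "eq_off (insert cr (mods (Seq ?b (Store vBL (rd cr) (rd vT))))) m' m"
    have "m' vL 0 = l"
      using fr l by simp
    from inner[of m', OF this]
    show "sim (Seq ?b (Store vBL (rd cr) (rd vT))) m' (map_pmf (\<lambda>x. bl(j := x)) (random_block l))
        (\<lambda>m'' a'. ?I (Suc j) (write_entry cr 0 (Suc j) m'') a' \<and> m'' cr 0 = j)
        ((1 + (2 + l * (1 + 1 + 2))) + 1) ((0 + l * (0 + 0)) + 0)"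
    proof (rule sim_Seq_post)
      fix m'' :: memory and x
      assume x: "m'' vT 0 = x" and fr': "eq_off (mods ?b) m'' m'"
      have "m'' vBL = m' vBL" "m'' cr 0 = j"
        using fr' j by simp_all
      then show "sim (Store vBL (rd cr) (rd vT)) m'' (return_pmf (bl(j := x)))
        (\<lambda>m'' a'. ?I (Suc j) (write_entry cr 0 (Suc j) m'') a' \<and> m'' cr 0 = j) 1 0"
        using x I by (intro sim_Store) (auto simp: write_entry_def less_Suc_eq)
    qed
  qed simp
  then show ?thesis
    by (rule sim_conseq) (auto simp: algebra_simps)
qed

definition explore_env :: "bool list \<Rightarrow> (nat \<Rightarrow> nat) \<Rightarrow> nat \<Rightarrow> nat \<Rightarrow> memory \<Rightarrow> bool" where
  "explore_env a bl l K m \<longleftrightarrow> env a m \<and> (\<forall>i<n. m vBL i = bl i) \<and> m vL 0 = l \<and> m vR 0 = 2 ^ l \<and> m vK 0 = K"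

lemma explore_env_cong:
  "m' 0 = m 0 \<Longrightarrow> m' vA = m vA \<Longrightarrow> m' vBL = m vBL \<Longrightarrow> m' vL = m vL \<Longrightarrow> m' vR = m vR \<Longrightarrow>
   m' vK = m vK \<Longrightarrow> explore_env a bl l K m' \<longleftrightarrow> explore_env a bl l K m"
  by (simp add: explore_env_def env_def)

lemma denotes_fresh:
  assumes m: "explore_env a bl l K m" and \<kappa>: "m vMK = \<kappa>" and y: "\<forall>i<n. m vY i = of_bool (y ! i)"
  shows "denotes m {} freshE {i \<in> diff a y. \<kappa> (bl i) = 0}"
  unfolding denotes_def
proof (intro allI impI)
  fix m' :: memory and i
  assume i: "i < n" "m' ci 0 = i" and fr: "eq_off {ci, vP} m' m"
  have "m' vY i = of_bool (y ! i)" "m' vA i = of_bool (a ! i)" "m' vBL i = bl i" "m' vMK = \<kappa>"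
    using m \<kappa> y i(1) fr by (simp_all add: explore_env_def env_def)
  then show "eval_expr freshE m' = of_bool (i \<in> {i \<in> diff a y. \<kappa> (bl i) = 0})"
    using i by (simp add: freshE_def diffE_def colourE_def diff_def)
qed

lemma sim_search:
  fixes bl \<kappa> :: "nat \<Rightarrow> nat" and a y :: "bool list"
  assumes m: "explore_env a bl l K m" and \<kappa>: "m vMK = \<kappa>" and y: "\<forall>i<n. m vY i = of_bool (y ! i)"
    and init: "m vLo 0 = 0" "m vW 0 = 2 ^ l"
  defines "Y \<equiv> {i \<in> diff a y. \<kappa> (bl i) = 0}"
  shows "sim search_com m (return_pmf ())
    (\<lambda>m' _. m' vLo 0 = locate (\<lambda>c. neg a {i \<in> Y. bl i < c}) l 0) (2 + l * (4 * n + 8)) l"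
proof -
  let ?g = "\<lambda>c. neg a {i \<in> Y. bl i < c}"
  \<comment> \<open>In place of a description of the current interval: the remaining
    \<open>l - j\<close> bisections, started at the current left end, lead to the final
    result.\<close>
  define I where "I = (\<lambda>j (m' :: memory). j \<le> l \<longrightarrow>
    m' vW 0 = 2 ^ (l - j) \<and> locate ?g (l - j) (m' vLo 0) = locate ?g l 0)"
  let ?q = "query_set vQ (andE freshE (Less (Read vBL (rd ci)) (Add (rd vLo) (rd vW))))"
  let ?c3 = "Cond (rd vQ) (setv vLo (Add (rd vLo) (rd vW))) Skip"
  let ?c = "Seq (setv vW (Div (rd vW) (Const 2))) (Seq ?q ?c3)"
  have "sim search_com m (return_pmf ()) (\<lambda>m' _. I l m')
      (2 + l * (1 + ((4 * n + 3) + (1 + 1)) + 2)) (l * (0 + (1 + 0)))"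
    unfolding search_com_def
  proof (rule sim_For_det)
    fix m' :: memory
    assume "eq_off (insert cl (mods ?c)) m' m"
    then show "eval_expr (rd vL) m' = l"
      using m by (simp add: explore_env_def)
  next
    show "I 0 (write_entry cl 0 0 m)"
      using init by (simp add: I_def write_entry_def)
  next
    fix m' :: memory and j
    assume I: "I j m'" and j: "j < l" "m' cl 0 = j"
      and fr: "eq_off (insert cl (mods ?c)) m' m"
    define d where "d = l - Suc j"
    have d: "l - j = Suc d" "l - Suc j = d" "Suc j \<le> l"
      using j(1) by (simp_all add: d_def)
    define lo where "lo = m' vLo 0"
    have lo: "m' vW 0 = 2 * 2 ^ d" "locate ?g (Suc d) lo = locate ?g l 0"
      using I j(1) by (simp_all add: I_def d lo_def)
    let ?post = "\<lambda>m'' (_ :: unit). I (Suc j) (write_entry cl 0 (Suc j) m'') \<and> m'' cl 0 = j"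
    show "sim ?c m' (return_pmf ()) ?post
        (1 + ((4 * n + 3) + (1 + 1))) (0 + (1 + 0))"
    proof (rule sim_Seq_det[OF sim_Store[where x = "()" and Q = "\<lambda>m1 _. m1 vW 0 = 2 ^ d"]])
      show "write_entry vW (eval_expr (Const 0) m') (eval_expr (Div (rd vW) (Const 2)) m') m' vW 0 = 2 ^ d"
        using lo(1) by (simp add: write_entry_def)
    next
      fix m1 :: memory
      assume w: "m1 vW 0 = 2 ^ d"
        and fr1: "eq_off (mods (setv vW (Div (rd vW) (Const 2)))) m1 m'"
      have fr2: "m1 x = m x" if "x \<notin> {cl, vW, vLo, vQ, ci, vP}" for x
        using that fr fr1 by simp
      have env1: "explore_env a bl l K m1"
        using m by (subst explore_env_cong[of m1 m]) (simp_all add: fr2)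
      have fresh: "denotes m1 {} freshE Y"
        unfolding Y_def by (rule denotes_fresh[OF env1]) (simp_all add: fr2 \<kappa> y)
      have lo1: "m1 vLo 0 = lo"
        by (simp add: fr1 lo_def)
      have den: "denotes m1 {} (andE freshE (Less (Read vBL (rd ci)) (Add (rd vLo) (rd vW)))) {i \<in> Y. bl i < lo + 2 ^ d}"
        unfolding denotes_def
      proof (intro allI impI)
        fix m2 :: memory and i
        assume i: "i < n" "m2 ci 0 = i" and fr3: "eq_off {ci, vP} m2 m1"
        have "m2 vBL i = bl i" "m2 vLo 0 = lo" "m2 vW 0 = 2 ^ d"
          using fr3 i(1) env1 lo1 w by (simp_all add: explore_env_def)
        moreover have "eval_expr freshE m2 = of_bool (i \<in> Y)"
          using fresh i fr3 unfolding denotes_def by blast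
        ultimately show "eval_expr (andE freshE (Less (Read vBL (rd ci)) (Add (rd vLo) (rd vW)))) m2 =
            of_bool (i \<in> {i \<in> Y. bl i < lo + 2 ^ d})"
          using i(2) by simp
      qed
      have "env a m1"
        using env1 by (simp add: explore_env_def)
      from sim_query_set[OF this den, of vQ]
      show "sim (Seq ?q ?c3) m1 (return_pmf ())
          ?post ((4 * n + 3) + (1 + 1)) (1 + 0)"
      proof (rule sim_Seq_det)
        fix m2 :: memory
        assume "m2 vQ 0 = of_bool (f (flip a {i \<in> Y. bl i < lo + 2 ^ d}))"
          and fr3: "eq_off (mods ?q) m2 m1"
        then have q: "m2 vQ 0 = of_bool (\<not> ?g (lo + 2 ^ d))"
          by (simp add: neg_def)
        have m2: "m2 vLo 0 = lo" "m2 vW 0 = 2 ^ d" "m2 cl 0 = j"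
          using lo1 w j(2) fr1 by (simp_all add: fr3)
        show "sim ?c3 m2 (return_pmf ())
          ?post (1 + 1) 0"
        proof (rule sim_Cond)
          assume "eval_expr (rd vQ) m2 \<noteq> 0"
          then have "\<not> ?g (lo + 2 ^ d)"
            using q by simp
          then have "locate ?g d (lo + 2 ^ d) = locate ?g l 0"
            using lo(2) by simp
          then show "sim (setv vLo (Add (rd vLo) (rd vW))) m2 (return_pmf ())
              ?post 1 0"
            using m2 by (intro sim_Store) (simp add: write_entry_def I_def d)
        next
          assume "eval_expr (rd vQ) m2 = 0"
          then have "?g (lo + 2 ^ d)"
            using q by simp
          then have "locate ?g d lo = locate ?g l 0"
            using lo(2) by simp
          then show "sim Skip m2 (return_pmf ())
              ?post 1 0"
            using m2 by (intro sim_Skip) (simp add: write_entry_def I_def d)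
        qed
      qed
    qed
  qed
  then show ?thesis
    by (rule sim_conseq) (auto simp: I_def algebra_simps)
qed

text \<open>Equality of the whole array is available because the memory starts out as zero and only
  marked blocks are written.\<close>

definition colouring :: "(nat \<Rightarrow> nat) \<times> nat \<Rightarrow> memory \<Rightarrow> bool" where
  "colouring \<sigma> m \<longleftrightarrow> m vMK = fst \<sigma> \<and> m vC 0 = snd \<sigma>"

lemma sim_new_colour:
  fixes bl \<kappa> :: "nat \<Rightarrow> nat" and a y :: "bool list"
  assumes m: "explore_env a bl l K m" and \<kappa>: "m vMK = \<kappa>" and y: "\<forall>i<n. m vY i = of_bool (y ! i)"
    and C: "m vC 0 = cnt"
  defines "Y \<equiv> {i \<in> diff a y. \<kappa> (bl i) = 0}"
  shows "sim new_colour m (return_pmf (\<kappa>(locate (\<lambda>c. neg a {i \<in> Y. bl i < c}) l 0 := Suc cnt), Suc cnt))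
    (\<lambda>m' \<sigma>. colouring \<sigma> m') (6 + l * (4 * n + 8)) l"
proof -
  let ?post = "\<lambda>m' \<sigma>. colouring \<sigma> m'"
  let ?b = "locate (\<lambda>c. neg a {i \<in> Y. bl i < c}) l 0"
  let ?r = "return_pmf (\<kappa>(?b := Suc cnt), Suc cnt) :: ((nat \<Rightarrow> nat) \<times> nat) pmf"
  let ?m = "write_entry vW 0 (2 ^ l) (write_entry vLo 0 0 m)"
  have env: "explore_env a bl l K ?m"
    using m by (subst explore_env_cong[of ?m m]) (simp_all add: write_entry_def)
  have "sim search_com ?m (return_pmf ()) (\<lambda>m' _. m' vLo 0 = ?b) (2 + l * (4 * n + 8)) l"
    unfolding Y_def by (rule sim_search[OF env]) (simp_all add: write_entry_def \<kappa> y)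
  then have "sim (Seq search_com (Seq (setv vC (Add (rd vC) (Const 1))) (Store vMK (rd vLo) (rd vC)))) ?m ?r
      ?post ((2 + l * (4 * n + 8)) + (1 + 1)) (l + (0 + 0))"
  proof (rule sim_Seq_det)
    fix m1 :: memory
    assume "m1 vLo 0 = ?b" and fr: "eq_off (mods search_com) m1 ?m"
    then show "sim (Seq (setv vC (Add (rd vC) (Const 1))) (Store vMK (rd vLo) (rd vC))) m1 ?r
        ?post (1 + 1) (0 + 0)"
      using \<kappa> C by (intro sim_Seq_Store sim_Store) (simp add: colouring_def write_entry_def)
  qed
  moreover have "m vR 0 = 2 ^ l"
    using m by (simp add: explore_env_def)
  ultimately have "sim new_colour m ?r ?post
      (1 + (1 + ((2 + l * (4 * n + 8)) + (1 + 1)))) (0 + (0 + (l + (0 + 0))))"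
    unfolding new_colour_def by (intro sim_Seq_Store) (simp add: write_entry_def)
  then show ?thesis
    by (rule sim_conseq) auto
qed

text \<open>Each sample is charged for a bisection, although at most \<open>K\<close> samples start
  one. This gives a bound that is the same for all runs at the price of a factor of order
  \<open>l\<close>.\<close>

lemma sim_explore:
  assumes D: "set_pmf D \<subseteq> cube n"
    and m: "explore_env a bl l K m" and \<sigma>: "colouring \<sigma> m"
  shows "sim explore_com m (map_pmf (explore a bl l K \<sigma>) D) (\<lambda>m' \<sigma>. colouring \<sigma> m')
    (5 * n + 11 + l * (4 * n + 8)) (2 + l)"
proof -
  let ?post = "\<lambda>m' \<sigma>. colouring \<sigma> m'"
  let ?T = "6 + l * (4 * n + 8)"
  obtain \<kappa> cnt where \<sigma>': "\<sigma> = (\<kappa>, cnt)"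
    by (cases \<sigma>)
  have \<kappa>: "m vMK = \<kappa>" "m vC 0 = cnt"
    using \<sigma> by (simp_all add: \<sigma>' colouring_def)
  let ?c = "Cond (andE (notE (rd vQ)) (Less (rd vC) (rd vK))) new_colour Skip"
  have "sim explore_com m (map_pmf (explore a bl l K \<sigma>) D) ?post
      ((n + 1) + ((4 * n + 3) + (?T + 1))) (1 + (1 + l))"
    unfolding explore_com_def
  proof (rule sim_Seq_post[OF sim_Sample[where Q = "\<lambda>m' y. \<forall>i<n. m' vY i = of_bool (y ! i)"]])
    fix m1 :: memory and y
    assume y: "\<forall>i<n. m1 vY i = of_bool (y ! i)" and fr: "eq_off (mods (Sample vY)) m1 m"
    define Y where "Y = {i \<in> diff a y. \<kappa> (bl i) = 0}"
    have env1: "explore_env a bl l K m1"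
      using m by (subst explore_env_cong[of m1 m]) (simp_all add: fr)
    then have "env a m1"
      by (simp add: explore_env_def)
    moreover have "denotes m1 {} freshE Y"
      unfolding Y_def by (rule denotes_fresh[OF env1 _ y]) (simp add: fr \<kappa>)
    ultimately have "sim (query_set vQ freshE) m1 (return_pmf ()) (\<lambda>m' _. m' vQ 0 = of_bool (f (flip a Y))) (4 * n + 3) 1"
      by (rule sim_query_set)
    then show "sim (Seq (query_set vQ freshE) ?c) m1 (return_pmf (explore a bl l K \<sigma> y)) ?post
        ((4 * n + 3) + (?T + 1)) (1 + l)"
    proof (rule sim_Seq_det)
      fix m2 :: memory
      assume q: "m2 vQ 0 = of_bool (f (flip a Y))" and fr2: "eq_off (mods (query_set vQ freshE)) m2 m1"
      have env2: "explore_env a bl l K m2"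
        using env1 by (subst explore_env_cong[of m2 m1]) (simp_all add: fr2)
      have m2: "m2 vMK = \<kappa>" "m2 vC 0 = cnt" "m2 vK 0 = K"
        using \<kappa> env2 by (simp_all add: fr2 fr explore_env_def)
      have y2: "\<forall>i<n. m2 vY i = of_bool (y ! i)"
        using y by (simp add: fr2)
      have cond: "eval_expr (andE (notE (rd vQ)) (Less (rd vC) (rd vK))) m2 \<noteq> 0 \<longleftrightarrow> neg a Y \<and> cnt < K"
        using q m2 by (simp add: neg_def)
      have e: "explore a bl l K \<sigma> y = (if neg a Y \<and> cnt < K
          then (\<kappa>(locate (\<lambda>c. neg a {i \<in> Y. bl i < c}) l 0 := Suc cnt), Suc cnt) else (\<kappa>, cnt))"
        by (simp add: explore_def \<sigma>' Y_def[symmetric])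
      show "sim ?c m2 (return_pmf (explore a bl l K \<sigma> y)) ?post (?T + 1) l"
      proof (rule sim_Cond)
        assume "eval_expr (andE (notE (rd vQ)) (Less (rd vC) (rd vK))) m2 \<noteq> 0"
        then have "explore a bl l K \<sigma> y = (\<kappa>(locate (\<lambda>c. neg a {i \<in> Y. bl i < c}) l 0 := Suc cnt), Suc cnt)"
          using cond e by simp
        then show "sim new_colour m2 (return_pmf (explore a bl l K \<sigma> y)) ?post ?T l"
          using sim_new_colour[OF env2 m2(1) y2 m2(2)] by (simp add: Y_def)
      next
        assume "eval_expr (andE (notE (rd vQ)) (Less (rd vC) (rd vK))) m2 = 0"
        then have "explore a bl l K \<sigma> y = (\<kappa>, cnt)"
          using cond e by auto
        then have "sim Skip m2 (return_pmf (explore a bl l K \<sigma> y)) ?post 1 0"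
          using m2 by (intro sim_Skip) (simp add: colouring_def)
        then show "sim Skip m2 (return_pmf (explore a bl l K \<sigma> y)) ?post ?T l"
          by (rule sim_conseq) auto
      qed
    qed
  qed (simp add: write_point_def)
  then show ?thesis
    by (rule sim_conseq) auto
qed

lemma sim_discover:
  assumes D: "set_pmf D \<subseteq> cube n"
    and m: "explore_env a bl l K m" and M: "m vM 0 = M" and \<sigma>: "m vMK = (\<lambda>_. 0)" "m vC 0 = 0"
  shows "sim discover_com m (discover a bl l K M) (\<lambda>m' \<sigma>. colouring \<sigma> m')
    (2 + M * (5 * n + 13 + l * (4 * n + 8))) (M * (2 + l))"
proof -
  have "sim discover_com m (discover a bl l K M) (\<lambda>m' \<sigma>. colouring \<sigma> m')
    (2 + M * (5 * n + 11 + l * (4 * n + 8) + 2)) (M * (2 + l))"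
    unfolding discover_com_def discover_def
  proof (rule sim_For)
    fix m' :: memory
    assume "eq_off (insert cr (mods explore_com)) m' m"
    then show "eval_expr (rd vM) m' = M"
      using M by simp
  next
    show "colouring (\<lambda>_. 0, 0) (write_entry cr 0 0 m)"
      using \<sigma> by (simp add: colouring_def write_entry_def)
  next
    fix m' :: memory and j \<sigma>
    assume \<sigma>: "colouring \<sigma> m'" and j: "m' cr 0 = j"
      and fr: "eq_off (insert cr (mods explore_com)) m' m"
    have "explore_env a bl l K m'"
      using m by (subst explore_env_cong[of m' m]) (simp_all add: fr)
    from sim_explore[OF D this \<sigma>]
    show "sim explore_com m' (map_pmf (explore a bl l K \<sigma>) D)
        (\<lambda>m'' a'. colouring a' (write_entry cr 0 (Suc j) m'') \<and> m'' cr 0 = j) (5 * n + 11 + l * (4 * n + 8)) (2 + l)"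
      using j by (elim sim_conseq) (auto simp: colouring_def write_entry_def)
  qed
  then show ?thesis
    by (rule sim_conseq) auto
qed

end

section \<open>The program of the tester\<close>

text \<open>While \<open>vU\<close> doubles until it reaches \<open>K\<close>, \<open>vL\<close>
  grows by 2 and \<open>vR\<close> by the factor 4, so that \<open>vR = 2 ^ vL\<close> throughout
  and finally \<open>vR\<close> is at least 32 K^2. \<open>K\<close> rounds suffice as the logarithm
  is at most \<open>K\<close>. The number of samples, a product, is formed by repeated
  addition.\<close>

definition setup_com :: com where
  "setup_com = Seq (Cond (Less (rd 0) (rd 1)) (setv vK (rd 0)) (setv vK (rd 1)))
     (Seq (setv vU (Const 1)) (Seq (setv vL (Const 5)) (Seq (setv vR (Const 32))
       (Seq (For cl (rd vK) (Cond (Less (rd vU) (rd vK))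
           (Seq (setv vU (Add (rd vU) (rd vU))) (Seq (setv vL (Add (rd vL) (Const 2))) (setv vR (times 4 (rd vR))))) Skip))
         (Seq (setv vM (Const 0)) (For cl (rd vK) (setv vM (Add (rd vM) (times 1000 (rd vE))))))))))"

definition verify_com :: com where
  "verify_com = Seq setup_com (Seq blocks_com (Seq discover_com (Seq trials_com (setv 4 (notE (rd vRej))))))"

definition find_com :: com where
  "find_com = Seq (Query vFd (Const 0) vA)
     (For cr (times 5 (rd vE)) (Cond (rd vFd) Skip (Seq (Sample vA) (Query vFd (Const 0) vA))))"

definition complement_com :: com where
  "complement_com = Seq (For ci (rd 0) (Store vA (rd ci) (notE (Read vA (rd ci))))) (Query vFd (Const 0) vA)"

definition no_positive_com :: com where
  "no_positive_com = Cond (andE (Less (Const 1) (rd 1)) (rd 0)) (setv 4 (Const 1)) complement_com"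

text \<open>If \<open>q < p\<close>, then \<epsilon> exceeds 1 and no function is far from the
  class, so acceptance is always right.\<close>

definition tester_com :: com where
  "tester_com = Cond (Less (rd 3) (rd 2)) (setv 4 (Const 1))
     (Seq (setv vE (Add (Div (rd 3) (rd 2)) (Const 1)))
       (Seq find_com (Seq (Cond (rd vFd) Skip no_positive_com) (Cond (rd vFd) verify_com Skip))))"

lemma mods_setup_com [simp]: "mods setup_com = {vK, vU, vL, vR, cl, vM}"
  by (auto simp: setup_com_def)

lemma mods_trials_com [simp]: "mods trials_com =
  {ci, vP, 31, 32, 33, 34, 35, 36, 37, vRej, vAny, vQ, cc, sZ, sW, sV, vY, cr}"
  by (auto simp: trials_com_def)

lemma mods_find_com [simp]: "mods find_com = {vFd, cr, vA}"
  by (auto simp: find_com_def)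

lemma mods_complement_com [simp]: "mods complement_com = {vFd, ci, vA}"
  by (auto simp: complement_com_def)

section \<open>Rounded logarithms and the number of blocks\<close>

definition log2_up :: "nat \<Rightarrow> nat" where
  "log2_up K = (LEAST i. K \<le> 2 ^ i)"

lemma le_two_power_log2_up: "K \<le> 2 ^ log2_up K"
  unfolding log2_up_def by (rule LeastI[of _ K]) (rule less_imp_le[OF less_exp])

lemma two_power_less:
  assumes "i < log2_up K"
  shows "2 ^ i < K"
proof -
  have "\<not> K \<le> 2 ^ i"
    using assms unfolding log2_up_def by (rule not_less_Least)
  then show ?thesis by simp
qed

lemma log2_up_le: "log2_up K \<le> K"
  unfolding log2_up_def by (rule Least_le) (rule less_imp_le[OF less_exp])

text \<open>The exponent of a power of two that is at least 32 K^2, as needed for the birthday bound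
  with error 1/32.\<close>

definition levels :: "nat \<Rightarrow> nat" where
  "levels K = 5 + 2 * log2_up K"

lemma levels_ge: "32 * K * K \<le> 2 ^ levels K"
proof -
  have "K * K \<le> 2 ^ log2_up K * 2 ^ log2_up K"
    by (rule mult_le_mono[OF le_two_power_log2_up le_two_power_log2_up])
  then have "2 ^ 5 * (K * K) \<le> 2 ^ 5 * (2 ^ log2_up K * 2 ^ log2_up K)"
    by (rule mult_le_mono2)
  also have "\<dots> = 2 ^ (5 + (log2_up K + log2_up K))"
    by (simp only: power_add)
  also have "5 + (log2_up K + log2_up K) = levels K"
    by (simp add: levels_def)
  finally show ?thesis
    by simp
qed

context testing
begin

lemma sim_setup:
  assumes n: "m 0 0 = n" and k: "m 1 0 = k" and E: "m vE 0 = E"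
  defines "K \<equiv> min k n"
  shows "sim setup_com m (return_pmf ()) (\<lambda>m' _. m' vK 0 = K \<and> m' vL 0 = levels K \<and>
    m' vR 0 = 2 ^ levels K \<and> m' vM 0 = K * (1000 * E)) (10 + 9 * K) 0"
proof -
  let ?L = "log2_up K"
  \<comment> \<open>The minimum expresses that growth stops once \<open>vU\<close> has reached
    \<open>K\<close>; all later rounds take the empty branch.\<close>
  define I where "I = (\<lambda>j (m' :: memory). m' vU 0 = 2 ^ min j ?L \<and> m' vL 0 = 5 + 2 * min j ?L \<and>
    m' vR 0 = 2 ^ (5 + 2 * min j ?L))"
  let ?grow = "Seq (setv vU (Add (rd vU) (rd vU))) (Seq (setv vL (Add (rd vL) (Const 2))) (setv vR (times 4 (rd vR))))"
  let ?c = "Cond (Less (rd vU) (rd vK)) ?grow Skip"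
  have loop1: "sim (For cl (rd vK) ?c) m' (return_pmf ()) (\<lambda>m' _. I K m') (2 + K * (1 + (1 + 1) + 1 + 2)) (K * 0)"
    if K: "m' vK 0 = K" and init: "I 0 m'" for m'
  proof (rule sim_For_det)
    fix m'' :: memory
    assume "eq_off (insert cl (mods ?c)) m'' m'"
    then show "eval_expr (rd vK) m'' = K"
      using K by simp
  next
    show "I 0 (write_entry cl 0 0 m')"
      using init by (simp add: I_def write_entry_def)
  next
    fix m'' :: memory and j
    assume I: "I j m''" and j: "m'' cl 0 = j" and fr: "eq_off (insert cl (mods ?c)) m'' m'"
    have K'': "m'' vK 0 = K"
      using K fr by simp
    let ?post = "\<lambda>m3 (_ :: unit). I (Suc j) (write_entry cl 0 (Suc j) m3) \<and> m3 cl 0 = j"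
    show "sim ?c m'' (return_pmf ()) ?post (1 + (1 + 1) + 1) 0"
    proof (rule sim_Cond)
      assume "eval_expr (Less (rd vU) (rd vK)) m'' \<noteq> 0"
      then have "2 ^ min j ?L < K"
        using I K'' by (simp add: I_def)
      then have "j < ?L"
        using le_two_power_log2_up[of K] by (cases "j < ?L") (simp_all add: min_def split: if_splits)
      then have m: "m'' vU 0 = 2 ^ j" "m'' vL 0 = 5 + 2 * j" "m'' vR 0 = 2 ^ (5 + 2 * j)" "min (Suc j) ?L = Suc j"
        using I by (simp_all add: I_def)
      have "sim ?grow m'' (return_pmf ()) ?post (1 + (1 + 1)) (0 + (0 + 0))"
        using j by (intro sim_Seq_Store sim_Store) (simp add: I_def m write_entry_def power_add)
      then show "sim ?grow m'' (return_pmf ()) ?post (1 + (1 + 1)) 0"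
        by simp
    next
      assume "eval_expr (Less (rd vU) (rd vK)) m'' = 0"
      then have "\<not> 2 ^ min j ?L < K"
        using I K'' by (simp add: I_def)
      then have "?L \<le> j"
        using two_power_less[of j K] by (cases "j < ?L") simp_all
      then have "I (Suc j) (write_entry cl 0 (Suc j) m'')"
        using I by (simp add: I_def write_entry_def min_def)
      then have "sim Skip m'' (return_pmf ()) ?post 1 0"
        using j by (intro sim_Skip) simp
      then show "sim Skip m'' (return_pmf ()) ?post (1 + (1 + 1)) 0"
        by (rule sim_conseq) auto
    qed
  qed
  let ?s = "setv vM (Add (rd vM) (times 1000 (rd vE)))"
  have loop2: "sim (For cl (rd vK) ?s) m' (return_pmf ()) (\<lambda>m' _. m' vM 0 = K * (1000 * E)) (2 + K * (1 + 2)) (K * 0)"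
    if K: "m' vK 0 = K" and E: "m' vE 0 = E" and init: "m' vM 0 = 0" for m'
  proof (rule sim_For_det)
    fix m'' :: memory
    assume "eq_off (insert cl (mods ?s)) m'' m'"
    then show "eval_expr (rd vK) m'' = K"
      using K by simp
  next
    show "write_entry cl 0 0 m' vM 0 = 0 * (1000 * E)"
      using init by (simp add: write_entry_def)
  next
    fix m'' :: memory and j
    assume I: "m'' vM 0 = j * (1000 * E)" and j: "m'' cl 0 = j"
      and fr: "eq_off (insert cl (mods ?s)) m'' m'"
    have "m'' vE 0 = E"
      using E fr by simp
    then show "sim ?s m'' (return_pmf ()) (\<lambda>m3 _. write_entry cl 0 (Suc j) m3 vM 0 = Suc j * (1000 * E) \<and> m3 cl 0 = j) 1 0"
      using I j by (intro sim_Store) (simp add: write_entry_def)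
  qed
  let ?c1 = "Cond (Less (rd 0) (rd 1)) (setv vK (rd 0)) (setv vK (rd 1))"
  let ?post = "\<lambda>m' (_ :: unit). m' vK 0 = K \<and> m' vL 0 = levels K \<and> m' vR 0 = 2 ^ levels K \<and> m' vM 0 = K * (1000 * E)"
  have tail: "sim (Seq (setv vM (Const 0)) (For cl (rd vK) ?s)) m' (return_pmf ()) ?post (1 + (2 + K * (1 + 2))) (0 + K * 0)"
    if K: "m' vK 0 = K" and E: "m' vE 0 = E" and I: "I K m'" for m'
  proof (rule sim_conseq[OF sim_Seq_det[OF sim_Store[where x = "()" and Q = "\<lambda>m1 _. m1 vM 0 = 0"] loop2]])
    fix m1 m2 :: memory
    assume "m2 vM 0 = K * (1000 * E)" and "eq_off (mods (Seq (setv vM (Const 0)) (For cl (rd vK) ?s))) m2 m'"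
    then show "m2 vK 0 = K \<and> m2 vL 0 = levels K \<and> m2 vR 0 = 2 ^ levels K \<and> m2 vM 0 = K * (1000 * E)"
      using K I log2_up_le[of K] by (simp add: I_def levels_def)
  qed (simp_all add: K E write_entry_def)
  have "sim setup_com m (return_pmf ()) ?post
      ((1 + 1) + (1 + (1 + (1 + ((2 + K * (1 + (1 + 1) + 1 + 2)) + (1 + (2 + K * (1 + 2))))))))
      (0 + (0 + (0 + (0 + (K * 0 + (0 + K * 0))))))"
    unfolding setup_com_def
  proof (rule sim_Seq_det[where ?Q1.0 = "\<lambda>m1 _. m1 vK 0 = K"])
    show "sim ?c1 m (return_pmf ()) (\<lambda>m1 _. m1 vK 0 = K) (1 + 1) 0"
      using n k by (intro sim_Cond sim_Store) (auto simp: write_entry_def K_def)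
    fix m1 :: memory
    assume K: "m1 vK 0 = K" and fr1: "eq_off (mods ?c1) m1 m"
    let ?m = "write_entry vR 0 32 (write_entry vL 0 5 (write_entry vU 0 1 m1))"
    have "sim (Seq (For cl (rd vK) ?c) (Seq (setv vM (Const 0)) (For cl (rd vK) ?s))) ?m (return_pmf ()) ?post
        ((2 + K * (1 + (1 + 1) + 1 + 2)) + (1 + (2 + K * (1 + 2)))) (K * 0 + (0 + K * 0))"
    proof (rule sim_Seq_det[OF loop1 tail])
      fix m2 :: memory
      assume "I K m2" and fr2: "eq_off (mods (For cl (rd vK) ?c)) m2 ?m"
      then show "m2 vK 0 = K" "m2 vE 0 = E" "I K m2"
        using K E fr1 by (simp_all add: fr2 write_entry_def)
    qed (simp_all add: K I_def write_entry_def)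
    then show "sim (Seq (setv vU (Const 1)) (Seq (setv vL (Const 5)) (Seq (setv vR (Const 32))
        (Seq (For cl (rd vK) ?c) (Seq (setv vM (Const 0)) (For cl (rd vK) ?s)))))) m1 (return_pmf ()) ?post
        (1 + (1 + (1 + ((2 + K * (1 + (1 + 1) + 1 + 2)) + (1 + (2 + K * (1 + 2)))))))
        (0 + (0 + (0 + (K * 0 + (0 + K * 0)))))"
      by (intro sim_Seq_Store) (simp only: eval_expr.simps)
  qed
  then show ?thesis
    by (rule sim_conseq) auto
qed

definition verify_time :: "nat \<Rightarrow> nat \<Rightarrow> nat \<Rightarrow> nat" where
  "verify_time K l E = (10 + 9 * K) + ((2 + n * (6 + l * 4)) +
     ((2 + K * (1000 * E) * (5 * n + 13 + l * (4 * n + 8))) + ((3 + 100 * E * (11 * n + 15 + K * (28 * n + 28))) + 1)))"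

definition verify_queries :: "nat \<Rightarrow> nat \<Rightarrow> nat \<Rightarrow> nat" where
  "verify_queries K l E = K * (1000 * E) * (2 + l) + 100 * E * (2 + K * 7)"

lemma sim_verify:
  assumes D: "set_pmf D \<subseteq> cube n"
    and env: "env a m" and k: "m 1 0 = k" and E: "m vE 0 = E" and C: "m vMK = (\<lambda>_. 0)" "m vC 0 = 0"
  defines "K \<equiv> min k n"
  shows "sim verify_com m (verify a (levels K) K E) (\<lambda>m' b. m' 4 0 = of_bool b)
    (verify_time K (levels K) E) (verify_queries K (levels K) E)"
proof -
  let ?l = "levels K" and ?M = "K * (1000 * E)"
  let ?Td = "2 + ?M * (5 * n + 13 + ?l * (4 * n + 8))" and ?Tt = "3 + 100 * E * (11 * n + 15 + K * (28 * n + 28))"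
  let ?Nt = "100 * E * (2 + K * 7)"
  let ?post = "\<lambda>m' b. m' 4 0 = of_bool b"
  have n: "m 0 0 = n"
    using env by (simp add: env_def)
  have "sim verify_com m (verify a ?l K E) ?post
      ((10 + 9 * K) + ((2 + n * (6 + ?l * 4)) + (?Td + (?Tt + 1)))) (0 + (0 + (?M * (2 + ?l) + (?Nt + 0))))"
    unfolding verify_com_def verify_def
  proof (rule sim_Seq_det[OF sim_setup[where m = m, OF n k E, folded K_def]])
    fix m1 :: memory
    assume m1: "m1 vK 0 = K \<and> m1 vL 0 = ?l \<and> m1 vR 0 = 2 ^ ?l \<and> m1 vM 0 = ?M"
      and fr1: "eq_off (mods setup_com) m1 m"
    have m1': "m1 0 0 = n" "m1 vL 0 = ?l"
      using n m1 by (simp_all add: fr1)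
    show "sim (Seq blocks_com (Seq discover_com (Seq trials_com (setv 4 (notE (rd vRej)))))) m1
        (bind_pmf (random_blocks ?l n) (\<lambda>bl. bind_pmf (discover a bl ?l K ?M)
          (\<lambda>\<sigma>. map_pmf Not (trials a (fst \<sigma> \<circ> bl) (snd \<sigma>) (100 * E))))) ?post
        ((2 + n * (6 + ?l * 4)) + (?Td + (?Tt + 1))) (0 + (?M * (2 + ?l) + (?Nt + 0)))"
    proof (rule sim_Seq[OF sim_blocks[where m = m1, OF m1']])
      fix m2 :: memory and bl :: "nat \<Rightarrow> nat"
      assume bl: "\<forall>i<n. m2 vBL i = bl i" and fr2: "eq_off (mods blocks_com) m2 m1"
      have env2: "env a m2"
        using env by (subst env_cong[of m2 m]) (simp_all add: fr2 fr1)
      have "explore_env a bl ?l K m2"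
        using env2 bl m1 by (simp add: explore_env_def fr2)
      moreover have "m2 vM 0 = ?M" "m2 vMK = (\<lambda>_. 0)" "m2 vC 0 = 0"
        using C m1 by (simp_all add: fr2 fr1)
      ultimately have 1: "sim discover_com m2 (discover a bl ?l K ?M) (\<lambda>m' \<sigma>. colouring \<sigma> m') ?Td (?M * (2 + ?l))"
        by (rule sim_discover[OF D])
      show "sim (Seq discover_com (Seq trials_com (setv 4 (notE (rd vRej))))) m2
          (bind_pmf (discover a bl ?l K ?M) (\<lambda>\<sigma>. map_pmf Not (trials a (fst \<sigma> \<circ> bl) (snd \<sigma>) (100 * E)))) ?post
          (?Td + (?Tt + 1)) (?M * (2 + ?l) + (?Nt + 0))"
      proof (rule sim_Seq[OF 1])
        fix m3 :: memory and \<sigma> :: "(nat \<Rightarrow> nat) \<times> nat"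
        assume \<sigma>: "colouring \<sigma> m3" "\<sigma> \<in> set_pmf (discover a bl ?l K ?M)"
          and fr3: "eq_off (mods discover_com) m3 m2"
        have "env a m3"
          using env2 by (subst env_cong[of m3 m2]) (simp_all add: fr3)
        then have "colour_env a (fst \<sigma> \<circ> bl) m3"
          using \<sigma>(1) bl by (simp add: colour_env_def colouring_def fr3)
        moreover have "m3 vC 0 = snd \<sigma>" "m3 vE 0 = E"
          using \<sigma>(1) E by (simp_all add: colouring_def fr3 fr2 fr1)
        ultimately have "sim trials_com m3 (trials a (fst \<sigma> \<circ> bl) (snd \<sigma>) (100 * E)) (\<lambda>m' r. m' vRej 0 = of_bool r)
            (3 + 100 * E * (11 * n + 15 + snd \<sigma> * (28 * n + 28))) (100 * E * (2 + snd \<sigma> * 7))"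
          by (rule sim_trials[OF D])
        \<comment> \<open>The number of colours varies from run to run; it is replaced by its bound
          \<open>K\<close>.\<close>
        then have 2: "sim trials_com m3 (trials a (fst \<sigma> \<circ> bl) (snd \<sigma>) (100 * E)) (\<lambda>m' r. m' vRej 0 = of_bool r) ?Tt ?Nt"
          using discover_le[OF \<sigma>(2)] by (elim sim_conseq) (auto intro!: mult_le_mono add_mono)
        show "sim (Seq trials_com (setv 4 (notE (rd vRej)))) m3
            (map_pmf Not (trials a (fst \<sigma> \<circ> bl) (snd \<sigma>) (100 * E))) ?post (?Tt + 1) (?Nt + 0)"
        proof (rule sim_Seq_post[OF 2])
          fix m4 :: memory and r
          assume "m4 vRej 0 = of_bool r"
          then show "sim (setv 4 (notE (rd vRej))) m4 (return_pmf (\<not> r)) ?post 1 0"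
            by (intro sim_Store) (simp add: write_entry_def)
        qed
      qed
    qed
  qed
  then show ?thesis
    by (rule sim_conseq) (auto simp: verify_time_def verify_queries_def)
qed

lemma read_point_env: "env a m \<Longrightarrow> read_point n vA m = a"
  by (auto simp: env_def read_point_def intro!: nth_equalityI)

lemma sim_Query_env:
  assumes "env a m"
  shows "sim (Query vFd (Const 0) vA) m (return_pmf x) (\<lambda>m' _. env a m' \<and> m' vFd 0 = of_bool (f a)) (n + 1) 1"
  using assms read_point_env[OF assms] by (intro sim_Query) (simp add: write_entry_def env_def)

lemma sim_find:
  assumes D: "set_pmf D \<subseteq> cube n"
    and m: "m 0 0 = n" "m vA = (\<lambda>_. 0)" "m vE 0 = E"
  shows "sim find_com m (find_positive (5 * E)) (\<lambda>m' s. env (snd s) m' \<and> m' vFd 0 = of_bool (fst s))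
    (n + 3 + 5 * E * (2 * n + 5)) (1 + 5 * E * 2)"
proof -
  let ?I = "\<lambda>m' s. env (snd s) m' \<and> m' vFd 0 = of_bool (fst s)"
  let ?z = "replicate n False"
  let ?q = "Query vFd (Const 0) vA"
  let ?c = "Cond (rd vFd) Skip (Seq (Sample vA) ?q)"
  have "env ?z m"
    using m by (simp add: env_def)
  from sim_Query_env[OF this, of "()"]
  have "sim find_com m (find_positive (5 * E)) ?I ((n + 1) + (2 + 5 * E * ((n + 1) + (n + 1) + 1 + 2))) (1 + 5 * E * (1 + 1))"
    unfolding find_com_def
  proof (rule sim_Seq_det)
    fix m1 :: memory
    assume m1: "env ?z m1 \<and> m1 vFd 0 = of_bool (f ?z)" and fr1: "eq_off (mods ?q) m1 m"
    show "sim (For cr (times 5 (rd vE)) ?c) m1 (find_positive (5 * E)) ?I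
        (2 + 5 * E * ((n + 1) + (n + 1) + 1 + 2)) (5 * E * (1 + 1))"
      unfolding find_positive_def
    proof (rule sim_For)
      fix m2 :: memory
      assume "eq_off (insert cr (mods ?c)) m2 m1"
      then show "eval_expr (times 5 (rd vE)) m2 = 5 * E"
        using m fr1 by simp
    next
      show "?I (write_entry cr 0 0 m1) (f ?z, ?z)"
        using m1 by (simp add: env_def write_entry_def)
    next
      fix m2 :: memory and j and s :: "bool \<times> bool list"
      assume I: "?I m2 s" and j: "m2 cr 0 = j"
      let ?post = "\<lambda>m'' s'. ?I (write_entry cr 0 (Suc j) m'') s' \<and> m'' cr 0 = j"
      show "sim ?c m2 (if fst s then return_pmf s else map_pmf (\<lambda>y. (f y, y)) D) ?post ((n + 1) + (n + 1) + 1) (1 + 1)"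
      proof (rule sim_Cond)
        assume "eval_expr (rd vFd) m2 \<noteq> 0"
        then have "fst s"
          using I by simp
        have "sim Skip m2 (return_pmf s) ?post 1 0"
          using I j by (intro sim_Skip) (simp add: env_def write_entry_def)
        then have "sim Skip m2 (return_pmf s) ?post ((n + 1) + (n + 1)) (1 + 1)"
          by (rule sim_conseq) auto
        then show "sim Skip m2 (if fst s then return_pmf s else map_pmf (\<lambda>y. (f y, y)) D) ?post ((n + 1) + (n + 1)) (1 + 1)"
          by (simp only: \<open>fst s\<close> if_True)
      next
        assume "eval_expr (rd vFd) m2 = 0"
        then have s: "\<not> fst s"
          using I by simp
        have "sim (Seq (Sample vA) ?q) m2 (map_pmf (\<lambda>y. (f y, y)) D) ?post ((n + 1) + (n + 1)) (1 + 1)"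
        proof (rule sim_Seq_post[OF sim_Sample[where Q = "\<lambda>m3 y. env y m3"]])
          fix y assume "y \<in> set_pmf D"
          then show "env y (write_point n vA y m2)"
            using D I by (auto simp: cube_def env_def write_point_def)
        next
          fix m3 :: memory and y
          assume y: "env y m3" and fr3: "eq_off (mods (Sample vA)) m3 m2"
          have "m3 cr 0 = j"
            using fr3 j by simp
          with sim_Query_env[OF y, of "(f y, y)"] show "sim ?q m3 (return_pmf (f y, y)) ?post (n + 1) 1"
            by (elim sim_conseq) (auto simp: env_def write_entry_def)
        qed
        then show "sim (Seq (Sample vA) ?q) m2 (if fst s then return_pmf s else map_pmf (\<lambda>y. (f y, y)) D) ?post
            ((n + 1) + (n + 1)) (1 + 1)"
          using s by simp
      qed
    qed
  qed
  then show ?thesis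
    by (rule sim_conseq) (auto simp: algebra_simps)
qed

lemma sim_complement:
  assumes env: "env a m"
  shows "sim complement_com m (return_pmf ()) (\<lambda>m' _. env (flip a UNIV) m' \<and> m' vFd 0 = of_bool (f (flip a UNIV)))
    (4 * n + 3) 1"
proof -
  let ?s = "Store vA (rd ci) (notE (Read vA (rd ci)))"
  have "sim (For ci (rd 0) ?s) m (return_pmf ())
      (\<lambda>m' _. \<forall>i<n. m' vA i = of_bool (if i < n then \<not> a ! i else a ! i)) (2 + n * (1 + 2)) (n * 0)"
  proof (rule sim_For_det[where I = "\<lambda>j m'. \<forall>i<n. m' vA i = of_bool (if i < j then \<not> a ! i else a ! i)"])
    fix m' :: memory
    assume "eq_off (insert ci (mods ?s)) m' m"
    then show "eval_expr (rd 0) m' = n"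
      using env by (simp add: env_def)
  next
    show "\<forall>i<n. write_entry ci 0 0 m vA i = of_bool (if i < 0 then \<not> a ! i else a ! i)"
      using env by (simp add: env_def write_entry_def)
  next
    fix m' :: memory and j
    assume "\<forall>i<n. m' vA i = of_bool (if i < j then \<not> a ! i else a ! i)" "j < n" "m' ci 0 = j"
    then show "sim ?s m' (return_pmf ())
        (\<lambda>m'' _. (\<forall>i<n. write_entry ci 0 (Suc j) m'' vA i = of_bool (if i < Suc j then \<not> a ! i else a ! i)) \<and> m'' ci 0 = j) 1 0"
      by (intro sim_Store) (auto simp: write_entry_def less_Suc_eq)
  qed
  then have "sim complement_com m (return_pmf ()) (\<lambda>m' _. env (flip a UNIV) m' \<and> m' vFd 0 = of_bool (f (flip a UNIV)))
      ((2 + n * (1 + 2)) + (n + 1)) (n * 0 + 1)"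
    unfolding complement_com_def
  proof (rule sim_Seq_det)
    fix m' :: memory
    assume "\<forall>i<n. m' vA i = of_bool (if i < n then \<not> a ! i else a ! i)"
      and "eq_off (mods (For ci (rd 0) ?s)) m' m"
    then have "env (flip a UNIV) m'"
      using env by (simp add: env_def)
    then show "sim (Query vFd (Const 0) vA) m' (return_pmf ())
        (\<lambda>m' _. env (flip a UNIV) m' \<and> m' vFd 0 = of_bool (f (flip a UNIV))) (n + 1) 1"
      by (rule sim_Query_env)
  qed
  then show ?thesis
    by (rule sim_conseq) auto
qed

definition tester_time :: "nat \<Rightarrow> nat \<Rightarrow> nat" where
  "tester_time K E = 1 + ((n + 3 + 5 * E * (2 * n + 5)) + ((4 * n + 3 + 1 + 1) + (verify_time K (levels K) E + 1))) + 1"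

definition tester_queries :: "nat \<Rightarrow> nat \<Rightarrow> nat" where
  "tester_queries K E = (1 + 5 * E * 2) + (1 + verify_queries K (levels K) E)"

lemma sim_tester:
  fixes k p q :: nat
  assumes D: "set_pmf D \<subseteq> cube n" and "0 < p" "p \<le> q"
  defines "E \<equiv> q div p + 1" and "K \<equiv> min k n"
  shows "sim tester_com (mem (init n k p q)) (tester k (levels K) K E) (\<lambda>m' b. m' 4 0 = of_bool b)
    (tester_time K E) (tester_queries K E)"
proof -
  let ?co = "\<lambda>s. flip (snd (s :: bool \<times> bool list)) UNIV"
  let ?T1 = "4 * n + 3 + 1 + 1"
  define m where "m = mem (init n k p q)"
  have m: "m 0 0 = n" "m 1 0 = k" "m 2 0 = p" "m 3 0 = q" "\<And>x. 4 \<le> x \<Longrightarrow> m x = (\<lambda>_. 0)"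
    by (auto simp: m_def init_def)
  let ?l = "levels K" and ?Tv = "verify_time K (levels K) E" and ?Nv = "verify_queries K (levels K) E"
  let ?post = "\<lambda>m' b. m' 4 0 = of_bool b"
  let ?c1 = "Cond (rd vFd) Skip no_positive_com" and ?c2 = "Cond (rd vFd) verify_com Skip"
  let ?W = "\<lambda>s. if f (?co s) then verify (?co s) ?l K E else return_pmf False"
  let ?V = "\<lambda>s. if fst s then verify (snd s) ?l K E
     else if k < 2 \<or> n = 0 then
       if f (?co s) then verify (?co s) ?l K E else return_pmf False
     else return_pmf True"
  \<comment> \<open>Neither \<open>vMK\<close> nor \<open>vC\<close> is among the changed arrays, so
    the discovery starts from the empty colouring.\<close>
  have final_verify: "sim ?c2 m' (verify a ?l K E) ?post (?Tv + 1) ?Nv"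
    if "env a m'" "m' vFd 0 = 1" and fr: "eq_off {vE, vFd, cr, vA, ci} m' m" "m' vE 0 = E" for a m'
    using that m unfolding K_def by (intro sim_Cond sim_verify[OF D]) (simp_all add: fr)
  \<comment> \<open>Without a positive point the answer is already in place: a 1 stored by
    \<open>no_positive_com\<close>, or the initial 0 if the complement is negative too.\<close>
  have final_skip: "sim ?c2 m' (return_pmf b) ?post (?Tv + 1) ?Nv"
    if "m' vFd 0 = 0" "m' 4 0 = of_bool b" for m' b
  proof (rule sim_Cond)
    have "sim Skip m' (return_pmf b) ?post 1 0"
      using that by (intro sim_Skip) simp
    then show "sim Skip m' (return_pmf b) ?post ?Tv ?Nv"
      by (rule sim_conseq) (auto simp: verify_time_def)
  qed (use that in simp)
  have rest: "sim (Seq ?c1 ?c2) m' (?V s) ?post (?T1 + (?Tv + 1)) (1 + ?Nv)"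
    if s: "env (snd s) m'" "m' vFd 0 = of_bool (fst s)"
      and fr: "eq_off {vE, vFd, cr, vA} m' m" "m' vE 0 = E" for m' s
  proof (cases "fst s")
    case True
    have "sim Skip m' (return_pmf ()) (\<lambda>m'' _. m'' = m') 1 0"
      by (intro sim_Skip) simp
    then have "sim Skip m' (return_pmf ()) (\<lambda>m'' _. m'' = m') (4 * n + 3 + 1) 1"
      by (rule sim_conseq) auto
    then have "sim ?c1 m' (return_pmf ()) (\<lambda>m'' _. m'' = m') ?T1 1"
      using True s(2) by (intro sim_Cond) simp_all
    then have "sim (Seq ?c1 ?c2) m' (verify (snd s) ?l K E) ?post (?T1 + (?Tv + 1)) (1 + ?Nv)"
    proof (rule sim_Seq_det)
      fix m'' assume e: "m'' = m'"
      show "sim ?c2 m'' (verify (snd s) ?l K E) ?post (?Tv + 1) ?Nv"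
        unfolding e using True s fr by (intro final_verify) simp_all
    qed
    then show ?thesis using True by simp
  next
    case False
    have fd: "m' vFd 0 = 0"
      using s(2) False by simp
    show ?thesis
    proof (cases "k < 2 \<or> n = 0")
      case True
      have "sim ?c1 m' (return_pmf ()) (\<lambda>m'' _. env (?co s) m'' \<and> m'' vFd 0 = of_bool (f (?co s)) \<and>
          (eq_off {vFd, ci, vA} m'' m')) ?T1 1"
        unfolding no_positive_com_def
      proof (rule sim_Cond, use fd in simp, rule sim_Cond)
        show "sim complement_com m' (return_pmf ()) (\<lambda>m'' _. env (?co s) m'' \<and> m'' vFd 0 = of_bool (f (?co s)) \<and>
          (eq_off {vFd, ci, vA} m'' m')) (4 * n + 3) 1"
          by (rule sim_conseq[OF sim_complement[OF s(1)]]) simp_all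
      qed (use True m fr in auto)
      then have "sim (Seq ?c1 ?c2) m' (?W s) ?post
          (?T1 + (?Tv + 1)) (1 + ?Nv)"
      proof (rule sim_Seq_det)
        fix m'' :: memory
        assume m'': "env (?co s) m'' \<and> m'' vFd 0 = of_bool (f (?co s)) \<and>
          (eq_off {vFd, ci, vA} m'' m')"
        show "sim ?c2 m'' (?W s) ?post (?Tv + 1) ?Nv"
        proof (cases "f (?co s)")
          case True
          have "sim ?c2 m'' (verify (?co s) ?l K E) ?post (?Tv + 1) ?Nv"
            using m'' True fr by (intro final_verify) simp_all
          then show ?thesis using True by simp
        next
          case False
          have "sim ?c2 m'' (return_pmf False) ?post (?Tv + 1) ?Nv"
            using m'' False fr m(5)[of 4] by (intro final_skip) simp_all
          then show ?thesis using False by simp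
        qed
      qed
      then show ?thesis using True False by simp
    next
      case big: False
      have "sim (setv 4 (Const 1)) m' (return_pmf ()) (\<lambda>m'' _. m'' 4 0 = 1 \<and> m'' vFd 0 = 0) 1 0"
        using fd by (intro sim_Store) (simp add: write_entry_def)
      then have "sim (setv 4 (Const 1)) m' (return_pmf ()) (\<lambda>m'' _. m'' 4 0 = 1 \<and> m'' vFd 0 = 0) (4 * n + 3) 1"
        by (rule sim_conseq) auto
      then have "sim ?c1 m' (return_pmf ()) (\<lambda>m'' _. m'' 4 0 = 1 \<and> m'' vFd 0 = 0) ?T1 1"
        unfolding no_positive_com_def
        using fd big m fr by (intro sim_Cond) auto
      then have "sim (Seq ?c1 ?c2) m' (return_pmf True) ?post (?T1 + (?Tv + 1)) (1 + ?Nv)"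
      proof (rule sim_Seq_det)
        fix m'' :: memory
        assume "m'' 4 0 = 1 \<and> m'' vFd 0 = 0"
        then show "sim ?c2 m'' (return_pmf True) ?post (?Tv + 1) ?Nv"
          by (intro final_skip) simp_all
      qed
      then show ?thesis using big False by auto
    qed
  qed
  have "sim (Seq find_com (Seq ?c1 ?c2)) m' (tester k ?l K E) ?post
      ((n + 3 + 5 * E * (2 * n + 5)) + (?T1 + (?Tv + 1))) ((1 + 5 * E * 2) + (1 + ?Nv))"
    if fr: "eq_off {vE} m' m" "m' vE 0 = E" for m'
    unfolding tester_def
  proof (rule sim_Seq[OF sim_find[OF D, where m = m']])
    fix m'' :: memory and s
    assume s: "env (snd s) m'' \<and> m'' vFd 0 = of_bool (fst s)" and fr': "eq_off (mods find_com) m'' m'"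
    show "sim (Seq ?c1 ?c2) m'' (?V s) ?post (?T1 + (?Tv + 1)) (1 + ?Nv)"
      using s fr by (intro rest) (simp_all add: fr')
  qed (use fr m in simp_all)
  then have "sim (Seq (setv vE (Add (Div (rd 3) (rd 2)) (Const 1))) (Seq find_com (Seq ?c1 ?c2))) m (tester k ?l K E) ?post
      (1 + ((n + 3 + 5 * E * (2 * n + 5)) + (?T1 + (?Tv + 1)))) (0 + ((1 + 5 * E * 2) + (1 + ?Nv)))"
    by (intro sim_Seq_det[OF sim_Store[where x = "()" and Q = "\<lambda>m' _. m' vE 0 = E"]])
      (simp_all add: write_entry_def m E_def)
  then have "sim tester_com m (tester k ?l K E) ?post
      (1 + ((n + 3 + 5 * E * (2 * n + 5)) + (?T1 + (?Tv + 1))) + 1) (0 + ((1 + 5 * E * 2) + (1 + ?Nv)))"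
    unfolding tester_com_def using assms(3) m by (intro sim_Cond) simp_all
  then show ?thesis
    unfolding m_def[symmetric] tester_time_def tester_queries_def by (rule sim_conseq) auto
qed

lemma sim_tester_trivial:
  assumes "q < p"
  shows "sim tester_com (mem (init n k p q)) (return_pmf True) (\<lambda>m' b. m' 4 0 = of_bool b) 2 0"
proof -
  have "sim tester_com (mem (init n k p q)) (return_pmf True) (\<lambda>m' b. m' 4 0 = of_bool b) (1 + 1) 0"
    unfolding tester_com_def
    using assms by (intro sim_Cond sim_Store) (auto simp: write_entry_def init_def)
  then show ?thesis
    by (rule sim_conseq) auto
qed

end

section \<open>Time, queries and correctness\<close>

lemma log2_up_le_log: "1 \<le> K \<Longrightarrow> real (log2_up K) \<le> 1 + log 2 (real K)"
proof (cases "log2_up K")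
  case (Suc i)
  assume K: "1 \<le> K"
  have "2 ^ i < K"
    by (rule two_power_less) (simp add: Suc)
  then have "real (2 ^ i) \<le> real K"
    by linarith
  then have "log 2 (real (2 ^ i)) \<le> log 2 (real K)"
    using K by (subst log_le_cancel_iff) auto
  then show ?thesis
    by (simp add: Suc log_nat_power)
qed simp

context testing
begin

text \<open>A coupling preserves total mass, relates the supports, and does not decrease the measure
  of an event when passing to the related configurations; these facts give termination, the bounds
  for every run, and the two probabilities.\<close>

lemma sim_exec:
  assumes sim: "sim c (mem s) M (\<lambda>m b. m 4 0 = of_bool b) T N"
  shows "lossless_spmf (exec n f D c s)"
    and "s' \<in> set_spmf (exec n f D c s) \<Longrightarrow> time s' \<le> time s + T \<and> queries s' \<le> queries s + N"
    and "prob M {True} \<le> measure (measure_spmf (exec n f D c s)) {s. accepting s}"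
    and "prob M {False} \<le> measure (measure_spmf (exec n f D c s)) {s. \<not> accepting s}"
proof -
  let ?R = "\<lambda>s' b. mem s' 4 0 = of_bool b \<and> eq_off (mods c) (mem s') (mem s) \<and>
      time s' \<le> time s + T \<and> queries s' \<le> queries s + N"
  have R: "rel_spmf ?R (exec n f D c s) (spmf_of_pmf M)"
    using sim by (simp add: sim_def)
  show "lossless_spmf (exec n f D c s)"
    using rel_spmf_weightD[OF R] by (simp add: lossless_spmf_def)
  have "rel_set (rel_option ?R) (set_pmf (exec n f D c s)) (set_pmf (spmf_of_pmf M))"
    by (rule rel_pmf_imp_rel_set[OF R])
  then show "time s' \<le> time s + T \<and> queries s' \<le> queries s + N" if "s' \<in> set_spmf (exec n f D c s)"
    using that by (fastforce simp: in_set_spmf rel_set_def option_rel_Some1)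
  \<comment> \<open>Events are transported from the first to the second component, so the coupling
    is reversed to start from \<open>M\<close>.\<close>
  have R': "rel_spmf ?R\<inverse>\<inverse> (spmf_of_pmf M) (exec n f D c s)"
    using R by (simp add: spmf_rel_conversep)
  show "prob M {True} \<le> measure (measure_spmf (exec n f D c s)) {s. accepting s}"
    using rel_spmf_measureD[OF R', of "{True}"]
    by (rule order_trans[OF eq_refl, rotated 1, OF order_trans[OF _ measure_spmf.finite_measure_mono]])
      (auto simp: accepting_def)
  show "prob M {False} \<le> measure (measure_spmf (exec n f D c s)) {s. \<not> accepting s}"
    using rel_spmf_measureD[OF R', of "{False}"]
    by (rule order_trans[OF eq_refl, rotated 1, OF order_trans[OF _ measure_spmf.finite_measure_mono]])
      (auto simp: accepting_def)
qed

text \<open>For polynomial time, the number of levels may be estimated linearly in n + 1, and every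
  summand by a multiple of E (n + 1)^3. The dominant contribution is that of the discovery,
  69000.\<close>

lemma tester_time_le:
  assumes K: "K \<le> n" and E: "1 \<le> E"
  shows "tester_time K E \<le> 80000 * (E * (n + 1) ^ 3)"
proof -
  define X where "X = n + 1"
  define l where "l = levels K"
  have X: "n \<le> X" "1 \<le> X" "K \<le> X"
    using K by (simp_all add: X_def)
  have l: "l \<le> 7 * X"
    using log2_up_le[of K] X by (simp add: l_def levels_def)
  have X2: "X \<le> X * X" and X3: "X * X \<le> X * (X * X)"
    using X(2) by simp_all
  have E3: "X * (X * X) \<le> E * (X * (X * X))"
    using E by simp
  have b1: "l * (4 * n + 8) \<le> (7 * X) * (8 * X)"
    using l X by (intro mult_le_mono) (auto simp: X_def)
  then have "l * (4 * n + 8) \<le> 56 * (X * X)"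
    by simp
  moreover have "5 * n + 13 \<le> 13 * X"
    by (simp add: X_def)
  ultimately have "5 * n + 13 + l * (4 * n + 8) \<le> 69 * (X * X)"
    using X2 by linarith
  then have "K * (1000 * E) * (5 * n + 13 + l * (4 * n + 8)) \<le> X * (1000 * E) * (69 * (X * X))"
    using X by (intro mult_le_mono) auto
  then have t1: "K * (1000 * E) * (5 * n + 13 + l * (4 * n + 8)) \<le> 69000 * (E * (X * (X * X)))"
    by (simp add: mult_ac)
  have "K * (28 * n + 28) \<le> X * (28 * X)"
    using X by (intro mult_le_mono) (auto simp: X_def)
  then have "K * (28 * n + 28) \<le> 28 * (X * X)"
    by simp
  moreover have "11 * n + 15 \<le> 15 * X"
    by (simp add: X_def)
  ultimately have "11 * n + 15 + K * (28 * n + 28) \<le> 43 * (X * X)"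
    using X2 by linarith
  then have "100 * E * (11 * n + 15 + K * (28 * n + 28)) \<le> 100 * E * (43 * (X * X))"
    by (rule mult_le_mono2)
  also have "\<dots> \<le> 4300 * (E * (X * (X * X)))"
    using X3 by simp
  finally have t2: "100 * E * (11 * n + 15 + K * (28 * n + 28)) \<le> 4300 * (E * (X * (X * X)))" .
  have "n * (6 + l * 4) \<le> X * (34 * X)"
    using X l by (intro mult_le_mono) auto
  have t3: "n * (6 + l * 4) \<le> 34 * (E * (X * (X * X)))"
  proof -
    have "n * (6 + l * 4) \<le> 34 * (X * X)"
      using \<open>n * (6 + l * 4) \<le> X * (34 * X)\<close> by simp
    then show ?thesis
      using X3 E3 by linarith
  qed
  have "5 * E * (2 * n + 5) \<le> 5 * E * (5 * X)"
    by (intro mult_le_mono2) (simp add: X_def)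
  also have "\<dots> \<le> 25 * (E * (X * (X * X)))"
    using X2 X3 by simp
  finally have t4: "5 * E * (2 * n + 5) \<le> 25 * (E * (X * (X * X)))" .
  have t5: "1 \<le> E * (X * (X * X))" "n \<le> E * (X * (X * X))" "K \<le> E * (X * (X * X))"
    using X X2 X3 E3 by linarith+
  have "tester_time K E \<le> 80000 * (E * (X * (X * X)))"
    unfolding tester_time_def verify_time_def l_def[symmetric]
    using t1 t2 t3 t4 t5 by linarith
  then show ?thesis
    by (simp add: X_def power3_eq_cube mult_ac)
qed

text \<open>As \<epsilon> is at most 2, \<open>k\<close> is at most twice
  \<open>k / \<epsilon>\<close>, so the logarithm of \<open>K\<close> is bounded by that of
  \<open>2 + k / \<epsilon>\<close>. The constant comes from 912 + 13000 and the factor 4 in the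
  bound on \<open>E\<close>.\<close>

lemma tester_queries_le:
  assumes k: "1 \<le> k" and \<epsilon>: "0 < \<epsilon>" "\<epsilon> \<le> 2" and E: "1 \<le> E" "real E \<le> 4 / \<epsilon>" and K: "K \<le> k"
  shows "real (tester_queries K E) \<le> 60000 * (real k / \<epsilon>) * log 2 (2 + real k / \<epsilon>)"
proof -
  let ?T = "real k / \<epsilon>"
  define L where "L = log 2 (2 + ?T)"
  have T: "real k \<le> 2 * ?T"
    using k \<epsilon> by (simp add: field_simps mult_left_mono)
  have "0 \<le> ?T" using \<epsilon> by simp
  then have L1: "1 \<le> L"
    using log_le_cancel_iff[of 2 2 "2 + ?T"] by (simp add: L_def)
  have lk: "real (log2_up K) \<le> 2 + L"
  proof (cases "K = 0")
    case True
    then show ?thesis using L1 log2_up_le[of K] by simp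
  next
    case False
    have "log 2 (real K) \<le> log 2 (2 * (2 + ?T))"
      using False K T \<open>0 \<le> ?T\<close> by (subst log_le_cancel_iff) auto
    also have "\<dots> = 1 + L"
      using \<open>0 \<le> ?T\<close> by (subst log_mult) (auto simp: L_def)
    finally show ?thesis
      using log2_up_le_log[of K] False by simp
  qed
  then have l: "2 + real (levels K) \<le> 13 * L"
    using L1 by (simp add: levels_def)
  have kE: "real k * real E \<le> 4 * ?T"
    using mult_left_mono[OF E(2), of "real k"] by (simp add: mult.commute)
  have k1: "1 \<le> real k" using k by simp
  have E1: "1 \<le> real E" using E(1) by simp
  have EkE: "real E \<le> real k * real E"
    using k1 by (simp add: mult_le_cancel_right1)
  have "real K * (1000 * real E) * (2 + real (levels K)) \<le> real k * (1000 * real E) * (13 * L)"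
    using K l L1 by (intro mult_mono) auto
  also have "\<dots> = 13000 * (real k * real E * L)"
    by (simp add: mult_ac)
  finally have "real K * (1000 * real E) * (2 + real (levels K)) \<le> 13000 * (real k * real E * L)" .
  moreover have "100 * real E * (2 + real K * 7) \<le> 900 * (real k * real E)"
  proof -
    have "2 + real K * 7 \<le> 9 * real k"
      using K k by simp
    from mult_left_mono[OF this, of "100 * real E"] show ?thesis
      by (simp add: mult_ac)
  qed
  moreover have "real (tester_queries K E) = 2 + 10 * real E + (real K * (1000 * real E) * (2 + real (levels K)) +
      100 * real E * (2 + real K * 7))"
    by (simp add: tester_queries_def verify_queries_def algebra_simps)
  ultimately have "real (tester_queries K E) \<le> 912 * (real k * real E) + 13000 * (real k * real E * L)"
    using E1 EkE by linarith
  moreover have "real k * real E \<le> real k * real E * L"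
    using mult_left_mono[OF L1, of "real k * real E"] by simp
  moreover have "real k * real E * L \<le> 4 * ?T * L"
    using kE L1 by (intro mult_right_mono) auto
  moreover have "0 \<le> ?T * L"
    using \<open>0 \<le> ?T\<close> L1 by (intro mult_nonneg_nonneg) auto
  ultimately have "real (tester_queries K E) \<le> 60000 * (?T * L)"
    by linarith
  then show ?thesis
    by (simp add: L_def mult.assoc)
qed

end

text \<open>The successor of the rounded quotient lies strictly above q/p, hence above 1/\<epsilon>.
  As p \<le> q, it is at most 2 q/p, and the imprecision of the representation costs another factor
  2.\<close>

lemma div_Suc_bounds:
  assumes "represents p q \<epsilon>" "p \<le> q"
  shows "1 / real (q div p + 1) < \<epsilon>" "2 \<le> q div p + 1" "real (q div p + 1) \<le> 4 / \<epsilon>" "\<epsilon> \<le> 2" "0 < \<epsilon>"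
proof -
  have p: "0 < p" "0 < q" and le: "real p / real q \<le> \<epsilon>" "\<epsilon> \<le> 2 * (real p / real q)"
    using assms(1) by (simp_all add: represents_def)
  show "0 < \<epsilon>"
    using p le(1) by (meson divide_pos_pos less_le_trans of_nat_0_less_iff)
  have "q < (q div p + 1) * p"
    using p(1) dividend_less_div_times[of p q] by simp
  then have "real q < real (q div p + 1) * real p"
    unfolding of_nat_mult[symmetric] of_nat_less_iff .
  then have "1 / real (q div p + 1) < real p / real q"
    using p by (simp add: field_simps)
  with le(1) show "1 / real (q div p + 1) < \<epsilon>" by simp
  have "1 \<le> q div p"
    using div_le_mono[OF assms(2), of p] p(1) by simp
  then show "2 \<le> q div p + 1" by simp
  have pq: "real p / real q \<le> 1"
    using p assms(2) by simp
  then show "\<epsilon> \<le> 2"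
    using le(2) by simp
  have "real (q div p) \<le> real q / real p"
  proof -
    have "real (q div p) * real p \<le> real q"
      unfolding of_nat_mult[symmetric] of_nat_le_iff by (rule div_times_less_eq_dividend)
    then show ?thesis
      using p by (simp add: le_divide_eq)
  qed
  moreover have "1 \<le> real q / real p"
    using p assms(2) by simp
  ultimately have "real (q div p + 1) \<le> 2 * (real q / real p)"
    by simp
  also have "\<dots> \<le> 4 / \<epsilon>"
    using le(2) p \<open>0 < \<epsilon>\<close> by (simp add: field_simps)
  finally show "real (q div p + 1) \<le> 4 / \<epsilon>" .
qed

theorem theorem8:
  shows "\<exists>A B. two_sided_distribution_free_tester A k_Term \<and>
           polynomial_time A \<and>
           B \<in> soft_O (\<lambda>k \<epsilon>. real k / \<epsilon>) \<and> query_bound A B"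
proof (intro exI conjI)
  define B where "B = (\<lambda>k \<epsilon>. 60000 * (real k / \<epsilon>) * log 2 (2 + real k / \<epsilon>))"
  have B0: "0 \<le> B k \<epsilon>" if "0 < \<epsilon>" for k \<epsilon>
  proof -
    have "0 \<le> log 2 (2 + real k / \<epsilon>)"
      using that by (subst zero_le_log_cancel_iff) (auto intro: add_increasing2 add_pos_nonneg)
    then show ?thesis
      using that by (simp add: B_def)
  qed
  have trivial: "testing.sim n f D tester_com (mem (init n k p q)) (return_pmf True) (\<lambda>m' b. m' 4 0 = of_bool b) 2 0"
    if "q < p" for n k p q f D
    by (rule testing.sim_tester_trivial[OF that])
  have main: "testing.sim n f D tester_com (mem (init n k p q))
      (testing.tester n f D k (levels (min k n)) (min k n) (q div p + 1)) (\<lambda>m' b. m' 4 0 = of_bool b)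
      (testing.tester_time n (min k n) (q div p + 1)) (testing.tester_queries (min k n) (q div p + 1))"
    if "represents p q \<epsilon>" "p \<le> q" "set_pmf D \<subseteq> cube n" for n k p q f D \<epsilon>
    using that by (intro testing.sim_tester) (auto simp: represents_def)
  show "two_sided_distribution_free_tester tester_com k_Term"
    unfolding two_sided_distribution_free_tester_def
  proof (intro allI impI conjI)
    fix n k :: nat and \<epsilon> :: real and p q :: nat and f :: "bool list \<Rightarrow> bool" and D :: "bool list pmf"
    assume k: "1 \<le> k" and rep: "represents p q \<epsilon>" and D: "set_pmf D \<subseteq> cube n"
    let ?T = "testing.tester n f D k (levels (min k n)) (min k n) (q div p + 1)"
    {
      assume f: "f \<in> k_Term n k"
      show "2 / 3 \<le> measure (measure_spmf (run tester_com n k p q f D)) {s. accepting s}"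
      proof (cases "p \<le> q")
        case True
        have "prob ?T {False} \<le> 1 / 3"
          by (rule testing.tester_completeness[OF D k f levels_ge]) simp
        then have "2 / 3 \<le> prob ?T {True}"
          by (simp add: prob_False_conv)
        with testing.sim_exec(3)[OF main[OF rep True D]] show ?thesis
          unfolding run_def by (rule order_trans[rotated])
      next
        case False
        then show ?thesis
          using testing.sim_exec(3)[OF trivial, of q p n f D k] unfolding run_def by simp
      qed
    next
      assume far: "eps_far D \<epsilon> (k_Term n k) f"
      show "2 / 3 \<le> measure (measure_spmf (run tester_com n k p q f D)) {s. \<not> accepting s}"
      proof (cases "p \<le> q")
        case True
        note E = div_Suc_bounds[OF rep True]
        have "prob ?T {True} \<le> 1 / 3"
          by (rule testing.tester_soundness[OF D k _ far E(1,2)]) simp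
        then have "2 / 3 \<le> prob ?T {False}"
          by (simp add: prob_False_conv)
        with testing.sim_exec(4)[OF main[OF rep True D]] show ?thesis
          unfolding run_def by (rule order_trans[rotated])
      next
        case False
        \<comment> \<open>The empty conjunction has distance at most 1 from \<open>f\<close>, so
          \<epsilon> \<le> 1, which contradicts \<open>q < p\<close>.\<close>
        have "(\<lambda>_. True) \<in> k_Term n k"
          by (auto simp: k_Term_def intro: exI[of _ "{}"])
        then have "\<epsilon> \<le> prob D {x. f x \<noteq> True}"
          using far[unfolded eps_far_def, THEN bspec] by blast
        also have "\<dots> \<le> 1" by simp
        finally have "\<epsilon> \<le> 1" .
        moreover have "real p / real q \<le> \<epsilon>"
          using rep by (simp add: represents_def)
        ultimately have "real p / real q \<le> 1"
          by linarith
        then have False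
          using False rep by (simp add: represents_def)
        then show ?thesis ..
      qed
    }
  qed
  show "polynomial_time tester_com"
    unfolding polynomial_time_def
  proof (intro exI allI impI)
    fix n k :: nat and \<epsilon> :: real and p q :: nat and f :: "bool list \<Rightarrow> bool" and D :: "bool list pmf"
    assume k: "1 \<le> k" and \<epsilon>: "0 < \<epsilon>" and rep: "represents p q \<epsilon>" and D: "set_pmf D \<subseteq> cube n"
    let ?bound = "real 320000 * (real n + 1 / \<epsilon> + 1) ^ 4"
    have base: "1 \<le> real n + 1 / \<epsilon> + 1"
      using \<epsilon> by simp
    show "lossless_spmf (run tester_com n k p q f D) \<and>
        (\<forall>s\<in>set_spmf (run tester_com n k p q f D). real (time s) \<le> ?bound)"
    proof (cases "p \<le> q")
      case True
      note E = div_Suc_bounds[OF rep True]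
      let ?E = "q div p + 1"
      note sim = testing.sim_exec(1,2)[OF main[OF rep True D]]
      have "real (time s) \<le> ?bound" if "s \<in> set_spmf (run tester_com n k p q f D)" for s
      proof -
        have "time s \<le> testing.tester_time n (min k n) ?E"
          using sim(2) that by (simp add: run_def init_def)
        also have "\<dots> \<le> 80000 * (?E * (n + 1) ^ 3)"
          by (rule testing.tester_time_le) auto
        finally have "real (time s) \<le> real (80000 * (?E * (n + 1) ^ 3))"
          by (simp only: of_nat_le_iff)
        also have "\<dots> = 80000 * (real ?E * (real n + 1) ^ 3)"
          by (simp only: of_nat_mult of_nat_power of_nat_add of_nat_1 of_nat_numeral)
        \<comment> \<open>Both 1/\<epsilon> and n + 1 are below the base, so
          \<open>E \<le> 4 / \<epsilon>\<close> contributes the factor 4 and the fourth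
          power.\<close>
        also have "\<dots> \<le> 80000 * ((4 * (real n + 1 / \<epsilon> + 1)) * (real n + 1 / \<epsilon> + 1) ^ 3)"
          using E(3) \<epsilon> by (intro mult_left_mono mult_mono power_mono) auto
        also have "\<dots> = ?bound"
          by (simp add: power_numeral_reduce)
        finally show ?thesis .
      qed
      then show ?thesis
        using sim(1) by (simp add: run_def)
    next
      case False
      from False have "q < p" by simp
      note sim = testing.sim_exec(1,2)[OF trivial[OF this, of n f D k]]
      have "real (time s) \<le> ?bound" if "s \<in> set_spmf (run tester_com n k p q f D)" for s
      proof -
        have "real (time s) \<le> 320000 * 1"
          using sim(2)[of s] False that by (simp add: run_def init_def)
        also have "\<dots> \<le> ?bound"
          using base by (intro mult_mono one_le_power) auto
        finally show ?thesis .
      qed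
      then show ?thesis
        using sim(1) False by (simp add: run_def)
    qed
  qed
  show "B \<in> soft_O (\<lambda>k \<epsilon>. real k / \<epsilon>)"
    unfolding soft_O_def B_def by (intro CollectI exI[of _ 60000] exI[of _ 1]) simp
  show "query_bound tester_com B"
    unfolding query_bound_def
  proof (intro allI impI ballI)
    fix n k :: nat and \<epsilon> :: real and p q :: nat and f :: "bool list \<Rightarrow> bool" and D :: "bool list pmf" and s
    assume k: "1 \<le> k" and \<epsilon>: "0 < \<epsilon>" and rep: "represents p q \<epsilon>" and D: "set_pmf D \<subseteq> cube n"
      and s: "s \<in> set_spmf (run tester_com n k p q f D)"
    show "real (queries s) \<le> B k \<epsilon>"
    proof (cases "p \<le> q")
      case True
      note E = div_Suc_bounds[OF rep True]
      have "queries s \<le> testing.tester_queries (min k n) (q div p + 1)"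
        using testing.sim_exec(2)[OF main[OF rep True D]] s by (simp add: run_def init_def)
      then have "real (queries s) \<le> real (testing.tester_queries (min k n) (q div p + 1))"
        by simp
      also have "\<dots> \<le> B k \<epsilon>"
        unfolding B_def by (rule testing.tester_queries_le[OF k \<epsilon> E(4) _ E(3)]) auto
      finally show ?thesis .
    next
      case False
      then have "q < p" by simp
      then have "queries s = 0"
        using testing.sim_exec(2)[OF trivial[of q p n f D k]] s by (simp add: run_def init_def)
      then show ?thesis
        using B0[OF \<epsilon>] by simp
    qed
  qed
qed

end
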